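(* Let ${}_AE_A$ and ${}_BD_B$ be the $W^*$-graph correspondences associated to directed graphs $G=(G^0,G^1,s_1,r_1)$ and $F=(F^0,F^1,s_2,r_2)$ respectively. Then ${}_AE_A$ and ${}_BD_B$ are (weakly) Morita equivalent if and only if $G\cong F$.
   Context: **Correspondences.** A right $W^*$-module is a right $C^*$-module over a $W^*$-algebra that is selfdual (every bounded module map into the algebra has the form $\langle y,\cdot\rangle$). An $A$-$B$ $W^*$-correspondence is a right $W^*$-module $E$ over $B$ with a unital normal $*$-homomorphism of $A$ into the adjointable operators $\mathscr L_B(E)$. $\overline\otimes_A$ is the $W^*$-module tensor product: the selfdual (weak$^*$) completion of the interior tensor product, with $\langle x_1\otimes y_1,x_2\otimes y_2\rangle=\langle y_1,\langle x_1,x_2\rangle\cdot y_2\rangle$. **Graph correspondences.** A directed graph $G=(G^0,G^1,s,r)$ consists of countable sets $G^0$ (vertices), $G^1$ (edges) and source and range maps $s,r:G^1\to G^0$. Its $W^*$-correspondence $(E,A)$ is $A=\ell^\infty(G^0)$, $E=\{x:G^1\to\mathbb C:\sup_{v\in G^0}\sum_{s(e)=v}|x(e)|^2<\infty\}$, with $(a\cdot x\cdot b)(e)=a(r(e))x(e)b(s(e))$ and $\langle x,y\rangle_A(v)=\sum_{s(e)=v}\overline{x(e)}y(e)$. **Graph isomorphism.** $G\cong F$ means there are bijections $\alpha:G^1\to F^1$ and $\beta:G^0\to F^0$ with $s_2(\alpha(e))=\beta(s_1(e))$ and $r_2(\alpha(e))=\beta(r_1(e))$ for all $e\in G^1$.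 **Morita equivalence.** An $A$-$B$ $W^*$-equivalence bimodule is an $A$-$B$ bimodule $X$ that is a $w^*$-full right $W^*$-module over $B$ and a $w^*$-full left $W^*$-module over $A$, each algebra acting by adjointable operators with respect to the inner product valued in the other, with ${}_A\langle x,y\rangle\cdot z=x\cdot\langle y,z\rangle_B$. ${}_AE_A$ and ${}_BD_B$ are (weakly) Morita equivalent if there are such an $X$ and an $A$-$B$ $W^*$-correspondence isomorphism (bijective linear bimodule map preserving $B$-valued inner products) from $X\overline\otimes_BD$ onto $E\overline\otimes_AX$. *)

theory Defs
  imports
    "HOL-Analysis.Analysis"
    "HOL-Algebra.Module"
    "Graph_Theory.Digraph"
begin

section \<open>Complex vector spaces\<close>

definition complex_ring :: "complex ring"
  where "complex_ring = \<lparr>carrier = UNIV, mult = (*), one = 1, zero = 0, add = (+)\<rparr>"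

definition lin_span :: "(complex, 'x, 'm) module_scheme \<Rightarrow> 'x set \<Rightarrow> 'x set"
  where "lin_span M S = \<Inter>{H. submodule H complex_ring M \<and> S \<subseteq> H}"

definition weak_topology :: "'x set \<Rightarrow> ('x \<Rightarrow> complex) set \<Rightarrow> 'x topology"
  where "weak_topology S \<Phi> = topology_generated_by {{x \<in> S. \<phi> x \<in> U} | \<phi> U. \<phi> \<in> \<Phi> \<and> open U}"

definition norm_complete :: "(complex, 'x, 'm) module_scheme \<Rightarrow> ('x \<Rightarrow> real) \<Rightarrow> bool"
  where "norm_complete M N \<longleftrightarrow> (\<forall>\<sigma> :: nat \<Rightarrow> 'x.
    range \<sigma> \<subseteq> carrier M \<and>
    (\<forall>\<epsilon> > 0. \<exists>k. \<forall>m \<ge> k. \<forall>n \<ge> k. N (\<sigma> m \<ominus>\<^bsub>M\<^esub> \<sigma> n) < \<epsilon>) \<longrightarrow>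
    (\<exists>x \<in> carrier M. (\<lambda>n. N (\<sigma> n \<ominus>\<^bsub>M\<^esub> x)) \<longlonglongrightarrow> 0))"

text \<open>Functionals are normalised to vanish off the carrier, so that equality of
  functionals is equality of functions.\<close>

definition dual_space :: "(complex, 'x, 'm) module_scheme \<Rightarrow> ('x \<Rightarrow> real) \<Rightarrow> ('x \<Rightarrow> complex) set"
  where "dual_space M N = {\<phi>.
    (\<forall>x. x \<notin> carrier M \<longrightarrow> \<phi> x = 0) \<and>
    (\<forall>x \<in> carrier M. \<forall>y \<in> carrier M. \<phi> (x \<oplus>\<^bsub>M\<^esub> y) = \<phi> x + \<phi> y) \<and>
    (\<forall>c. \<forall>x \<in> carrier M. \<phi> (c \<odot>\<^bsub>M\<^esub> x) = c * \<phi> x) \<and>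
    (\<exists>K. \<forall>x \<in> carrier M. cmod (\<phi> x) \<le> K * N x)}"

definition dual_norm :: "(complex, 'x, 'm) module_scheme \<Rightarrow> ('x \<Rightarrow> real) \<Rightarrow> ('x \<Rightarrow> complex) \<Rightarrow> real"
  where "dual_norm M N \<phi> = Sup {cmod (\<phi> x) | x. x \<in> carrier M \<and> N x \<le> 1}"


section \<open>\<open>C\<^sup>*\<close>-algebras and \<open>W\<^sup>*\<close>-algebras\<close>

record 'a cstar = "(complex, 'a) module" +
  star :: "'a \<Rightarrow> 'a"
  cnorm :: "'a \<Rightarrow> real"

locale cstar_algebra = ring A + vec: module complex_ring A
  for A :: "('a, 'm) cstar_scheme" (structure) +
  assumes smult_mult_left:
      "\<lbrakk>x \<in> carrier A; y \<in> carrier A\<rbrakk> \<Longrightarrow> (c \<odot> x) \<otimes> y = c \<odot> (x \<otimes> y)"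
    and smult_mult_right:
      "\<lbrakk>x \<in> carrier A; y \<in> carrier A\<rbrakk> \<Longrightarrow> x \<otimes> (c \<odot> y) = c \<odot> (x \<otimes> y)"
    and star_closed: "x \<in> carrier A \<Longrightarrow> star A x \<in> carrier A"
    and star_star: "x \<in> carrier A \<Longrightarrow> star A (star A x) = x"
    and star_add:
      "\<lbrakk>x \<in> carrier A; y \<in> carrier A\<rbrakk> \<Longrightarrow> star A (x \<oplus> y) = star A x \<oplus> star A y"
    and star_smult: "x \<in> carrier A \<Longrightarrow> star A (c \<odot> x) = cnj c \<odot> star A x"
    and star_mult:
      "\<lbrakk>x \<in> carrier A; y \<in> carrier A\<rbrakk> \<Longrightarrow> star A (x \<otimes> y) = star A y \<otimes> star A x"
    and cnorm_nonneg: "x \<in> carrier A \<Longrightarrow> 0 \<le> cnorm A x"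
    and cnorm_eq_0: "x \<in> carrier A \<Longrightarrow> cnorm A x = 0 \<longleftrightarrow> x = \<zero>"
    and cnorm_triangle:
      "\<lbrakk>x \<in> carrier A; y \<in> carrier A\<rbrakk> \<Longrightarrow> cnorm A (x \<oplus> y) \<le> cnorm A x + cnorm A y"
    and cnorm_smult: "x \<in> carrier A \<Longrightarrow> cnorm A (c \<odot> x) = cmod c * cnorm A x"
    and cnorm_mult:
      "\<lbrakk>x \<in> carrier A; y \<in> carrier A\<rbrakk> \<Longrightarrow> cnorm A (x \<otimes> y) \<le> cnorm A x * cnorm A y"
    and cstar_identity: "x \<in> carrier A \<Longrightarrow> cnorm A (star A x \<otimes> x) = (cnorm A x)\<^sup>2"
    and complete: "norm_complete A (cnorm A)"

definition positive_elements :: "('a, 'm) cstar_scheme \<Rightarrow> 'a set"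
  where "positive_elements A = {star A a \<otimes>\<^bsub>A\<^esub> a | a. a \<in> carrier A}"

text \<open>A \<open>W\<^sup>*\<close>-algebra is a \<open>C\<^sup>*\<close>-algebra that is the dual of a Banach space.  The predual is
  unique (Sakai), hence it can be carried along as a component of the structure; it is
  represented by its canonical image in the dual of the algebra.\<close>

record 'a wstar = "'a cstar" +
  predual :: "('a \<Rightarrow> complex) set"

definition opposite :: "('a, 'm) wstar_scheme \<Rightarrow> ('a, 'm) wstar_scheme"
  where "opposite A = A\<lparr>mult := (\<lambda>x y. y \<otimes>\<^bsub>A\<^esub> x)\<rparr>"

locale wstar_algebra = cstar_algebra A
  for A :: "('a, 'm) wstar_scheme" (structure) +
  assumes predual_subset: "predual A \<subseteq> dual_space A (cnorm A)"
    and predual_zero: "(\<lambda>_. 0) \<in> predual A"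
    and predual_add:
      "\<lbrakk>\<phi> \<in> predual A; \<psi> \<in> predual A\<rbrakk> \<Longrightarrow> (\<lambda>x. \<phi> x + \<psi> x) \<in> predual A"
    and predual_scale: "\<phi> \<in> predual A \<Longrightarrow> (\<lambda>x. c * \<phi> x) \<in> predual A"
    and predual_closed:
      "\<lbrakk>\<phi> \<in> dual_space A (cnorm A);
        \<And>\<epsilon>. \<epsilon> > 0 \<Longrightarrow> \<exists>\<psi> \<in> predual A. dual_norm A (cnorm A) (\<lambda>x. \<phi> x - \<psi> x) < \<epsilon>\<rbrakk>
       \<Longrightarrow> \<phi> \<in> predual A"
    and predual_isometric:
      "x \<in> carrier A \<Longrightarrow>
       cnorm A x = Sup {cmod (\<phi> x) | \<phi>. \<phi> \<in> predual A \<and> dual_norm A (cnorm A) \<phi> \<le> 1}"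
    and predual_onto:
      "\<lbrakk>\<And>\<phi> \<psi>. \<lbrakk>\<phi> \<in> predual A; \<psi> \<in> predual A\<rbrakk> \<Longrightarrow> F (\<lambda>x. \<phi> x + \<psi> x) = F \<phi> + F \<psi>;
        \<And>c \<phi>. \<phi> \<in> predual A \<Longrightarrow> F (\<lambda>x. c * \<phi> x) = c * F \<phi>;
        \<exists>K. \<forall>\<phi> \<in> predual A. cmod (F \<phi>) \<le> K * dual_norm A (cnorm A) \<phi>\<rbrakk>
       \<Longrightarrow> \<exists>x \<in> carrier A. \<forall>\<phi> \<in> predual A. F \<phi> = \<phi> x"

definition wstar_topology :: "('a, 'm) wstar_scheme \<Rightarrow> 'a topology"
  where "wstar_topology A = weak_topology (carrier A) (predual A)"


section \<open>\<open>W\<^sup>*\<close>-modules\<close>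

text \<open>The components \<open>mult\<close> and \<open>one\<close>, inherited from the record of modules, are irrelevant.
  Inner products are linear in the second variable.\<close>

record ('b, 'x) hilbert_module = "(complex, 'x) module" +
  ract :: "'x \<Rightarrow> 'b \<Rightarrow> 'x"
  rinner :: "'x \<Rightarrow> 'x \<Rightarrow> 'b"

definition hnorm :: "('b, 'm) cstar_scheme \<Rightarrow> ('b, 'x, 'n) hilbert_module_scheme \<Rightarrow> 'x \<Rightarrow> real"
  where "hnorm B X x = sqrt (cnorm B (rinner X x x))"

locale right_cstar_module = B: cstar_algebra B + X: module complex_ring X
  for B :: "('b, 'm) cstar_scheme" and X :: "('b, 'x, 'n) hilbert_module_scheme" +
  assumes ract_closed: "\<lbrakk>x \<in> carrier X; b \<in> carrier B\<rbrakk> \<Longrightarrow> ract X x b \<in> carrier X"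
    and ract_add_left:
      "\<lbrakk>x \<in> carrier X; y \<in> carrier X; b \<in> carrier B\<rbrakk>
       \<Longrightarrow> ract X (x \<oplus>\<^bsub>X\<^esub> y) b = ract X x b \<oplus>\<^bsub>X\<^esub> ract X y b"
    and ract_add_right:
      "\<lbrakk>x \<in> carrier X; b \<in> carrier B; c \<in> carrier B\<rbrakk>
       \<Longrightarrow> ract X x (b \<oplus>\<^bsub>B\<^esub> c) = ract X x b \<oplus>\<^bsub>X\<^esub> ract X x c"
    and ract_smult_left:
      "\<lbrakk>x \<in> carrier X; b \<in> carrier B\<rbrakk> \<Longrightarrow> ract X (t \<odot>\<^bsub>X\<^esub> x) b = t \<odot>\<^bsub>X\<^esub> ract X x b"
    and ract_smult_right:
      "\<lbrakk>x \<in> carrier X; b \<in> carrier B\<rbrakk> \<Longrightarrow> ract X x (t \<odot>\<^bsub>B\<^esub> b) = t \<odot>\<^bsub>X\<^esub> ract X x b"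
    and ract_mult:
      "\<lbrakk>x \<in> carrier X; b \<in> carrier B; c \<in> carrier B\<rbrakk>
       \<Longrightarrow> ract X x (b \<otimes>\<^bsub>B\<^esub> c) = ract X (ract X x b) c"
    and ract_one: "x \<in> carrier X \<Longrightarrow> ract X x \<one>\<^bsub>B\<^esub> = x"
    and rinner_closed: "\<lbrakk>x \<in> carrier X; y \<in> carrier X\<rbrakk> \<Longrightarrow> rinner X x y \<in> carrier B"
    and rinner_add:
      "\<lbrakk>x \<in> carrier X; y \<in> carrier X; z \<in> carrier X\<rbrakk>
       \<Longrightarrow> rinner X x (y \<oplus>\<^bsub>X\<^esub> z) = rinner X x y \<oplus>\<^bsub>B\<^esub> rinner X x z"
    and rinner_smult:
      "\<lbrakk>x \<in> carrier X; y \<in> carrier X\<rbrakk> \<Longrightarrow> rinner X x (t \<odot>\<^bsub>X\<^esub> y) = t \<odot>\<^bsub>B\<^esub> rinner X x y"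
    and rinner_ract:
      "\<lbrakk>x \<in> carrier X; y \<in> carrier X; b \<in> carrier B\<rbrakk>
       \<Longrightarrow> rinner X x (ract X y b) = rinner X x y \<otimes>\<^bsub>B\<^esub> b"
    and rinner_star:
      "\<lbrakk>x \<in> carrier X; y \<in> carrier X\<rbrakk> \<Longrightarrow> star B (rinner X x y) = rinner X y x"
    and rinner_positive: "x \<in> carrier X \<Longrightarrow> rinner X x x \<in> positive_elements B"
    and rinner_definite: "\<lbrakk>x \<in> carrier X; rinner X x x = \<zero>\<^bsub>B\<^esub>\<rbrakk> \<Longrightarrow> x = \<zero>\<^bsub>X\<^esub>"
    and module_complete: "norm_complete X (hnorm B X)"

definition bounded_module_map ::
    "('b, 'm) cstar_scheme \<Rightarrow> ('b, 'x, 'n) hilbert_module_scheme \<Rightarrow> ('x \<Rightarrow> 'b) \<Rightarrow> bool"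
  where "bounded_module_map B X f \<longleftrightarrow>
    f \<in> carrier X \<rightarrow> carrier B \<and>
    (\<forall>x \<in> carrier X. \<forall>y \<in> carrier X. f (x \<oplus>\<^bsub>X\<^esub> y) = f x \<oplus>\<^bsub>B\<^esub> f y) \<and>
    (\<forall>t. \<forall>x \<in> carrier X. f (t \<odot>\<^bsub>X\<^esub> x) = t \<odot>\<^bsub>B\<^esub> f x) \<and>
    (\<forall>x \<in> carrier X. \<forall>b \<in> carrier B. f (ract X x b) = f x \<otimes>\<^bsub>B\<^esub> b) \<and>
    (\<exists>K. \<forall>x \<in> carrier X. cnorm B (f x) \<le> K * hnorm B X x)"

locale right_wstar_module = right_cstar_module B X + wstar_algebra B
  for B :: "('b, 'm) wstar_scheme" and X :: "('b, 'x, 'n) hilbert_module_scheme" +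
  assumes selfdual:
    "bounded_module_map B X f \<Longrightarrow> \<exists>y \<in> carrier X. \<forall>x \<in> carrier X. f x = rinner X y x"

text \<open>A selfdual module \<open>X\<close> over \<open>B\<close> is a dual Banach space (Paschke); its predual is the norm
  closure in the dual of \<open>X\<close> of the span of the functionals \<open>\<omega>(\<langle>y, \<cdot>\<rangle>)\<close> with \<open>y\<close> in \<open>X\<close> and
  \<open>\<omega>\<close> in the predual of \<open>B\<close>.  That set of functionals is closed under scalar multiples.\<close>

definition module_predual ::
    "('b, 'm) wstar_scheme \<Rightarrow> ('b, 'x, 'n) hilbert_module_scheme \<Rightarrow> ('x \<Rightarrow> complex) set"
  where "module_predual B X = {\<phi> \<in> dual_space X (hnorm B X).
    \<forall>\<epsilon> > 0. \<exists>ps. set ps \<subseteq> predual B \<times> carrier X \<and>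
      (\<forall>x \<in> carrier X. cmod (\<phi> x - (\<Sum>(\<omega>, y) \<leftarrow> ps. \<omega> (rinner X y x))) \<le> \<epsilon> * hnorm B X x)}"

definition module_wstar_topology ::
    "('b, 'm) wstar_scheme \<Rightarrow> ('b, 'x, 'n) hilbert_module_scheme \<Rightarrow> 'x topology"
  where "module_wstar_topology B X = weak_topology (carrier X) (module_predual B X)"

definition wstar_full :: "('b, 'm) wstar_scheme \<Rightarrow> ('b, 'x, 'n) hilbert_module_scheme \<Rightarrow> bool"
  where "wstar_full B X \<longleftrightarrow>
    wstar_topology B closure_of
      lin_span B {rinner X x y | x y. x \<in> carrier X \<and> y \<in> carrier X} = carrier B"

definition adjointable :: "('b, 'x, 'n) hilbert_module_scheme \<Rightarrow> ('x \<Rightarrow> 'x) \<Rightarrow> bool"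
  where "adjointable X T \<longleftrightarrow>
    T \<in> carrier X \<rightarrow> carrier X \<and>
    (\<exists>S \<in> carrier X \<rightarrow> carrier X.
      \<forall>x \<in> carrier X. \<forall>y \<in> carrier X. rinner X (T x) y = rinner X x (S y))"


section \<open>\<open>W\<^sup>*\<close>-correspondences\<close>

record ('b, 'x, 'a) correspondence = "('b, 'x) hilbert_module" +
  lact :: "'a \<Rightarrow> 'x \<Rightarrow> 'x"

text \<open>Normality is \<open>w\<^sup>*\<close>-continuity: the predual of the algebra of adjointable operators on a
  selfdual module \<open>X\<close> is the closed span of the functionals \<open>T \<mapsto> \<omega>(\<langle>x, T y\<rangle>)\<close>, so the left
  action is \<open>w\<^sup>*\<close>-continuous iff it pulls each of these back to a \<open>w\<^sup>*\<close>-continuous functional.\<close>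

locale wstar_correspondence = A: wstar_algebra A + right_wstar_module B X
  for A :: "('a, 'k) wstar_scheme" and B :: "('b, 'm) wstar_scheme"
    and X :: "('b, 'x, 'a, 'n) correspondence_scheme" +
  assumes lact_adjointable: "a \<in> carrier A \<Longrightarrow> adjointable X (lact X a)"
    and lact_add:
      "\<lbrakk>a \<in> carrier A; a' \<in> carrier A; x \<in> carrier X\<rbrakk>
       \<Longrightarrow> lact X (a \<oplus>\<^bsub>A\<^esub> a') x = lact X a x \<oplus>\<^bsub>X\<^esub> lact X a' x"
    and lact_smult:
      "\<lbrakk>a \<in> carrier A; x \<in> carrier X\<rbrakk> \<Longrightarrow> lact X (t \<odot>\<^bsub>A\<^esub> a) x = t \<odot>\<^bsub>X\<^esub> lact X a x"
    and lact_mult: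
      "\<lbrakk>a \<in> carrier A; a' \<in> carrier A; x \<in> carrier X\<rbrakk>
       \<Longrightarrow> lact X (a \<otimes>\<^bsub>A\<^esub> a') x = lact X a (lact X a' x)"
    and lact_one: "x \<in> carrier X \<Longrightarrow> lact X \<one>\<^bsub>A\<^esub> x = x"
    and lact_star:
      "\<lbrakk>a \<in> carrier A; x \<in> carrier X; y \<in> carrier X\<rbrakk>
       \<Longrightarrow> rinner X (lact X a x) y = rinner X x (lact X (star A a) y)"
    and lact_normal:
      "\<lbrakk>\<omega> \<in> predual B; x \<in> carrier X; y \<in> carrier X\<rbrakk>
       \<Longrightarrow> continuous_map (wstar_topology A) euclidean (\<lambda>a. \<omega> (rinner X x (lact X a y)))"

definition correspondence_iso ::
    "('a, 'k) wstar_scheme \<Rightarrow> ('b, 'm) wstar_scheme \<Rightarrow>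
     ('b, 'x, 'a, 'n) correspondence_scheme \<Rightarrow> ('b, 'y, 'a, 'p) correspondence_scheme \<Rightarrow>
     ('x \<Rightarrow> 'y) \<Rightarrow> bool"
  where "correspondence_iso A B X Y \<Phi> \<longleftrightarrow>
    bij_betw \<Phi> (carrier X) (carrier Y) \<and>
    (\<forall>x \<in> carrier X. \<forall>y \<in> carrier X. \<Phi> (x \<oplus>\<^bsub>X\<^esub> y) = \<Phi> x \<oplus>\<^bsub>Y\<^esub> \<Phi> y) \<and>
    (\<forall>t. \<forall>x \<in> carrier X. \<Phi> (t \<odot>\<^bsub>X\<^esub> x) = t \<odot>\<^bsub>Y\<^esub> \<Phi> x) \<and>
    (\<forall>a \<in> carrier A. \<forall>x \<in> carrier X. \<Phi> (lact X a x) = lact Y a (\<Phi> x)) \<and>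
    (\<forall>x \<in> carrier X. \<forall>b \<in> carrier B. \<Phi> (ract X x b) = ract Y (\<Phi> x) b) \<and>
    (\<forall>x \<in> carrier X. \<forall>y \<in> carrier X. rinner Y (\<Phi> x) (\<Phi> y) = rinner X x y)"

text \<open>\<open>(T, \<tau>)\<close> is the \<open>W\<^sup>*\<close>-module tensor product over \<open>A\<close> of a \<open>C\<close>-\<open>A\<close> bimodule \<open>X\<close> and an
  \<open>A\<close>-\<open>B\<close> correspondence \<open>Y\<close>, where \<open>\<tau> x y\<close> is the elementary tensor.  The inner product formula
  forces \<open>\<tau>\<close> to be bilinear, \<open>A\<close>-balanced and compatible with the right action, and identifies the
  span of its range with the algebraic tensor product modulo vectors of length zero, that is, with
  a norm dense submodule of the interior tensor product; \<open>T\<close> is the selfdual completion of it.\<close>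

definition wstar_tensor ::
    "('c, 'k) wstar_scheme \<Rightarrow> ('a, 'l) wstar_scheme \<Rightarrow> ('b, 'm) wstar_scheme \<Rightarrow>
     ('a, 'x, 'c, 'n) correspondence_scheme \<Rightarrow> ('b, 'y, 'a, 'p) correspondence_scheme \<Rightarrow>
     ('b, 't, 'c, 'q) correspondence_scheme \<Rightarrow> ('x \<Rightarrow> 'y \<Rightarrow> 't) \<Rightarrow> bool"
  where "wstar_tensor C A B X Y T \<tau> \<longleftrightarrow>
    wstar_correspondence C B T \<and>
    (\<forall>x \<in> carrier X. \<forall>y \<in> carrier Y. \<tau> x y \<in> carrier T) \<and>
    (\<forall>x\<^sub>1 \<in> carrier X. \<forall>y\<^sub>1 \<in> carrier Y. \<forall>x\<^sub>2 \<in> carrier X. \<forall>y\<^sub>2 \<in> carrier Y.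
      rinner T (\<tau> x\<^sub>1 y\<^sub>1) (\<tau> x\<^sub>2 y\<^sub>2) = rinner Y y\<^sub>1 (lact Y (rinner X x\<^sub>1 x\<^sub>2) y\<^sub>2)) \<and>
    (\<forall>c \<in> carrier C. \<forall>x \<in> carrier X. \<forall>y \<in> carrier Y. lact T c (\<tau> x y) = \<tau> (lact X c x) y) \<and>
    module_wstar_topology B T closure_of
      lin_span T {\<tau> x y | x y. x \<in> carrier X \<and> y \<in> carrier Y} = carrier T"


section \<open>Morita equivalence\<close>

record ('b, 'x, 'a) bimod = "('b, 'x, 'a) correspondence" +
  linner :: "'x \<Rightarrow> 'x \<Rightarrow> 'a"

text \<open>A left module over \<open>A\<close>, whose inner product is linear in the first variable, is the same as
  a right module over the opposite algebra with the inner product flipped.\<close>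

definition left_module :: "('b, 'x, 'a, 'n) bimod_scheme \<Rightarrow> ('a, 'x) hilbert_module"
  where "left_module X = \<lparr>carrier = carrier X, mult = mult X, one = one X, zero = zero X,
    add = add X, smult = smult X, ract = (\<lambda>x a. lact X a x), rinner = (\<lambda>x y. linner X y x)\<rparr>"

definition wstar_equivalence_bimodule ::
    "('a, 'k) wstar_scheme \<Rightarrow> ('b, 'm) wstar_scheme \<Rightarrow> ('b, 'x, 'a, 'n) bimod_scheme \<Rightarrow> bool"
  where "wstar_equivalence_bimodule A B X \<longleftrightarrow>
    right_wstar_module B X \<and> wstar_full B X \<and>
    right_wstar_module (opposite A) (left_module X) \<and> wstar_full (opposite A) (left_module X) \<and>
    (\<forall>a \<in> carrier A. \<forall>x \<in> carrier X. \<forall>b \<in> carrier B.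
      ract X (lact X a x) b = lact X a (ract X x b)) \<and>
    (\<forall>a \<in> carrier A. adjointable X (lact X a)) \<and>
    (\<forall>b \<in> carrier B. adjointable (left_module X) (\<lambda>x. ract X x b)) \<and>
    (\<forall>x \<in> carrier X. \<forall>y \<in> carrier X. \<forall>z \<in> carrier X.
      lact X (linner X x y) z = ract X x (rinner X y z))"

text \<open>HOL does not quantify over types inside a formula, so the first argument fixes the type from
  which the underlying sets of \<open>X\<close> and of both tensor products are taken.  For countable
  graphs every such \<open>X\<close> and both tensor products have at most the cardinality of the continuum, so
  \<open>nat \<Rightarrow> complex\<close> is no restriction.\<close>

definition morita_equivalent ::
    "'x itself \<Rightarrow> ('a, 'k) wstar_scheme \<Rightarrow> ('b, 'm) wstar_scheme \<Rightarrow>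
     ('a, 'e, 'a, 'n) correspondence_scheme \<Rightarrow> ('b, 'd, 'b, 'p) correspondence_scheme \<Rightarrow> bool"
  where "morita_equivalent _ A B E D \<longleftrightarrow>
    wstar_correspondence A A E \<and> wstar_correspondence B B D \<and>
    (\<exists>(X :: ('b, 'x, 'a) bimod)
      (S :: ('b, 'x, 'a) correspondence) \<tau> (T :: ('b, 'x, 'a) correspondence) \<sigma> \<Phi>.
      wstar_equivalence_bimodule A B X \<and>
      wstar_tensor A B B X D S \<tau> \<and>
      wstar_tensor A A B E X T \<sigma> \<and>
      correspondence_iso A B S T \<Phi>)"


section \<open>Graph correspondences\<close>

text \<open>Functions on a set \<open>V\<close> are represented by functions on the type that vanish off \<open>V\<close>.
  The predual of \<open>\<ell>\<^sup>\<infinity>(V)\<close> is \<open>\<ell>\<^sup>1(V)\<close>.\<close>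

definition linf_carrier :: "'v set \<Rightarrow> ('v \<Rightarrow> complex) set"
  where "linf_carrier V = {a. (\<forall>v. v \<notin> V \<longrightarrow> a v = 0) \<and> bounded (a ` V)}"

definition linf_predual :: "'v set \<Rightarrow> (('v \<Rightarrow> complex) \<Rightarrow> complex) set"
  where "linf_predual V = {\<phi>. \<exists>f. (\<lambda>v. cmod (f v)) summable_on V \<and>
    \<phi> = (\<lambda>a. if a \<in> linf_carrier V then \<Sum>\<^sub>\<infinity>v\<in>V. f v * a v else 0)}"

definition linf :: "'v set \<Rightarrow> ('v \<Rightarrow> complex) wstar"
  where "linf V = \<lparr>
    carrier = linf_carrier V,
    mult = (\<lambda>a b v. a v * b v),
    one = (\<lambda>v. if v \<in> V then 1 else 0),
    zero = (\<lambda>_. 0),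
    add = (\<lambda>a b v. a v + b v),
    smult = (\<lambda>t a v. t * a v),
    star = (\<lambda>a v. cnj (a v)),
    cnorm = (\<lambda>a. Sup (insert 0 ((\<lambda>v. cmod (a v)) ` V))),
    predual = linf_predual V\<rparr>"

text \<open>In a \<open>pre_digraph\<close>, \<open>tail\<close> is the source map and \<open>head\<close> is the range map, so
  \<open>out_arcs G v\<close> consists of the edges with source \<open>v\<close>.\<close>

definition graph_correspondence ::
    "('v, 'e) pre_digraph \<Rightarrow> ('v \<Rightarrow> complex, 'e \<Rightarrow> complex, 'v \<Rightarrow> complex) correspondence"
  where "graph_correspondence G = \<lparr>
    carrier = {x. (\<forall>e. e \<notin> arcs G \<longrightarrow> x e = 0) \<and>
      (\<forall>v \<in> verts G. (\<lambda>e. (cmod (x e))\<^sup>2) summable_on out_arcs G v) \<and>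
      bdd_above ((\<lambda>v. \<Sum>\<^sub>\<infinity>e\<in>out_arcs G v. (cmod (x e))\<^sup>2) ` verts G)},
    mult = undefined,
    one = undefined,
    zero = (\<lambda>_. 0),
    add = (\<lambda>x y e. x e + y e),
    smult = (\<lambda>t x e. t * x e),
    ract = (\<lambda>x b e. x e * b (tail G e)),
    rinner = (\<lambda>x y v. \<Sum>\<^sub>\<infinity>e\<in>out_arcs G v. cnj (x e) * y e),
    lact = (\<lambda>a x e. a (head G e) * x e)\<rparr>"

definition graph_isomorphic :: "('v, 'e) pre_digraph \<Rightarrow> ('w, 'f) pre_digraph \<Rightarrow> bool"
  where "graph_isomorphic G F \<longleftrightarrow>
    (\<exists>\<alpha> \<beta>. bij_betw \<alpha> (arcs G) (arcs F) \<and> bij_betw \<beta> (verts G) (verts F) \<and>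
      (\<forall>e \<in> arcs G. tail F (\<alpha> e) = \<beta> (tail G e) \<and> head F (\<alpha> e) = \<beta> (head G e)))"

end

theory Submission
  imports Defs
begin

text \<open>
  The vertices of a graph are the minimal projections of \<open>\<ell>\<^sup>\<infinity>\<close> of its vertex set, and the edges
  from \<open>u\<close> to \<open>v\<close> are an orthonormal basis of the corner of the correspondence cut out by the
  projections of \<open>v\<close> on the left and of \<open>u\<close> on the right.  Morita equivalence preserves both.

  Let \<open>X\<close> be an equivalence bimodule between \<open>\<ell>\<^sup>\<infinity>(V)\<close> and \<open>\<ell>\<^sup>\<infinity>(W)\<close>.  The identity
  \<open>linner x y \<cdot> z = x \<cdot> rinner y z\<close>, applied to a nonzero vector \<open>x\<close> of a corner of \<open>X\<close>, shows that
  the whole row and the whole column of that corner are spanned by \<open>x\<close> (\<open>link_row\<close>, \<open>link_column\<close>).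
  By fullness every row and every column contains a nonzero corner, so the nonzero corners are the
  graph of a bijection \<open>\<beta>\<close> from \<open>V\<close> to \<open>W\<close>, and each of them contains a unit vector.  Tensoring
  with these unit vectors turns the edges of the first graph from \<open>u\<close> to \<open>v\<close> into an orthonormal
  basis of one corner of \<open>E \<otimes> X\<close> (\<open>left_tensor_corner\<close>), and the edges of the second graph from
  \<open>\<beta> u\<close> to \<open>\<beta> v\<close> into an orthonormal basis of the same corner of \<open>X \<otimes> D\<close> (\<open>right_tensor_corner\<close>).
  An isomorphism of the two tensor products makes the squared moduli of the transition
  coefficients a doubly stochastic matrix, and such a matrix is square
  (\<open>doubly_stochastic_bij\<close>).  Thus \<open>\<beta>\<close> extends to the edges.

  Conversely, all objects needed are modules of the following kind: the functions on a set \<open>I\<close> whose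
  square sums over the fibres of a map \<open>s\<close> from \<open>I\<close> to \<open>W\<close> are bounded, with \<open>\<ell>\<^sup>\<infinity>(V)\<close> acting through
  a second map from \<open>I\<close> to \<open>V\<close>.  These are \<open>W\<^sup>*\<close>-correspondences, a bijective pair of maps gives an
  equivalence bimodule, and the tensor product of two of them lives on the fibre product of the index
  sets.  For isomorphic graphs the bimodule lives on the vertices, and both tensor products are the
  same module on the edges.
\<close>

section \<open>Complex modules of functions\<close>

lemma complex_ring_simps [simp]:
  "carrier complex_ring = UNIV" "mult complex_ring = (*)" "one complex_ring = 1"
  "zero complex_ring = 0" "add complex_ring = (+)"
  by (simp_all add: complex_ring_def)

lemma cring_complex_ring: "cring complex_ring"
proof (rule cringI)
  show "abelian_group complex_ring"
  proof (rule abelian_groupI)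
    show "\<exists>y\<in>carrier complex_ring. y \<oplus>\<^bsub>complex_ring\<^esub> x = \<zero>\<^bsub>complex_ring\<^esub>" for x
      by (rule bexI[of _ "-x"]) simp_all
  qed simp_all
  show "comm_monoid complex_ring"
    by (rule comm_monoidI) (simp_all add: mult_ac)
qed (simp add: distrib_right)

definition delta :: "'i \<Rightarrow> 'i \<Rightarrow> complex"
  where "delta j = (\<lambda>i. if i = j then 1 else 0)"

lemma delta_same: "delta i i = 1"
  and delta_other: "i \<noteq> j \<Longrightarrow> delta j i = 0"
  by (simp_all add: delta_def)

locale function_space =
  fixes C :: "('i \<Rightarrow> complex) set"
  assumes zero_mem: "(\<lambda>_. 0) \<in> C"
    and add_mem: "\<lbrakk>x \<in> C; y \<in> C\<rbrakk> \<Longrightarrow> (\<lambda>i. x i + y i) \<in> C"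
    and smult_mem: "x \<in> C \<Longrightarrow> (\<lambda>i. t * x i) \<in> C"
begin

lemma uminus_mem: "x \<in> C \<Longrightarrow> (\<lambda>i. - x i) \<in> C"
  using smult_mem[of x "-1"] by simp

lemma diff_mem: "\<lbrakk>x \<in> C; y \<in> C\<rbrakk> \<Longrightarrow> (\<lambda>i. x i - y i) \<in> C"
  using add_mem[OF _ uminus_mem, of x y] by simp

lemma linear_finite_support:
  assumes "finite F" and delta: "\<And>i. i \<in> F \<Longrightarrow> delta i \<in> C"
    and add: "\<And>x y. \<lbrakk>x \<in> C; y \<in> C\<rbrakk> \<Longrightarrow> \<phi> (\<lambda>i. x i + y i) = \<phi> x + (\<phi> y :: complex)"
    and smult: "\<And>t x. x \<in> C \<Longrightarrow> \<phi> (\<lambda>i. t * x i) = t * \<phi> x"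
  shows "(\<lambda>i. if i \<in> F then c i else 0) \<in> C \<and>
    \<phi> (\<lambda>i. if i \<in> F then c i else 0) = (\<Sum>i\<in>F. c i * \<phi> (delta i))"
  using assms(1,2)
proof (induction F)
  case empty
  have "\<phi> (\<lambda>_. 0) = 0" using smult[OF zero_mem, of 0] by simp
  then show ?case by (simp add: zero_mem)
next
  case (insert j F)
  let ?x = "\<lambda>i. if i \<in> F then c i else 0"
  have eq: "(\<lambda>i. if i \<in> insert j F then c i else 0) = (\<lambda>i. c j * delta j i + ?x i)"
    using insert.hyps by (auto simp: delta_def)
  have "delta j \<in> C" "?x \<in> C" "\<phi> ?x = (\<Sum>i\<in>F. c i * \<phi> (delta i))"
    using insert by auto
  then show ?case
    unfolding eq using insert.hyps by (simp add: add smult add_mem smult_mem)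
qed

end

locale function_module = function_space "carrier M"
  for M :: "(complex, 'i \<Rightarrow> complex, 'm) module_scheme" (structure) +
  assumes zero_fun: "zero M = (\<lambda>_. 0)"
    and add_fun: "add M = (\<lambda>x y i. x i + y i)"
    and smult_fun: "smult M = (\<lambda>t x i. t * x i)"
begin

lemma is_module: "module complex_ring M"
proof (rule moduleI)
  show "abelian_group M"
  proof (rule abelian_groupI)
    show "\<exists>y\<in>carrier M. y \<oplus> x = \<zero>" if "x \<in> carrier M" for x
      by (rule bexI[OF _ uminus_mem[OF that]]) (simp add: add_fun zero_fun)
  qed (simp_all add: add_fun zero_fun add_mem zero_mem add_ac)
qed (simp_all add: cring_complex_ring smult_fun add_fun smult_mem algebra_simps)

lemma minus_fun:
  assumes "x \<in> carrier M" "y \<in> carrier M"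
  shows "x \<ominus> y = (\<lambda>i. x i - y i)"
proof -
  interpret module complex_ring M by (rule is_module)
  have "\<ominus> y = (\<lambda>i. - y i)"
    by (rule minus_equality) (use assms uminus_mem in \<open>simp_all add: add_fun zero_fun\<close>)
  then show ?thesis
    by (simp add: a_minus_def add_fun)
qed

text \<open>Both \<open>\<ell>\<^sup>\<infinity>\<close> and the fibrewise square-summable functions carry a norm that is a supremum of
  Euclidean norms over finite sets of coordinates.  Such a norm is lower semicontinuous for
  pointwise convergence, and this is what makes the space complete: the pointwise limit of a
  Cauchy sequence is its limit in norm.\<close>

lemma norm_complete_sup_L2:
  fixes \<F> :: "'i set set"
  assumes carrier: "carrier M =
      {x. (\<forall>i. i \<notin> \<Union>\<F> \<longrightarrow> x i = 0) \<and> (\<exists>K. \<forall>F\<in>\<F>. L2_set (\<lambda>i. cmod (x i)) F \<le> K)}"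
    and fin: "\<And>F. F \<in> \<F> \<Longrightarrow> finite F"
    and N: "\<And>x r. \<lbrakk>x \<in> carrier M; 0 \<le> r\<rbrakk> \<Longrightarrow> N x \<le> r \<longleftrightarrow> (\<forall>F\<in>\<F>. L2_set (\<lambda>i. cmod (x i)) F \<le> r)"
    and N_nonneg: "\<And>x. x \<in> carrier M \<Longrightarrow> 0 \<le> N x"
  shows "norm_complete M N"
  unfolding norm_complete_def
proof (intro allI impI, elim conjE)
  fix X :: "nat \<Rightarrow> 'i \<Rightarrow> complex"
  assume X: "range X \<subseteq> carrier M"
    and cauchy: "\<forall>\<epsilon>>0. \<exists>k. \<forall>m\<ge>k. \<forall>n\<ge>k. N (X m \<ominus> X n) < \<epsilon>"
  have Xc: "X n \<in> carrier M" for n using X by auto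
  have X0: "X n i = 0" if "i \<notin> \<Union>\<F>" for n i
    using Xc[of n] that unfolding carrier by blast
  have bound: "\<exists>k. \<forall>m\<ge>k. \<forall>n\<ge>k. \<forall>F\<in>\<F>. L2_set (\<lambda>i. cmod (X m i - X n i)) F \<le> \<epsilon>"
    if pos: "\<epsilon> > 0" for \<epsilon>
  proof -
    obtain k where "\<forall>m\<ge>k. \<forall>n\<ge>k. N (X m \<ominus> X n) < \<epsilon>" using cauchy pos by blast
    then have "\<forall>m\<ge>k. \<forall>n\<ge>k. N (\<lambda>i. X m i - X n i) \<le> \<epsilon>"
      by (simp add: minus_fun[OF Xc Xc] less_imp_le)
    then show ?thesis using N[OF diff_mem[OF Xc Xc]] pos by (auto intro!: exI[of _ k])
  qed
  have pointwise: "convergent (\<lambda>n. X n i)" for i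
  proof (cases "i \<in> \<Union>\<F>")
    case True
    then obtain F where F: "F \<in> \<F>" "i \<in> F" by blast
    have "Cauchy (\<lambda>n. X n i)"
    proof (rule metric_CauchyI)
      fix e :: real assume "e > 0"
      then obtain k where k: "\<forall>m\<ge>k. \<forall>n\<ge>k. \<forall>F\<in>\<F>. L2_set (\<lambda>i. cmod (X m i - X n i)) F \<le> e/2"
        using bound[of "e/2"] by auto
      have "dist (X m i) (X n i) < e" if "m \<ge> k" "n \<ge> k" for m n
      proof -
        have "cmod (X m i - X n i) \<le> L2_set (\<lambda>i. cmod (X m i - X n i)) F"
          by (rule member_le_L2_set) (use F fin in auto)
        also have "\<dots> \<le> e/2" using k that F by blast
        finally show ?thesis using \<open>e > 0\<close> by (simp add: dist_norm)
      qed
      then show "\<exists>k. \<forall>m\<ge>k. \<forall>n\<ge>k. dist (X m i) (X n i) < e" by blast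
    qed
    then show ?thesis by (rule Cauchy_convergent)
  next
    case False
    then show ?thesis by (simp add: X0 convergent_const)
  qed
  define x where "x i = lim (\<lambda>n. X n i)" for i
  have lim: "(\<lambda>n. X n i) \<longlonglongrightarrow> x i" for i
    using pointwise by (simp add: x_def convergent_LIMSEQ_iff)
  have close: "\<exists>k. \<forall>m\<ge>k. \<forall>F\<in>\<F>. L2_set (\<lambda>i. cmod (X m i - x i)) F \<le> \<epsilon>" if "\<epsilon> > 0" for \<epsilon>
  proof -
    obtain k where k: "\<forall>m\<ge>k. \<forall>n\<ge>k. \<forall>F\<in>\<F>. L2_set (\<lambda>i. cmod (X m i - X n i)) F \<le> \<epsilon>"
      using bound \<open>\<epsilon> > 0\<close> by blast
    have "L2_set (\<lambda>i. cmod (X m i - x i)) F \<le> \<epsilon>" if "m \<ge> k" "F \<in> \<F>" for m F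
    proof (rule tendsto_upperbound)
      show "(\<lambda>n. L2_set (\<lambda>i. cmod (X m i - X n i)) F) \<longlonglongrightarrow> L2_set (\<lambda>i. cmod (X m i - x i)) F"
        unfolding L2_set_def by (intro tendsto_intros lim)
      show "\<forall>\<^sub>F n in sequentially. L2_set (\<lambda>i. cmod (X m i - X n i)) F \<le> \<epsilon>"
        using k that by (auto simp: eventually_sequentially)
    qed simp
    then show ?thesis by blast
  qed
  have x_mem: "x \<in> carrier M"
  proof -
    obtain k where k: "\<forall>F\<in>\<F>. L2_set (\<lambda>i. cmod (X k i - x i)) F \<le> 1" using close[of 1] by auto
    obtain K where K: "\<forall>F\<in>\<F>. L2_set (\<lambda>i. cmod (X k i)) F \<le> K" using Xc[of k] unfolding carrier by blast
    have "L2_set (\<lambda>i. cmod (x i)) F \<le> K + 1" if "F \<in> \<F>" for F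
    proof -
      have "L2_set (\<lambda>i. cmod (x i)) F \<le> L2_set (\<lambda>i. cmod (X k i) + cmod (X k i - x i)) F"
        by (rule L2_set_mono) (simp_all add: norm_minus_commute norm_triangle_sub)
      also have "\<dots> \<le> L2_set (\<lambda>i. cmod (X k i)) F + L2_set (\<lambda>i. cmod (X k i - x i)) F"
        by (rule L2_set_triangle_ineq)
      finally show ?thesis using k K that by fastforce
    qed
    moreover have "x i = 0" if "i \<notin> \<Union>\<F>" for i
      using X0[OF that] by (simp add: x_def lim_def) 
    ultimately show ?thesis unfolding carrier by blast
  qed
  have "(\<lambda>n. N (X n \<ominus> x)) \<longlonglongrightarrow> 0"
  proof (rule metric_LIMSEQ_I)
    fix e :: real assume "e > 0"
    then obtain k where k: "\<forall>m\<ge>k. \<forall>F\<in>\<F>. L2_set (\<lambda>i. cmod (X m i - x i)) F \<le> e/2"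
      using close[of "e/2"] by auto
    have "dist (N (X n \<ominus> x)) 0 < e" if "n \<ge> k" for n
    proof -
      have "N (\<lambda>i. X n i - x i) \<le> e/2"
        using N[OF diff_mem[OF Xc[of n] x_mem], of "e/2"] k \<open>e > 0\<close> that by auto
      then show ?thesis
        using N_nonneg[OF diff_mem[OF Xc[of n] x_mem]] \<open>e > 0\<close>
        by (simp add: minus_fun[OF Xc x_mem])
    qed
    then show "\<exists>no. \<forall>n\<ge>no. dist (N (X n \<ominus> x)) 0 < e" by blast
  qed
  then show "\<exists>x\<in>carrier M. (\<lambda>n. N (X n \<ominus> x)) \<longlonglongrightarrow> 0"
    using x_mem by blast
qed

end

lemma has_sum_if_error_vanishes:
  fixes g :: "'i \<Rightarrow> complex"
  assumes "\<And>F. \<lbrakk>finite F; F \<subseteq> A\<rbrakk> \<Longrightarrow> cmod (L - (\<Sum>i\<in>F. g i)) \<le> h F"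
    and "(h \<longlongrightarrow> 0) (finite_subsets_at_top A)"
  shows "(g has_sum L) A"
proof -
  have "((\<lambda>F. L - sum g F) \<longlongrightarrow> 0) (finite_subsets_at_top A)"
    by (rule Lim_null_comparison[OF eventually_finite_subsets_at_top_weakI assms(2)])
      (rule assms(1))
  from tendsto_diff[OF tendsto_const[of L] this] show ?thesis
    by (simp add: has_sum_def)
qed

lemma tail_sum_vanishes:
  fixes f :: "'i \<Rightarrow> real"
  assumes "f summable_on A"
  shows "((\<lambda>F. infsum f A - sum f F) \<longlongrightarrow> 0) (finite_subsets_at_top A)"
  using tendsto_diff[OF tendsto_const infsum_tendsto[OF assms], of "infsum f A"] by simp

section \<open>Weak topologies\<close>

lemma topspace_weak_topology: "\<Phi> \<noteq> {} \<Longrightarrow> topspace (weak_topology S \<Phi>) = S"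
  unfolding weak_topology_def topology_generated_by_topspace
  by (auto intro!: exI[of _ S] exI[of _ UNIV])

lemma topspace_weak_topology_subset: "topspace (weak_topology S \<Phi>) \<subseteq> S"
  unfolding weak_topology_def topology_generated_by_topspace by auto

lemma openin_weak_topology:
  "\<lbrakk>\<phi> \<in> \<Phi>; open U\<rbrakk> \<Longrightarrow> openin (weak_topology S \<Phi>) {x \<in> S. \<phi> x \<in> U}"
  unfolding weak_topology_def by (rule topology_generated_by_Basis) blast

lemma continuous_map_weak_topology:
  assumes "\<phi> \<in> \<Phi>" and eq: "\<And>x. x \<in> S \<Longrightarrow> f x = \<phi> x"
  shows "continuous_map (weak_topology S \<Phi>) euclidean f"
proof -
  have top: "topspace (weak_topology S \<Phi>) = S"
    using assms by (intro topspace_weak_topology) auto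
  have "{x \<in> S. f x \<in> U} = {x \<in> S. \<phi> x \<in> U}" for U using eq by auto
  then show ?thesis
    using openin_weak_topology[OF assms(1)] by (auto simp: continuous_map_def top)
qed

lemma weak_closure_vanishing:
  assumes "x \<in> weak_topology S \<Phi> closure_of A" "\<phi> \<in> \<Phi>" "\<And>a. a \<in> A \<Longrightarrow> \<phi> a = 0"
  shows "\<phi> x = 0"
proof (rule ccontr)
  assume "\<phi> x \<noteq> 0"
  moreover have "x \<in> S"
    using assms(1,2) topspace_weak_topology[of \<Phi> S] by (auto simp: in_closure_of)
  ultimately have "x \<in> {x \<in> S. \<phi> x \<in> - {0}}" by simp
  moreover have "openin (weak_topology S \<Phi>) {x \<in> S. \<phi> x \<in> - {0}}"
    by (rule openin_weak_topology[OF assms(2)]) auto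
  ultimately obtain a where "a \<in> A" "a \<in> {x \<in> S. \<phi> x \<in> - {0}}"
    using in_closure_of[THEN iffD1, OF assms(1), THEN conjunct2, rule_format, OF conjI] by metis
  with assms(3) show False by simp
qed

text \<open>Weak closures are exhibited by nets: the approximating net for square-summable functions is the
  net of finite truncations, indexed by \<open>finite_subsets_at_top\<close>.\<close>

lemma weak_closure_limit:
  assumes "\<Phi> \<noteq> {}" "F \<noteq> bot" "x \<in> S"
    and "\<And>n. f n \<in> A" "\<And>n. f n \<in> S"
    and lim: "\<And>\<phi>. \<phi> \<in> \<Phi> \<Longrightarrow> ((\<lambda>n. \<phi> (f n)) \<longlongrightarrow> \<phi> x) F"
  shows "x \<in> weak_topology S \<Phi> closure_of A"
  unfolding in_closure_of
proof (intro conjI allI impI)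
  show "x \<in> topspace (weak_topology S \<Phi>)" using assms by (simp add: topspace_weak_topology)
  fix T assume T: "x \<in> T \<and> openin (weak_topology S \<Phi>) T"
  then have "generate_topology_on {{x \<in> S. \<phi> x \<in> U} | \<phi> U. \<phi> \<in> \<Phi> \<and> open U} T"
    by (simp add: weak_topology_def openin_topology_generated_by_iff)
  then have "x \<in> T \<Longrightarrow> \<forall>\<^sub>F n in F. f n \<in> T"
  proof induction
    case (UN K)
    then obtain k where "k \<in> K" "x \<in> k" by blast
    then have "\<forall>\<^sub>F n in F. f n \<in> k" using UN by blast
    then show ?case by (rule eventually_mono) (use \<open>k \<in> K\<close> in blast)
  next
    case (Basis s)
    then obtain \<phi> U where s: "s = {x \<in> S. \<phi> x \<in> U}" "\<phi> \<in> \<Phi>" "open U" by blast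
    then have "\<phi> x \<in> U" using Basis.prems by simp
    then have "\<forall>\<^sub>F n in F. \<phi> (f n) \<in> U"
      using s by (intro topological_tendstoD[OF lim])
    then show ?case by (rule eventually_mono) (use s assms in auto)
  qed (auto intro: eventually_conj)
  then have "\<exists>n. f n \<in> T" using T assms(2) eventually_happens' by blast
  then show "\<exists>y. y \<in> A \<and> y \<in> T" using assms by blast
qed

lemma lin_span_vanishing:
  assumes "module complex_ring M"
    and S: "S \<subseteq> carrier M" "\<And>x. x \<in> S \<Longrightarrow> \<phi> x = (0::complex)"
    and add: "\<And>x y. \<lbrakk>x \<in> carrier M; y \<in> carrier M\<rbrakk> \<Longrightarrow> \<phi> (x \<oplus>\<^bsub>M\<^esub> y) = \<phi> x + \<phi> y"
    and smult: "\<And>c x. x \<in> carrier M \<Longrightarrow> \<phi> (c \<odot>\<^bsub>M\<^esub> x) = c * \<phi> x"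
    and "x \<in> lin_span M S"
  shows "\<phi> x = 0"
proof -
  interpret module complex_ring M by fact
  have "submodule {x \<in> carrier M. \<phi> x = 0} complex_ring M"
  proof (rule submoduleI)
    show z: "\<zero>\<^bsub>M\<^esub> \<in> {x \<in> carrier M. \<phi> x = 0}" using add[of "\<zero>\<^bsub>M\<^esub>" "\<zero>\<^bsub>M\<^esub>"] by simp
    show "\<ominus>\<^bsub>M\<^esub> a \<in> {x \<in> carrier M. \<phi> x = 0}" if "a \<in> {x \<in> carrier M. \<phi> x = 0}" for a
      using that add[of a "\<ominus>\<^bsub>M\<^esub> a"] z by (simp add: M.r_neg)
  qed (use add smult in auto)
  then have "lin_span M S \<subseteq> {x \<in> carrier M. \<phi> x = 0}"
    unfolding lin_span_def using S by blast
  then show ?thesis using assms by blast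
qed


section \<open>The algebra \<open>\<ell>\<^sup>\<infinity>(V)\<close>\<close>

definition linf_norm :: "'v set \<Rightarrow> ('v \<Rightarrow> complex) \<Rightarrow> real"
  where "linf_norm V a = Sup (insert 0 ((\<lambda>v. cmod (a v)) ` V))"

definition linf_functional :: "'v set \<Rightarrow> ('v \<Rightarrow> complex) \<Rightarrow> ('v \<Rightarrow> complex) \<Rightarrow> complex"
  where "linf_functional V f = (\<lambda>a. if a \<in> linf_carrier V then \<Sum>\<^sub>\<infinity>v\<in>V. f v * a v else 0)"

lemma linf_simps [simp]:
  "carrier (linf V) = linf_carrier V"
  "mult (linf V) = (\<lambda>a b v. a v * b v)"
  "one (linf V) = (\<lambda>v. if v \<in> V then 1 else 0)"
  "zero (linf V) = (\<lambda>_. 0)"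
  "add (linf V) = (\<lambda>a b v. a v + b v)"
  "smult (linf V) = (\<lambda>t a v. t * a v)"
  "star (linf V) = (\<lambda>a v. cnj (a v))"
  "cnorm (linf V) = linf_norm V"
  by (simp_all add: linf_def linf_norm_def fun_eq_iff)

lemma predual_linf:
  "predual (linf V) = {linf_functional V f | f. (\<lambda>v. cmod (f v)) summable_on V}"
  by (auto simp: linf_def linf_predual_def linf_functional_def)

lemma mem_linf_iff:
  "a \<in> linf_carrier V \<longleftrightarrow> (\<forall>v. v \<notin> V \<longrightarrow> a v = 0) \<and> (\<exists>K. \<forall>v. cmod (a v) \<le> K)"
proof -
  have "bounded (a ` V) \<longleftrightarrow> (\<exists>K. \<forall>v. cmod (a v) \<le> K)" if "\<forall>v. v \<notin> V \<longrightarrow> a v = 0"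
  proof
    assume "bounded (a ` V)"
    then obtain K where K: "\<forall>v\<in>V. cmod (a v) \<le> K" by (auto simp: bounded_iff)
    have "cmod (a v) \<le> \<bar>K\<bar>" for v
      by (cases "v \<in> V") (use K that in \<open>auto intro: order_trans[OF _ abs_ge_self]\<close>)
    then show "\<exists>K. \<forall>v. cmod (a v) \<le> K" by blast
  qed (auto simp: bounded_iff)
  then show ?thesis by (auto simp: linf_carrier_def)
qed

lemma linf_memI: "\<lbrakk>\<And>v. v \<notin> V \<Longrightarrow> a v = 0; \<And>v. v \<in> V \<Longrightarrow> cmod (a v) \<le> K\<rbrakk> \<Longrightarrow> a \<in> linf_carrier V"
  unfolding linf_carrier_def by (auto simp: bounded_iff)

lemma linf_off: "\<lbrakk>a \<in> linf_carrier V; v \<notin> V\<rbrakk> \<Longrightarrow> a v = 0"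
  by (simp add: linf_carrier_def)

lemma bdd_above_linf:
  assumes "a \<in> linf_carrier V"
  shows "bdd_above (insert 0 ((\<lambda>v. cmod (a v)) ` V))"
proof -
  obtain K where "\<forall>v. cmod (a v) \<le> K" using assms by (auto simp: mem_linf_iff)
  then have "bdd_above ((\<lambda>v. cmod (a v)) ` V)" by (intro bdd_aboveI2) auto
  then show ?thesis by simp
qed

lemma linf_norm_nonneg: "a \<in> linf_carrier V \<Longrightarrow> 0 \<le> linf_norm V a"
  unfolding linf_norm_def by (rule cSup_upper[OF _ bdd_above_linf]) simp_all

lemma cmod_le_linf_norm: "a \<in> linf_carrier V \<Longrightarrow> cmod (a v) \<le> linf_norm V a"
proof (cases "v \<in> V")
  case True
  assume "a \<in> linf_carrier V"
  then show ?thesis unfolding linf_norm_def using True bdd_above_linf by (intro cSup_upper) auto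
next
  case False
  assume "a \<in> linf_carrier V"
  then show ?thesis using False by (simp add: linf_off linf_norm_nonneg)
qed

lemma linf_norm_le: "\<lbrakk>0 \<le> r; \<And>v. v \<in> V \<Longrightarrow> cmod (a v) \<le> r\<rbrakk> \<Longrightarrow> linf_norm V a \<le> r"
  unfolding linf_norm_def by (rule cSup_least) auto

lemma linf_norm_le_iff:
  "\<lbrakk>a \<in> linf_carrier V; 0 \<le> r\<rbrakk> \<Longrightarrow> linf_norm V a \<le> r \<longleftrightarrow> (\<forall>v\<in>V. cmod (a v) \<le> r)"
  using cmod_le_linf_norm linf_norm_le order_trans by metis

lemma linf_zero: "(\<lambda>_. 0) \<in> linf_carrier V"
  by (rule linf_memI[of _ _ 0]) auto

lemma linf_one: "(\<lambda>v. if v \<in> V then 1 else 0) \<in> linf_carrier V"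
  by (rule linf_memI[of _ _ 1]) auto

lemma linf_add:
  assumes "a \<in> linf_carrier V" "b \<in> linf_carrier V"
  shows "(\<lambda>v. a v + b v) \<in> linf_carrier V"
  by (rule linf_memI[of _ _ "linf_norm V a + linf_norm V b"])
    (use assms in \<open>auto simp: linf_off intro!: norm_triangle_le add_mono cmod_le_linf_norm\<close>)

lemma linf_mult:
  assumes "a \<in> linf_carrier V" "b \<in> linf_carrier V"
  shows "(\<lambda>v. a v * b v) \<in> linf_carrier V"
  by (rule linf_memI[of _ _ "linf_norm V a * linf_norm V b"])
    (use assms in \<open>auto simp: linf_off norm_mult intro!: mult_mono cmod_le_linf_norm linf_norm_nonneg\<close>)

lemma linf_smult: "a \<in> linf_carrier V \<Longrightarrow> (\<lambda>v. t * a v) \<in> linf_carrier V"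
  by (rule linf_memI[of _ _ "cmod t * linf_norm V a"])
    (auto simp: linf_off norm_mult intro!: mult_left_mono cmod_le_linf_norm)

lemma linf_cnj: "a \<in> linf_carrier V \<Longrightarrow> (\<lambda>v. cnj (a v)) \<in> linf_carrier V"
  by (rule linf_memI[of _ _ "linf_norm V a"]) (auto simp: linf_off cmod_le_linf_norm)

lemma linf_delta: "v \<in> V \<Longrightarrow> delta v \<in> linf_carrier V"
  by (rule linf_memI[of _ _ 1]) (auto simp: delta_def)

lemma function_module_linf: "function_module (linf V)"
  by unfold_locales (simp_all add: linf_zero linf_add linf_smult)

lemma positive_elements_linf:
  "positive_elements (linf V) = {a \<in> linf_carrier V. \<forall>v. a v \<in> \<real>\<^sub>\<ge>\<^sub>0}"
proof (intro equalityI subsetI)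
  fix a assume "a \<in> positive_elements (linf V)"
  then obtain b where b: "b \<in> linf_carrier V" "a = (\<lambda>v. cnj (b v) * b v)"
    by (auto simp: positive_elements_def)
  have "cnj z * z \<in> \<real>\<^sub>\<ge>\<^sub>0" for z
    by (simp add: complex_mult_cnj mult.commute[of "cnj z"] flip: of_real_power of_real_add)
  then show "a \<in> {a \<in> linf_carrier V. \<forall>v. a v \<in> \<real>\<^sub>\<ge>\<^sub>0}"
    using b linf_mult[OF linf_cnj, of b V b] by simp
next
  fix a assume "a \<in> {a \<in> linf_carrier V. \<forall>v. a v \<in> \<real>\<^sub>\<ge>\<^sub>0}"
  then have a: "a \<in> linf_carrier V" and pos: "a v \<in> \<real>\<^sub>\<ge>\<^sub>0" for v by auto
  define b where "b v = complex_of_real (sqrt (Re (a v)))" for v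
  have "b \<in> linf_carrier V"
  proof (rule linf_memI[of _ _ "sqrt (linf_norm V a)"])
    fix v
    show "b v = 0" if "v \<notin> V" using linf_off[OF a that] by (simp add: b_def)
    have "0 \<le> Re (a v)" using pos[of v] by (auto simp: nonneg_Reals_def)
    moreover have "Re (a v) \<le> linf_norm V a"
      by (rule order_trans[OF complex_Re_le_cmod cmod_le_linf_norm[OF a]])
    ultimately show "cmod (b v) \<le> sqrt (linf_norm V a)" by (simp add: b_def)
  qed
  moreover have "a = (\<lambda>v. cnj (b v) * b v)"
  proof
    fix v
    obtain r where r: "a v = of_real r" "0 \<le> r" using pos[of v] by (auto simp: nonneg_Reals_def)
    show "a v = cnj (b v) * b v" by (simp add: b_def r flip: of_real_mult)
  qed
  ultimately show "a \<in> positive_elements (linf V)" by (auto simp: positive_elements_def)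
qed

lemma cstar_algebra_linf: "cstar_algebra (linf V)"
proof -
  interpret function_module "linf V" by (rule function_module_linf)
  have mod: "module complex_ring (linf V)" by (rule is_module)
  interpret mod: module complex_ring "linf V" by (rule mod)
  have ring: "ring (linf V)"
    by (rule ringI[OF mod.M.abelian_group_axioms])
      (auto intro!: monoidI simp: linf_mult linf_one algebra_simps linf_off fun_eq_iff)
  have complete: "norm_complete (linf V) (linf_norm V)"
  proof (rule norm_complete_sup_L2[where \<F> = "(\<lambda>v. {v}) ` V"])
    show "carrier (linf V) =
      {x. (\<forall>i. i \<notin> \<Union> ((\<lambda>v. {v}) ` V) \<longrightarrow> x i = 0) \<and>
          (\<exists>K. \<forall>F\<in>(\<lambda>v. {v}) ` V. L2_set (\<lambda>i. cmod (x i)) F \<le> K)}"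
      by (auto simp: linf_carrier_def bounded_iff)
  qed (auto simp: linf_norm_le_iff linf_norm_nonneg)
  have eq0: "linf_norm V x = 0 \<longleftrightarrow> x = (\<lambda>_. 0)" if "x \<in> linf_carrier V" for x
  proof
    assume "linf_norm V x = 0"
    then show "x = (\<lambda>_. 0)" using cmod_le_linf_norm[OF that] by (auto simp: fun_eq_iff)
  next
    assume "x = (\<lambda>_. 0)"
    then show "linf_norm V x = 0"
      using linf_norm_le[of 0 V x] linf_norm_nonneg[OF that] by simp
  qed
  have tri: "linf_norm V (\<lambda>v. x v + y v) \<le> linf_norm V x + linf_norm V y"
    if "x \<in> linf_carrier V" "y \<in> linf_carrier V" for x y
    using that by (intro linf_norm_le)
      (auto intro!: norm_triangle_le add_mono cmod_le_linf_norm add_nonneg_nonneg linf_norm_nonneg)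
  have mult: "linf_norm V (\<lambda>v. x v * y v) \<le> linf_norm V x * linf_norm V y"
    if "x \<in> linf_carrier V" "y \<in> linf_carrier V" for x y
    using that by (intro linf_norm_le)
      (auto simp: norm_mult intro!: mult_mono cmod_le_linf_norm mult_nonneg_nonneg linf_norm_nonneg)
  have smult_le: "linf_norm V (\<lambda>v. c * x v) \<le> cmod c * linf_norm V x"
    if "x \<in> linf_carrier V" for c x
    using that by (intro linf_norm_le)
      (auto simp: norm_mult intro!: mult_left_mono cmod_le_linf_norm mult_nonneg_nonneg linf_norm_nonneg)
  have smult: "linf_norm V (\<lambda>v. c * x v) = cmod c * linf_norm V x" if "x \<in> linf_carrier V" for c x
  proof (cases "c = 0")
    case True
    then show ?thesis using eq0[OF linf_zero] by simp
  next
    case False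
    have "(\<lambda>v. inverse c * (c * x v)) = x" using False by (simp add: fun_eq_iff)
    then have "linf_norm V x = linf_norm V (\<lambda>v. inverse c * (c * x v))" by simp
    also have "\<dots> \<le> cmod (inverse c) * linf_norm V (\<lambda>v. c * x v)"
      by (rule smult_le[OF linf_smult[OF that]])
    finally have "cmod c * linf_norm V x \<le> linf_norm V (\<lambda>v. c * x v)"
      using False by (simp add: norm_inverse norm_divide field_simps)
    with smult_le[OF that, of c] show ?thesis by linarith
  qed
  have ident: "linf_norm V (\<lambda>v. cnj (x v) * x v) = (linf_norm V x)\<^sup>2" if x: "x \<in> linf_carrier V" for x
  proof (rule antisym)
    show "linf_norm V (\<lambda>v. cnj (x v) * x v) \<le> (linf_norm V x)\<^sup>2"
      by (rule linf_norm_le)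
        (auto simp: norm_mult power2_eq_square intro!: mult_mono cmod_le_linf_norm linf_norm_nonneg x)
    have m: "(\<lambda>v. cnj (x v) * x v) \<in> linf_carrier V" by (intro linf_mult linf_cnj x)
    have "linf_norm V x \<le> sqrt (linf_norm V (\<lambda>v. cnj (x v) * x v))"
    proof (rule linf_norm_le)
      show "cmod (x v) \<le> sqrt (linf_norm V (\<lambda>v. cnj (x v) * x v))" for v
        using cmod_le_linf_norm[OF m, of v]
        by (intro real_le_rsqrt) (simp add: norm_mult power2_eq_square)
    qed (simp add: linf_norm_nonneg[OF m])
    then show "(linf_norm V x)\<^sup>2 \<le> linf_norm V (\<lambda>v. cnj (x v) * x v)"
      using linf_norm_nonneg[OF x] linf_norm_nonneg[OF m] by (metis power_mono real_sqrt_pow2)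
  qed
  show ?thesis
    by (intro cstar_algebra.intro cstar_algebra_axioms.intro ring mod)
      (simp_all add: linf_cnj complete eq0 tri mult smult ident linf_norm_nonneg mult.assoc
        mult.left_commute mult.commute[of "cnj _" "cnj _"])
qed


text \<open>\<open>\<ell>\<^sup>1\<close> sits isometrically in the dual of \<open>\<ell>\<^sup>\<infinity>\<close>: the phases of finitely many values
  \<open>\<chi> (delta v)\<close> form a vector of norm at most one on which \<open>\<chi>\<close> takes the sum of their moduli.\<close>

lemma linf_dual_bounds:
  assumes "\<phi> \<in> dual_space (linf V) (linf_norm V)"
  shows cmod_le_dual_norm:
      "x \<in> linf_carrier V \<Longrightarrow> cmod (\<phi> x) \<le> dual_norm (linf V) (linf_norm V) \<phi> * linf_norm V x"
    and sum_delta_le_dual_norm: "\<lbrakk>finite F; F \<subseteq> V\<rbrakk> \<Longrightarrow>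
      (\<Sum>v\<in>F. cmod (\<phi> (delta v))) \<le> dual_norm (linf V) (linf_norm V) \<phi>"
    and dual_norm_nonneg: "0 \<le> dual_norm (linf V) (linf_norm V) \<phi>"
proof -
  interpret C: cstar_algebra "linf V" by (rule cstar_algebra_linf)
  let ?S = "{cmod (\<phi> x) | x. x \<in> linf_carrier V \<and> linf_norm V x \<le> 1}"
  have add: "\<phi> (\<lambda>v. x v + y v) = \<phi> x + \<phi> y" if "x \<in> linf_carrier V" "y \<in> linf_carrier V" for x y
    using assms that by (simp add: dual_space_def)
  have smult: "\<phi> (\<lambda>v. c * x v) = c * \<phi> x" if "x \<in> linf_carrier V" for c x
    using assms that by (simp add: dual_space_def)
  obtain K where K: "\<forall>x\<in>linf_carrier V. cmod (\<phi> x) \<le> K * linf_norm V x"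
    using assms by (auto simp: dual_space_def)
  have bdd: "bdd_above ?S"
  proof (rule bdd_aboveI)
    fix r assume "r \<in> ?S"
    then obtain x where x: "x \<in> linf_carrier V" "linf_norm V x \<le> 1" "r = cmod (\<phi> x)" by blast
    have "K * linf_norm V x \<le> \<bar>K\<bar> * 1"
      using x linf_norm_nonneg[OF x(1)] by (intro mult_mono) auto
    then show "r \<le> \<bar>K\<bar>" using K x by fastforce
  qed
  have up: "cmod (\<phi> x) \<le> dual_norm (linf V) (linf_norm V) \<phi>"
    if "x \<in> linf_carrier V" "linf_norm V x \<le> 1" for x
    unfolding dual_norm_def by (rule cSup_upper) (use that bdd in auto)
  show nonneg: "0 \<le> dual_norm (linf V) (linf_norm V) \<phi>"
  proof -
    have "linf_norm V (\<lambda>_. 0) \<le> 1" by (rule linf_norm_le) auto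
    from order_trans[OF norm_ge_zero up[OF linf_zero this]] show ?thesis .
  qed
  show "cmod (\<phi> x) \<le> dual_norm (linf V) (linf_norm V) \<phi> * linf_norm V x" if x: "x \<in> linf_carrier V"
  proof (cases "linf_norm V x = 0")
    case True
    then show ?thesis using K x by auto
  next
    case False
    define N where "N = linf_norm V x"
    have N: "N > 0" using False linf_norm_nonneg[OF x] by (simp add: N_def)
    let ?y = "\<lambda>v. complex_of_real (inverse N) * x v"
    have "linf_norm V ?y = 1" using C.cnorm_smult[of x "complex_of_real (inverse N)"] x N
      by (simp add: N_def[symmetric] norm_inverse)
    then have "cmod (\<phi> ?y) \<le> dual_norm (linf V) (linf_norm V) \<phi>"
      using up linf_smult[OF x] by simp
    then show ?thesis
      unfolding smult[OF x] using N
      by (simp add: N_def[symmetric] norm_mult norm_inverse norm_divide field_simps)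
  qed
  show "(\<Sum>v\<in>F. cmod (\<phi> (delta v))) \<le> dual_norm (linf V) (linf_norm V) \<phi>" if F: "finite F" "F \<subseteq> V"
  proof -
    interpret function_module "linf V" by (rule function_module_linf)
    let ?c = "\<lambda>v. cnj (sgn (\<phi> (delta v)))"
    let ?a = "\<lambda>v. if v \<in> F then ?c v else 0"
    have *: "?a \<in> linf_carrier V \<and> \<phi> ?a = (\<Sum>v\<in>F. ?c v * \<phi> (delta v))"
    proof -
      have "delta v \<in> carrier (linf V)" if "v \<in> F" for v
        using that F by (auto intro: linf_delta)
      from linear_finite_support[OF F(1) this, of \<phi> ?c] show ?thesis
        using add smult by simp
    qed
    have c: "cnj (sgn z) * z = of_real (cmod z)" for z :: complex
      by (cases "z = 0") (simp_all add: sgn_eq mult.commute[of _ z] complex_norm_square[symmetric] power2_eq_square)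
    have "linf_norm V ?a \<le> 1"
      by (rule linf_norm_le) (auto simp: norm_sgn)
    then have "cmod (\<phi> ?a) \<le> dual_norm (linf V) (linf_norm V) \<phi>" using up * by blast
    moreover have "\<phi> ?a = of_real (\<Sum>v\<in>F. cmod (\<phi> (delta v)))"
      using * by (simp add: c)
    ultimately show ?thesis by (simp add: sum_nonneg del: of_real_sum)
  qed
qed

lemma linf_dual_norm_le:
  assumes "\<And>x. x \<in> linf_carrier V \<Longrightarrow> cmod (\<phi> x) \<le> K * linf_norm V x" "0 \<le> K"
  shows "dual_norm (linf V) (linf_norm V) \<phi> \<le> K"
  unfolding dual_norm_def
proof (rule cSup_least)
  show "{cmod (\<phi> x) | x. x \<in> carrier (linf V) \<and> linf_norm V x \<le> 1} \<noteq> {}"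
    using linf_zero[of V] linf_norm_le[of 1 V "\<lambda>_. 0"] by (auto intro!: exI[of _ "\<lambda>_. 0"])
  fix r assume "r \<in> {cmod (\<phi> x) | x. x \<in> carrier (linf V) \<and> linf_norm V x \<le> 1}"
  then obtain x where x: "x \<in> linf_carrier V" "linf_norm V x \<le> 1" "r = cmod (\<phi> x)" by auto
  have "K * linf_norm V x \<le> K * 1" using x assms by (intro mult_left_mono) auto
  then show "r \<le> K" using assms(1)[OF x(1)] x by simp
qed

lemma l1_times_linf:
  assumes f: "(\<lambda>v. cmod (f v)) summable_on V" and a: "a \<in> linf_carrier V"
  shows "(\<lambda>v. f v * a v) summable_on V" "(\<lambda>v. cmod (f v * a v)) summable_on V"
    and "cmod (\<Sum>\<^sub>\<infinity>v\<in>V. f v * a v) \<le> (\<Sum>\<^sub>\<infinity>v\<in>V. cmod (f v)) * linf_norm V a"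
proof -
  have le: "cmod (f v * a v) \<le> cmod (f v) * linf_norm V a" for v
    by (simp add: norm_mult mult_left_mono cmod_le_linf_norm[OF a])
  have s: "(\<lambda>v. cmod (f v) * linf_norm V a) summable_on V"
    by (rule summable_on_cmult_left[OF f])
  show abs: "(\<lambda>v. cmod (f v * a v)) summable_on V"
    by (rule Infinite_Sum.abs_summable_on_comparison_test'[OF s le])
  then show "(\<lambda>v. f v * a v) summable_on V" by (rule abs_summable_summable)
  have "cmod (\<Sum>\<^sub>\<infinity>v\<in>V. f v * a v) \<le> (\<Sum>\<^sub>\<infinity>v\<in>V. cmod (f v * a v))"
    by (rule norm_infsum_bound[OF abs])
  also have "\<dots> \<le> (\<Sum>\<^sub>\<infinity>v\<in>V. cmod (f v) * linf_norm V a)"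
    by (rule infsum_mono[OF abs s le])
  finally show "cmod (\<Sum>\<^sub>\<infinity>v\<in>V. f v * a v) \<le> (\<Sum>\<^sub>\<infinity>v\<in>V. cmod (f v)) * linf_norm V a"
    by (simp add: infsum_cmult_left')
qed

lemma linf_functional_dual:
  assumes f: "(\<lambda>v. cmod (f v)) summable_on V"
  shows "linf_functional V f \<in> dual_space (linf V) (linf_norm V)"
    and "dual_norm (linf V) (linf_norm V) (linf_functional V f) \<le> (\<Sum>\<^sub>\<infinity>v\<in>V. cmod (f v))"
proof -
  note s = l1_times_linf[OF f]
  have "linf_functional V f (\<lambda>v. x v + y v) = linf_functional V f x + linf_functional V f y"
    if "x \<in> linf_carrier V" "y \<in> linf_carrier V" for x y
    using that by (simp add: linf_functional_def linf_add distrib_left infsum_add s)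
  moreover have "linf_functional V f (\<lambda>v. c * x v) = c * linf_functional V f x"
    if "x \<in> linf_carrier V" for c x
    using that by (simp add: linf_functional_def linf_smult mult.left_commute[of _ c] infsum_cmult_right')
  moreover have bound:
    "cmod (linf_functional V f x) \<le> (\<Sum>\<^sub>\<infinity>v\<in>V. cmod (f v)) * linf_norm V x" if "x \<in> linf_carrier V" for x
    using that s(3) by (simp add: linf_functional_def)
  moreover have "linf_functional V f x = 0" if "x \<notin> linf_carrier V" for x
    using that by (simp add: linf_functional_def)
  ultimately show "linf_functional V f \<in> dual_space (linf V) (linf_norm V)"
    unfolding dual_space_def by (auto intro!: exI[of _ "\<Sum>\<^sub>\<infinity>v\<in>V. cmod (f v)"])
  show "dual_norm (linf V) (linf_norm V) (linf_functional V f) \<le> (\<Sum>\<^sub>\<infinity>v\<in>V. cmod (f v))"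
    by (rule linf_dual_norm_le[OF bound infsum_nonneg]) auto
qed

lemma summable_delta: "(\<lambda>u. cmod (delta v u)) summable_on V"
  by (rule finite_nonzero_values_imp_summable_on) (auto simp: delta_def)

lemma infsum_delta: "v \<in> V \<Longrightarrow> (\<Sum>\<^sub>\<infinity>u\<in>V. delta v u * f u) = f v"
  by (subst infsum_cong_neutral[where T = "{v}" and g = "\<lambda>u. f u"]) (auto simp: delta_def)

lemma evaluation_in_predual:
  assumes "v \<in> V"
  shows "(\<lambda>a. if a \<in> linf_carrier V then a v else 0) \<in> predual (linf V)"
  unfolding predual_linf using summable_delta[of v V]
  by (auto intro!: exI[of _ "delta v"] simp: linf_functional_def infsum_delta[OF assms] fun_eq_iff)

text \<open>A functional \<open>L\<close> on the predual is evaluation at \<open>x v = L (ev v)\<close>, where \<open>ev v\<close> is the evaluation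
  at \<open>v\<close>: both agree on finitely supported families, and the tail of a summable family has small
  norm.\<close>

lemma linf_predual_onto:
  assumes add: "\<And>\<phi> \<psi>. \<lbrakk>\<phi> \<in> predual (linf V); \<psi> \<in> predual (linf V)\<rbrakk>
      \<Longrightarrow> L (\<lambda>x. \<phi> x + \<psi> x) = L \<phi> + (L \<psi> :: complex)"
    and scale: "\<And>c \<phi>. \<phi> \<in> predual (linf V) \<Longrightarrow> L (\<lambda>x. c * \<phi> x) = c * L \<phi>"
    and bound: "\<exists>K. \<forall>\<phi>\<in>predual (linf V). cmod (L \<phi>) \<le> K * dual_norm (linf V) (linf_norm V) \<phi>"
  shows "\<exists>x\<in>linf_carrier V. \<forall>\<phi>\<in>predual (linf V). L \<phi> = \<phi> x"
proof -
  let ?ev = "\<lambda>f. linf_functional V f"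
  define x where "x v = (if v \<in> V then L (?ev (delta v)) else 0)" for v
  obtain K0 where K0: "\<forall>\<phi>\<in>predual (linf V). cmod (L \<phi>) \<le> K0 * dual_norm (linf V) (linf_norm V) \<phi>"
    using bound by blast
  have bound': "cmod (L (?ev f)) \<le> \<bar>K0\<bar> * (\<Sum>\<^sub>\<infinity>v\<in>V. cmod (f v))"
    if f: "(\<lambda>v. cmod (f v)) summable_on V" for f
  proof -
    note d = linf_functional_dual[OF f]
    have "cmod (L (?ev f)) \<le> K0 * dual_norm (linf V) (linf_norm V) (?ev f)"
      using K0 f by (auto simp: predual_linf)
    also have "\<dots> \<le> \<bar>K0\<bar> * (\<Sum>\<^sub>\<infinity>v\<in>V. cmod (f v))"
      by (intro mult_mono d dual_norm_nonneg) auto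
    finally show ?thesis .
  qed
  have ladd: "L (?ev (\<lambda>v. f v + g v)) = L (?ev f) + L (?ev g)"
    if f: "(\<lambda>v. cmod (f v)) summable_on V" and g: "(\<lambda>v. cmod (g v)) summable_on V" for f g
  proof -
    have "?ev (\<lambda>v. f v + g v) = (\<lambda>a. ?ev f a + ?ev g a)"
      using l1_times_linf(1)[OF f] l1_times_linf(1)[OF g]
      by (auto simp: linf_functional_def fun_eq_iff distrib_right infsum_add)
    then show ?thesis using add f g by (auto simp: predual_linf)
  qed
  have lscale: "L (?ev (\<lambda>v. c * f v)) = c * L (?ev f)"
    if f: "(\<lambda>v. cmod (f v)) summable_on V" for c f
  proof -
    have "?ev (\<lambda>v. c * f v) = (\<lambda>a. c * ?ev f a)"
      by (auto simp: linf_functional_def fun_eq_iff mult.assoc infsum_cmult_right')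
    then show ?thesis using scale f by (auto simp: predual_linf)
  qed
  have xbound: "cmod (x v) \<le> \<bar>K0\<bar>" if "v \<in> V" for v
  proof -
    have "(\<Sum>\<^sub>\<infinity>u\<in>V. cmod (delta v u)) = (\<Sum>\<^sub>\<infinity>u\<in>{v}. 1)"
      using that by (intro infsum_cong_neutral) (auto simp: delta_def)
    then show ?thesis using bound'[OF summable_delta, of v] that by (simp add: x_def)
  qed
  then have x: "x \<in> linf_carrier V" by (intro linf_memI[of _ _ "\<bar>K0\<bar>"]) (auto simp: x_def)
  have "L (?ev f) = ?ev f x" if f: "(\<lambda>v. cmod (f v)) summable_on V" for f
  proof -
    \<comment> \<open>\<open>L\<close> seen as a functional on the Banach space of summable families.\<close>
    interpret l1: function_space "{f. (\<lambda>v. cmod (f v)) summable_on V}"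
    proof (rule function_space.intro, goal_cases)
      case (2 x y)
      then show ?case
        by (auto intro: Infinite_Sum.abs_summable_on_comparison_test'[OF summable_on_add[of "\<lambda>v. cmod (x v)" V "\<lambda>v. cmod (y v)"]]
          norm_triangle_ineq)
    qed (auto simp: norm_mult intro: summable_on_cmult_right)
    have fin: "(\<lambda>v. cmod (if v \<in> F then f v else 0)) summable_on V \<and>
        L (?ev (\<lambda>v. if v \<in> F then f v else 0)) = (\<Sum>v\<in>F. f v * x v)" if F: "finite F" "F \<subseteq> V" for F
      using l1.linear_finite_support[of F "\<lambda>f. L (?ev f)" f] F(2)
      by (auto simp: F(1) summable_delta ladd lscale x_def subsetD[OF F(2)] intro!: sum.cong)
    have "((\<lambda>v. f v * x v) has_sum L (?ev f)) V"
    proof (rule has_sum_if_error_vanishes)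
      fix F assume F: "finite F" "F \<subseteq> V"
      let ?f = "\<lambda>v. if v \<in> F then f v else 0" and ?g = "\<lambda>v. if v \<in> F then 0 else f v"
      have g: "(\<lambda>v. cmod (?g v)) summable_on V"
        by (rule Infinite_Sum.abs_summable_on_comparison_test'[OF f]) auto
      have "(\<lambda>v. ?f v + ?g v) = f" by auto
      then have "L (?ev f) = (\<Sum>v\<in>F. f v * x v) + L (?ev ?g)"
        using ladd[OF _ g, of ?f] fin[OF F] by simp
      moreover have "(\<Sum>\<^sub>\<infinity>v\<in>V. cmod (?g v)) = (\<Sum>\<^sub>\<infinity>v\<in>V - F. cmod (f v))"
        by (rule infsum_cong_neutral) auto
      moreover have "\<dots> = (\<Sum>\<^sub>\<infinity>v\<in>V. cmod (f v)) - (\<Sum>v\<in>F. cmod (f v))"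
        using infsum_Diff[OF f summable_on_finite F(2)] F by simp
      ultimately show "cmod (L (?ev f) - (\<Sum>v\<in>F. f v * x v))
          \<le> \<bar>K0\<bar> * ((\<Sum>\<^sub>\<infinity>v\<in>V. cmod (f v)) - (\<Sum>v\<in>F. cmod (f v)))"
        using bound'[OF g] by simp
    next
      show "((\<lambda>F. \<bar>K0\<bar> * ((\<Sum>\<^sub>\<infinity>v\<in>V. cmod (f v)) - (\<Sum>v\<in>F. cmod (f v)))) \<longlongrightarrow> 0) (finite_subsets_at_top V)"
        using tendsto_mult_left[OF tail_sum_vanishes[OF f], of "\<bar>K0\<bar>"] by simp
    qed
    then show ?thesis using x by (simp add: linf_functional_def infsumI)
  qed
  then show ?thesis using x by (auto simp: predual_linf)
qed

text \<open>A norm limit \<open>\<phi>\<close> of predual elements is again given by a summable family, namely by its values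
  \<open>f v = \<phi> (delta v)\<close>.  If \<open>g\<close> represents an approximant, then the \<open>\<ell>\<^sup>1\<close>-distance of \<open>f\<close> and \<open>g\<close> is
  bounded by the dual norm of the difference, so \<open>\<phi>\<close> and the functional of \<open>f\<close> are both close to
  the functional of \<open>g\<close>.\<close>

lemma linf_predual_closed:
  assumes \<phi>: "\<phi> \<in> dual_space (linf V) (linf_norm V)"
    and approx: "\<And>\<epsilon>. \<epsilon> > 0 \<Longrightarrow>
      \<exists>\<psi>\<in>predual (linf V). dual_norm (linf V) (linf_norm V) (\<lambda>x. \<phi> x - \<psi> x) < \<epsilon>"
  shows "\<phi> \<in> predual (linf V)"
proof -
  define f where "f v = \<phi> (delta v)" for v
  have f: "(\<lambda>v. cmod (f v)) summable_on V"
    by (rule nonneg_bdd_above_summable_on)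
      (auto simp: f_def intro!: bdd_aboveI2 sum_delta_le_dual_norm[OF \<phi>])
  have "\<phi> a = linf_functional V f a" for a
  proof (cases "a \<in> linf_carrier V")
    case False
    then show ?thesis using \<phi> by (simp add: dual_space_def linf_functional_def)
  next
    case a: True
    have "cmod (\<phi> a - linf_functional V f a) \<le> 0 + e" if "e > 0" for e
    proof -
      define \<epsilon> where "\<epsilon> = e / (2 * (linf_norm V a + 1))"
      have N: "linf_norm V a + 1 > 0" using linf_norm_nonneg[OF a] by linarith
      then have "\<epsilon> > 0" using that by (simp add: \<epsilon>_def)
      then obtain g where g: "(\<lambda>v. cmod (g v)) summable_on V"
        and close: "dual_norm (linf V) (linf_norm V) (\<lambda>x. \<phi> x - linf_functional V g x) < \<epsilon>"
        using approx by (auto simp: predual_linf)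
      let ?\<chi> = "\<lambda>x. \<phi> x - linf_functional V g x"
      have \<chi>: "?\<chi> \<in> dual_space (linf V) (linf_norm V)"
      proof -
        obtain K where "\<forall>x\<in>linf_carrier V. cmod (\<phi> x) \<le> K * linf_norm V x"
          using \<phi> by (auto simp: dual_space_def)
        moreover obtain K' where "\<forall>x\<in>linf_carrier V. cmod (linf_functional V g x) \<le> K' * linf_norm V x"
          using linf_functional_dual(1)[OF g] by (auto simp: dual_space_def)
        ultimately have "\<forall>x\<in>linf_carrier V. cmod (?\<chi> x) \<le> (K + K') * linf_norm V x"
          by (auto simp: distrib_right intro!: norm_triangle_le_diff add_mono)
        then have "\<exists>K. \<forall>x\<in>linf_carrier V. cmod (?\<chi> x) \<le> K * linf_norm V x" by blast
        then show ?thesis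
          using \<phi> linf_functional_dual(1)[OF g] unfolding dual_space_def
          by (simp add: algebra_simps)
      qed
      have fg: "f v - g v = ?\<chi> (delta v)" if "v \<in> V" for v
      proof -
        have "linf_functional V g (delta v) = g v"
          using infsum_delta[OF that, of g] that
          by (simp add: linf_functional_def linf_delta mult.commute)
        then show ?thesis by (simp add: f_def)
      qed
      have fgs: "(\<lambda>v. cmod (f v - g v)) summable_on V"
        by (rule Infinite_Sum.abs_summable_on_comparison_test'[OF summable_on_add[OF f g]])
          (rule norm_triangle_ineq4)
      have "(\<Sum>\<^sub>\<infinity>v\<in>V. cmod (f v - g v)) \<le> dual_norm (linf V) (linf_norm V) ?\<chi>"
      proof (rule infsum_le_finite_sums[OF fgs])
        fix F assume F: "finite F" "F \<subseteq> V"
        then have "(\<Sum>v\<in>F. cmod (f v - g v)) = (\<Sum>v\<in>F. cmod (?\<chi> (delta v)))"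
          by (intro sum.cong) (auto simp: fg)
        then show "(\<Sum>v\<in>F. cmod (f v - g v)) \<le> dual_norm (linf V) (linf_norm V) ?\<chi>"
          using sum_delta_le_dual_norm[OF \<chi> F] by simp
      qed
      then have l1: "(\<Sum>\<^sub>\<infinity>v\<in>V. cmod (f v - g v)) \<le> \<epsilon>" using close by simp
      have "linf_functional V f a - linf_functional V g a = (\<Sum>\<^sub>\<infinity>v\<in>V. (f v - g v) * a v)"
        using a infsum_add[OF l1_times_linf(1)[OF f a] summable_on_uminus[THEN iffD2, OF l1_times_linf(1)[OF g a]]]
        by (simp add: linf_functional_def left_diff_distrib infsum_uminus)
      then have "cmod (linf_functional V f a - linf_functional V g a) \<le> \<epsilon> * linf_norm V a"
        using l1_times_linf(3)[OF fgs a] mult_right_mono[OF l1 linf_norm_nonneg[OF a]] by simp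
      moreover have "cmod (\<phi> a - linf_functional V g a) \<le> \<epsilon> * linf_norm V a"
        using cmod_le_dual_norm[OF \<chi> a] mult_right_mono[OF less_imp_le[OF close] linf_norm_nonneg[OF a]]
        by simp
      ultimately have "cmod (\<phi> a - linf_functional V f a) \<le> \<epsilon> * linf_norm V a + \<epsilon> * linf_norm V a"
        using norm_triangle_ineq4[of "\<phi> a - linf_functional V g a" "linf_functional V f a - linf_functional V g a"]
        by simp
      also have "\<dots> \<le> 2 * \<epsilon> * (linf_norm V a + 1)" using \<open>\<epsilon> > 0\<close> by (simp add: algebra_simps)
      also have "\<dots> = e" using N by (simp add: \<epsilon>_def field_simps)
      finally show ?thesis by simp
    qed
    then have "cmod (\<phi> a - linf_functional V f a) \<le> 0" by (rule field_le_epsilon)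
    then show ?thesis by simp
  qed
  then have "\<phi> = linf_functional V f" by (rule ext)
  then show ?thesis using f by (auto simp: predual_linf)
qed

lemma wstar_algebra_linf: "wstar_algebra (linf V)"
proof (intro wstar_algebra.intro cstar_algebra_linf wstar_algebra_axioms.intro)
  show "predual (linf V) \<subseteq> dual_space (linf V) (cnorm (linf V))"
    using linf_functional_dual(1) by (auto simp: predual_linf)
  show "(\<lambda>_. 0) \<in> predual (linf V)"
    by (auto simp: predual_linf linf_functional_def fun_eq_iff intro!: exI[of _ "\<lambda>_. 0"])
  show "(\<lambda>x. \<phi> x + \<psi> x) \<in> predual (linf V)" if mem: "\<phi> \<in> predual (linf V)" "\<psi> \<in> predual (linf V)" for \<phi> \<psi>
  proof -
    obtain f g where f: "(\<lambda>v. cmod (f v)) summable_on V" "\<phi> = linf_functional V f"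
      and g: "(\<lambda>v. cmod (g v)) summable_on V" "\<psi> = linf_functional V g"
      using mem unfolding predual_linf by blast
    have "(\<lambda>v. cmod (f v + g v)) summable_on V"
      by (rule Infinite_Sum.abs_summable_on_comparison_test'[OF summable_on_add[OF f(1) g(1)]]) (rule norm_triangle_ineq)
    moreover have "linf_functional V (\<lambda>v. f v + g v) = (\<lambda>a. \<phi> a + \<psi> a)"
      using l1_times_linf(1)[OF f(1)] l1_times_linf(1)[OF g(1)]
      by (auto simp: f g linf_functional_def fun_eq_iff distrib_right infsum_add)
    ultimately show ?thesis unfolding predual_linf by (auto intro!: exI[of _ "\<lambda>v. f v + g v"])
  qed
  show "(\<lambda>x. c * \<phi> x) \<in> predual (linf V)" if mem: "\<phi> \<in> predual (linf V)" for c \<phi>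
  proof -
    obtain f where f: "(\<lambda>v. cmod (f v)) summable_on V" "\<phi> = linf_functional V f"
      using mem by (auto simp: predual_linf)
    have "linf_functional V (\<lambda>v. c * f v) = (\<lambda>a. c * \<phi> a)"
      by (auto simp: f linf_functional_def fun_eq_iff mult.assoc infsum_cmult_right')
    moreover have "(\<lambda>v. cmod (c * f v)) summable_on V"
      using f by (simp add: norm_mult summable_on_cmult_right)
    ultimately show ?thesis unfolding predual_linf by (auto intro!: exI[of _ "\<lambda>v. c * f v"])
  qed
  show "\<phi> \<in> predual (linf V)" if "\<phi> \<in> dual_space (linf V) (cnorm (linf V))"
    "\<And>\<epsilon>. \<epsilon> > 0 \<Longrightarrow> \<exists>\<psi>\<in>predual (linf V). dual_norm (linf V) (cnorm (linf V)) (\<lambda>x. \<phi> x - \<psi> x) < \<epsilon>" for \<phi>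
    by (rule linf_predual_closed[OF that[unfolded linf_simps]])
  show "cnorm (linf V) x =
      Sup {cmod (\<phi> x) | \<phi>. \<phi> \<in> predual (linf V) \<and> dual_norm (linf V) (cnorm (linf V)) \<phi> \<le> 1}"
    if x: "x \<in> carrier (linf V)" for x
  proof -
    let ?S = "{cmod (\<phi> x) | \<phi>. \<phi> \<in> predual (linf V) \<and> dual_norm (linf V) (linf_norm V) \<phi> \<le> 1}"
    have le: "r \<le> linf_norm V x" if r: "r \<in> ?S" for r
    proof -
      obtain f where f: "(\<lambda>v. cmod (f v)) summable_on V" "r = cmod (linf_functional V f x)"
        "dual_norm (linf V) (linf_norm V) (linf_functional V f) \<le> 1"
        using r by (auto simp: predual_linf)
      have "r \<le> dual_norm (linf V) (linf_norm V) (linf_functional V f) * linf_norm V x"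
        unfolding f(2) by (rule cmod_le_dual_norm[OF linf_functional_dual(1)[OF f(1)]]) (use x in simp)
      also have "\<dots> \<le> 1 * linf_norm V x"
        using x by (intro mult_right_mono f(3) linf_norm_nonneg) auto
      finally show ?thesis by simp
    qed
    have mem: "cmod (x v) \<in> ?S" if "v \<in> V" for v
    proof -
      let ?\<phi> = "\<lambda>a. if a \<in> linf_carrier V then a v else 0"
      have "dual_norm (linf V) (linf_norm V) ?\<phi> \<le> 1"
        by (rule linf_dual_norm_le) (auto simp: cmod_le_linf_norm)
      then show ?thesis using x evaluation_in_predual[OF that] by (auto intro!: exI[of _ ?\<phi>])
    qed
    have zero: "0 \<in> ?S"
    proof -
      have "(\<lambda>_. 0) \<in> predual (linf V)"
        by (auto simp: predual_linf linf_functional_def fun_eq_iff intro!: exI[of _ "\<lambda>_. 0"])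
      moreover have "dual_norm (linf V) (linf_norm V) (\<lambda>_. 0) \<le> 1"
        by (rule linf_dual_norm_le) (use linf_norm_nonneg in auto)
      ultimately show ?thesis by force
    qed
    have bdd: "bdd_above ?S" using le by (rule bdd_aboveI)
    have "linf_norm V x \<le> Sup ?S"
      by (rule linf_norm_le) (use cSup_upper[OF zero bdd] cSup_upper[OF mem bdd] in auto)
    moreover have "Sup ?S \<le> linf_norm V x" using zero by (intro cSup_least le) auto
    ultimately show ?thesis by simp
  qed
  show "\<exists>x\<in>carrier (linf V). \<forall>\<phi>\<in>predual (linf V). L \<phi> = \<phi> x"
    if "\<And>\<phi> \<psi>. \<lbrakk>\<phi> \<in> predual (linf V); \<psi> \<in> predual (linf V)\<rbrakk> \<Longrightarrow> L (\<lambda>x. \<phi> x + \<psi> x) = L \<phi> + L \<psi>"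
      "\<And>c \<phi>. \<phi> \<in> predual (linf V) \<Longrightarrow> L (\<lambda>x. c * \<phi> x) = c * L \<phi>"
      "\<exists>K. \<forall>\<phi>\<in>predual (linf V). cmod (L \<phi>) \<le> K * dual_norm (linf V) (cnorm (linf V)) \<phi>" for L
    using linf_predual_onto[of V L] that by simp
qed


section \<open>Square-summable families\<close>

definition l2 :: "'i set \<Rightarrow> ('i \<Rightarrow> complex) set"
  where "l2 A = {x. (\<forall>i. i \<notin> A \<longrightarrow> x i = 0) \<and> (\<lambda>i. (cmod (x i))\<^sup>2) summable_on A}"

lemma square_summable_product:
  fixes x y :: "'i \<Rightarrow> complex"
  assumes "(\<lambda>i. (cmod (x i))\<^sup>2) summable_on A" "(\<lambda>i. (cmod (y i))\<^sup>2) summable_on A"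
  shows "(\<lambda>i. cmod (cnj (x i) * y i)) summable_on A"
  using abs_summable_product[of "\<lambda>i. cnj (x i)" A y] assms
  by (simp add: norm_mult power2_eq_square)

lemma norm_mult_le_sum_squares: "cmod (cnj x * y) \<le> (cmod x)\<^sup>2 + (cmod y)\<^sup>2"
proof -
  have "0 \<le> (cmod x - cmod y)\<^sup>2" "0 \<le> cmod x * cmod y" by simp_all
  then have "cmod x * cmod y \<le> (cmod x)\<^sup>2 + (cmod y)\<^sup>2"
    unfolding power2_diff by linarith
  then show ?thesis by (simp add: norm_mult)
qed

lemma norm_add_square_le: "(cmod (x + y))\<^sup>2 \<le> 2 * (cmod x)\<^sup>2 + 2 * (cmod y)\<^sup>2"
proof -
  have "(cmod (x + y))\<^sup>2 \<le> (cmod x + cmod y)\<^sup>2"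
    by (intro power_mono norm_triangle_ineq) simp
  also have "\<dots> \<le> 2 * (cmod x)\<^sup>2 + 2 * (cmod y)\<^sup>2"
    using zero_le_power2[of "cmod x - cmod y"] by (simp add: power2_sum power2_diff)
  finally show ?thesis .
qed

lemma l2_finite_support: "\<lbrakk>finite F; F \<subseteq> A\<rbrakk> \<Longrightarrow> (\<lambda>i. if i \<in> F then c i else 0) \<in> l2 A"
  unfolding l2_def by (auto intro!: finite_nonzero_values_imp_summable_on elim: finite_subset[rotated])

lemma l2_delta: "i \<in> A \<Longrightarrow> delta i \<in> l2 A"
  using l2_finite_support[of "{i}" A "\<lambda>_. 1"] by (simp add: delta_def)

lemma function_space_l2: "function_space (l2 A)"
proof
  show "(\<lambda>i. x i + y i) \<in> l2 A" if "x \<in> l2 A" "y \<in> l2 A" for x y :: "'a \<Rightarrow> complex"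
  proof -
    have "(\<lambda>i. 2 * (cmod (x i))\<^sup>2 + 2 * (cmod (y i))\<^sup>2) summable_on A"
      using that by (intro summable_on_add summable_on_cmult_right) (auto simp: l2_def)
    then have "(\<lambda>i. (cmod (x i + y i))\<^sup>2) summable_on A"
      by (rule summable_on_comparison_test) (auto intro: norm_add_square_le)
    then show ?thesis using that by (simp add: l2_def)
  qed
qed (auto simp: l2_def norm_mult power_mult_distrib intro: summable_on_cmult_right)

text \<open>The representing vector has the entries \<open>cnj (g (delta i))\<close>.  It is square-summable because
  \<open>g\<close> maps its finite truncations to their squared norms, and it represents \<open>g\<close> because a vector
  of \<open>l2 A\<close> is the limit of its finite truncations.\<close>

lemma riesz_l2:
  assumes add: "\<And>x y. \<lbrakk>x \<in> l2 A; y \<in> l2 A\<rbrakk> \<Longrightarrow> g (\<lambda>i. x i + y i) = g x + (g y :: complex)"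
    and smult: "\<And>t x. x \<in> l2 A \<Longrightarrow> g (\<lambda>i. t * x i) = t * g x"
    and bound: "\<And>x. x \<in> l2 A \<Longrightarrow> (cmod (g x))\<^sup>2 \<le> K * (\<Sum>\<^sub>\<infinity>i\<in>A. (cmod (x i))\<^sup>2)"
    and K: "0 \<le> K"
  defines "y \<equiv> \<lambda>i. if i \<in> A then cnj (g (delta i)) else 0"
  shows riesz_vector_l2: "y \<in> l2 A"
    and riesz_vector_norm: "(\<Sum>\<^sub>\<infinity>i\<in>A. (cmod (y i))\<^sup>2) \<le> K"
    and riesz_represents: "x \<in> l2 A \<Longrightarrow> ((\<lambda>i. cnj (y i) * x i) has_sum g x) A"
proof -
  interpret function_space "l2 A" by (rule function_space_l2)
  have fin: "g (\<lambda>i. if i \<in> F then c i else 0) = (\<Sum>i\<in>F. c i * g (delta i))"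
    if F: "finite F" "F \<subseteq> A" for F c
  proof -
    have "delta i \<in> l2 A" if "i \<in> F" for i using that F by (auto intro: l2_delta)
    from linear_finite_support[OF F(1) this, of g c] show ?thesis using add smult by simp
  qed
  have partial: "(\<Sum>i\<in>F. (cmod (y i))\<^sup>2) \<le> K" if F: "finite F" "F \<subseteq> A" for F
  proof -
    let ?z = "\<lambda>i. if i \<in> F then y i else 0" and ?S = "\<Sum>i\<in>F. (cmod (y i))\<^sup>2"
    have "g ?z = (\<Sum>i\<in>F. complex_of_real ((cmod (y i))\<^sup>2))"
      unfolding fin[OF F] using F(2)
      by (intro sum.cong refl) (auto simp: y_def complex_norm_square mult.commute simp del: of_real_power)
    then have gz: "g ?z = of_real ?S" by simp
    have "(\<Sum>\<^sub>\<infinity>i\<in>A. (cmod (?z i))\<^sup>2) = (\<Sum>\<^sub>\<infinity>i\<in>F. (cmod (y i))\<^sup>2)"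
      by (rule infsum_cong_neutral) (use F in auto)
    then have "?S\<^sup>2 \<le> K * ?S"
      using bound[OF l2_finite_support[OF F, of y]] F by (simp add: gz del: of_real_sum)
    moreover have "0 \<le> ?S" by (intro sum_nonneg) simp
    ultimately show ?thesis using K
      by (cases "?S = 0") (auto simp: power2_eq_square)
  qed
  have summable: "(\<lambda>i. (cmod (y i))\<^sup>2) summable_on A"
    by (rule nonneg_bdd_above_summable_on) (auto intro!: bdd_aboveI2[of _ _ K] partial)
  then show "y \<in> l2 A" by (simp add: l2_def y_def)
  show "(\<Sum>\<^sub>\<infinity>i\<in>A. (cmod (y i))\<^sup>2) \<le> K"
    by (rule infsum_le_finite_sums[OF summable partial])
  show "((\<lambda>i. cnj (y i) * x i) has_sum g x) A" if x: "x \<in> l2 A"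
  proof (rule has_sum_if_error_vanishes)
    have sx: "(\<lambda>i. (cmod (x i))\<^sup>2) summable_on A" using x by (simp add: l2_def)
    let ?tail = "\<lambda>F. (\<Sum>\<^sub>\<infinity>i\<in>A. (cmod (x i))\<^sup>2) - (\<Sum>i\<in>F. (cmod (x i))\<^sup>2)"
    show "((\<lambda>F. sqrt (K * ?tail F)) \<longlongrightarrow> 0) (finite_subsets_at_top A)"
      using tendsto_real_sqrt[OF tendsto_mult_left[OF tail_sum_vanishes[OF sx], of K]] by simp
    fix F assume F: "finite F" "F \<subseteq> A"
    let ?f = "\<lambda>i. if i \<in> F then x i else 0"
    let ?r = "\<lambda>i. x i - ?f i"
    have f: "?f \<in> l2 A" by (rule l2_finite_support[OF F])
    have r: "?r \<in> l2 A" by (rule diff_mem[OF x f])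
    have "(\<lambda>i. ?f i + ?r i) = x" by auto
    then have "g x = (\<Sum>i\<in>F. cnj (y i) * x i) + g ?r"
      using add[OF f r] fin[OF F, of x] F(2)
      by (auto simp: y_def mult.commute intro!: sum.cong)
    moreover have "(\<Sum>\<^sub>\<infinity>i\<in>A. (cmod (?r i))\<^sup>2) = ?tail F"
    proof -
      have "(\<Sum>\<^sub>\<infinity>i\<in>A. (cmod (?r i))\<^sup>2) = (\<Sum>\<^sub>\<infinity>i\<in>A - F. (cmod (x i))\<^sup>2)"
        by (rule infsum_cong_neutral) auto
      then show ?thesis using infsum_Diff[OF sx summable_on_finite F(2)] F by simp
    qed
    ultimately show "cmod (g x - (\<Sum>i\<in>F. cnj (y i) * x i)) \<le> sqrt (K * ?tail F)"
      using bound[OF r] by (intro real_le_rsqrt) simp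
  qed
qed


section \<open>Modules of fibrewise square-summable functions\<close>

definition fibre :: "'i set \<Rightarrow> ('i \<Rightarrow> 'w) \<Rightarrow> 'w \<Rightarrow> 'i set"
  where "fibre I s w = {i \<in> I. s i = w}"

text \<open>Besides the graph correspondence (\<open>I\<close> the edges, \<open>s\<close> the source map) this covers the bimodules
  \<open>X\<close> (\<open>s\<close> bijective) and the tensor products.\<close>

definition fibre_l2 :: "'i set \<Rightarrow> ('i \<Rightarrow> 'w) \<Rightarrow> 'w set \<Rightarrow> ('i \<Rightarrow> complex) set"
  where "fibre_l2 I s W = {x. (\<forall>i. i \<notin> I \<longrightarrow> x i = 0) \<and>
    (\<forall>w\<in>W. (\<lambda>i. (cmod (x i))\<^sup>2) summable_on fibre I s w) \<and>
    bdd_above ((\<lambda>w. \<Sum>\<^sub>\<infinity>i\<in>fibre I s w. (cmod (x i))\<^sup>2) ` W)}"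

definition fibre_inner :: "'i set \<Rightarrow> ('i \<Rightarrow> 'w) \<Rightarrow> ('i \<Rightarrow> complex) \<Rightarrow> ('i \<Rightarrow> complex) \<Rightarrow> 'w \<Rightarrow> complex"
  where "fibre_inner I s x y = (\<lambda>w. \<Sum>\<^sub>\<infinity>i\<in>fibre I s w. cnj (x i) * y i)"

lemma has_sum_fibres:
  fixes h :: "'i \<Rightarrow> 'c::banach"
  assumes h: "(h has_sum S) I" and s: "\<And>i. i \<in> I \<Longrightarrow> s i \<in> W"
  shows "((\<lambda>w. \<Sum>\<^sub>\<infinity>i\<in>fibre I s w. h i) has_sum S) W"
proof (rule has_sum_Sigma[where f = "\<lambda>(w, i). h i" and A = W and B = "fibre I s"])
  show "uniformly_continuous_on UNIV (\<lambda>(x::'c, y). x + y)"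
    by (rule isUCont_plus)
  have "bij_betw (\<lambda>i. (s i, i)) I (Sigma W (fibre I s))"
    by (rule bij_betwI[of _ _ _ snd]) (auto simp: fibre_def s)
  from has_sum_reindex_bij_betw[OF this, of "\<lambda>(w, i). h i" S] h
  show "((\<lambda>(w, i). h i) has_sum S) (Sigma W (fibre I s))" by simp
  show "((\<lambda>i. case (w, i) of (w, i) \<Rightarrow> h i) has_sum (\<Sum>\<^sub>\<infinity>i\<in>fibre I s w. h i)) (fibre I s w)" for w
    using summable_on_subset_banach[OF has_sum_imp_summable[OF h], of "fibre I s w"]
    by (auto simp: fibre_def)
qed

lemma fibre_weighted_summable:
  fixes k :: "'i \<Rightarrow> complex"
  assumes f: "(\<lambda>w. cmod (f w)) summable_on W" and s: "\<And>i. i \<in> I \<Longrightarrow> s i \<in> W"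
    and K: "\<And>w F. \<lbrakk>w \<in> W; finite F; F \<subseteq> fibre I s w\<rbrakk> \<Longrightarrow> (\<Sum>i\<in>F. cmod (k i)) \<le> K"
  shows "(\<lambda>i. cmod (f (s i) * k i)) summable_on I"
proof (rule nonneg_bdd_above_summable_on)
  show "bdd_above (sum (\<lambda>i. cmod (f (s i) * k i)) ` {F. F \<subseteq> I \<and> finite F})"
  proof (rule bdd_aboveI2)
    fix F assume "F \<in> {F. F \<subseteq> I \<and> finite F}"
    then have F: "F \<subseteq> I" "finite F" by auto
    have sF: "s ` F \<subseteq> W" using F s by auto
    have "(\<Sum>i\<in>F. cmod (f (s i) * k i)) = (\<Sum>w\<in>s ` F. \<Sum>i\<in>{i \<in> F. s i = w}. cmod (f (s i) * k i))"
      by (rule sum.image_gen[OF F(2)])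
    also have "\<dots> = (\<Sum>w\<in>s ` F. cmod (f w) * (\<Sum>i\<in>{i \<in> F. s i = w}. cmod (k i)))"
      by (auto simp: norm_mult sum_distrib_left intro!: sum.cong)
    also have "\<dots> \<le> (\<Sum>w\<in>s ` F. cmod (f w) * \<bar>K\<bar>)"
    proof (intro sum_mono mult_left_mono)
      fix w assume "w \<in> s ` F"
      then show "(\<Sum>i\<in>{i \<in> F. s i = w}. cmod (k i)) \<le> \<bar>K\<bar>"
        using F sF by (intro order_trans[OF K abs_ge_self]) (auto simp: fibre_def)
    qed simp
    also have "\<dots> \<le> (\<Sum>\<^sub>\<infinity>w\<in>W. cmod (f w)) * \<bar>K\<bar>"
      unfolding sum_distrib_right[symmetric]
      by (intro mult_right_mono finite_sum_le_infsum[OF f]) (use F sF in auto)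
    finally show "(\<Sum>i\<in>F. cmod (f (s i) * k i)) \<le> (\<Sum>\<^sub>\<infinity>w\<in>W. cmod (f w)) * \<bar>K\<bar>" .
  qed
qed simp

abbreviation fibre_bounded ::
    "'i set \<Rightarrow> ('i \<Rightarrow> 'w) \<Rightarrow> 'w set \<Rightarrow> ('i \<Rightarrow> real) \<Rightarrow> real \<Rightarrow> bool"
  where "fibre_bounded I s W k K \<equiv>
    \<forall>w\<in>W. \<forall>F. finite F \<and> F \<subseteq> fibre I s w \<longrightarrow> (\<Sum>i\<in>F. k i) \<le> K"

lemma fibre_l2_iff:
  "x \<in> fibre_l2 I s W \<longleftrightarrow> (\<forall>i. i \<notin> I \<longrightarrow> x i = 0) \<and>
    (\<exists>K. fibre_bounded I s W (\<lambda>i. (cmod (x i))\<^sup>2) K)"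
    (is "_ \<longleftrightarrow> ?off \<and> (\<exists>K. ?bd K)")
proof (intro iffI conjI)
  assume x: "x \<in> fibre_l2 I s W"
  show ?off using x by (simp add: fibre_l2_def)
  obtain K where K: "\<forall>w\<in>W. (\<Sum>\<^sub>\<infinity>i\<in>fibre I s w. (cmod (x i))\<^sup>2) \<le> K"
    using x by (auto simp: fibre_l2_def bdd_above_def)
  have "(\<Sum>i\<in>F. (cmod (x i))\<^sup>2) \<le> K" if "w \<in> W" "finite F" "F \<subseteq> fibre I s w" for w F
    using that x K by (intro order_trans[OF finite_sum_le_infsum]) (auto simp: fibre_l2_def)
  then show "\<exists>K. ?bd K" by blast
next
  assume "?off \<and> (\<exists>K. ?bd K)"
  then obtain K where off: ?off and K: "?bd K" by blast
  have summable: "(\<lambda>i. (cmod (x i))\<^sup>2) summable_on fibre I s w" if "w \<in> W" for w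
    by (rule nonneg_bdd_above_summable_on) (use K that in \<open>auto intro!: bdd_aboveI2[of _ _ K]\<close>)
  then have "(\<Sum>\<^sub>\<infinity>i\<in>fibre I s w. (cmod (x i))\<^sup>2) \<le> K" if "w \<in> W" for w
    using K that by (intro infsum_le_finite_sums) auto
  then show "x \<in> fibre_l2 I s W"
    using off summable unfolding fibre_l2_def by (auto intro!: bdd_aboveI2)
qed

lemma function_space_fibre_l2: "function_space (fibre_l2 I s W)"
proof
  show "(\<lambda>_. 0) \<in> fibre_l2 I s W" by (auto simp: fibre_l2_iff)
  show "(\<lambda>i. x i + y i) \<in> fibre_l2 I s W" if xy: "x \<in> fibre_l2 I s W" "y \<in> fibre_l2 I s W" for x y
  proof -
    obtain K L where KL:
      "fibre_bounded I s W (\<lambda>i. (cmod (x i))\<^sup>2) K"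
      "fibre_bounded I s W (\<lambda>i. (cmod (y i))\<^sup>2) L"
      using xy by (auto simp: fibre_l2_iff)
    have "(\<Sum>i\<in>F. (cmod (x i + y i))\<^sup>2) \<le> 2 * K + 2 * L"
      if "w \<in> W" "finite F" "F \<subseteq> fibre I s w" for w F
    proof -
      have "(\<Sum>i\<in>F. (cmod (x i + y i))\<^sup>2) \<le> (\<Sum>i\<in>F. 2 * (cmod (x i))\<^sup>2 + 2 * (cmod (y i))\<^sup>2)"
        by (intro sum_mono norm_add_square_le)
      also have "\<dots> = 2 * (\<Sum>i\<in>F. (cmod (x i))\<^sup>2) + 2 * (\<Sum>i\<in>F. (cmod (y i))\<^sup>2)"
        by (simp add: sum.distrib sum_distrib_left)
      also have "\<dots> \<le> 2 * K + 2 * L" using KL that by (intro add_mono mult_left_mono) auto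
      finally show ?thesis .
    qed
    then show ?thesis using xy by (auto simp: fibre_l2_iff)
  qed
  show "(\<lambda>i. t * x i) \<in> fibre_l2 I s W" if x: "x \<in> fibre_l2 I s W" for t x
  proof -
    obtain K where K: "fibre_bounded I s W (\<lambda>i. (cmod (x i))\<^sup>2) K"
      using x by (auto simp: fibre_l2_iff)
    have "(\<Sum>i\<in>F. (cmod (t * x i))\<^sup>2) \<le> (cmod t)\<^sup>2 * K"
      if "w \<in> W" "finite F" "F \<subseteq> fibre I s w" for w F
      using K that
      by (auto simp: norm_mult power_mult_distrib sum_distrib_left[symmetric] intro!: mult_left_mono)
    then show ?thesis using x by (auto simp: fibre_l2_iff)
  qed
qed

lemma fibre_l2_dominated:
  assumes x: "x \<in> fibre_l2 I s W" and c: "0 \<le> c" and le: "\<And>i. cmod (y i) \<le> c * cmod (x i)"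
  shows "y \<in> fibre_l2 I s W"
proof -
  obtain K where K: "fibre_bounded I s W (\<lambda>i. (cmod (x i))\<^sup>2) K"
    using x by (auto simp: fibre_l2_iff)
  have "(\<Sum>i\<in>F. (cmod (y i))\<^sup>2) \<le> c\<^sup>2 * K" if "w \<in> W" "finite F" "F \<subseteq> fibre I s w" for w F
  proof -
    have "(\<Sum>i\<in>F. (cmod (y i))\<^sup>2) \<le> (\<Sum>i\<in>F. c\<^sup>2 * (cmod (x i))\<^sup>2)"
      using le by (intro sum_mono) (metis norm_ge_zero power_mono power_mult_distrib)
    also have "\<dots> \<le> c\<^sup>2 * K"
      using K that by (auto simp: sum_distrib_left[symmetric] intro!: mult_left_mono)
    finally show ?thesis .
  qed
  moreover have "y i = 0" if "i \<notin> I" for i using le[of i] x that by (simp add: fibre_l2_def)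
  ultimately show ?thesis by (auto simp: fibre_l2_iff)
qed

lemma fibre_l2_restrict:
  "x \<in> fibre_l2 I s W \<Longrightarrow> (\<lambda>i. if P i then x i else 0) \<in> fibre_l2 I s W"
  by (rule fibre_l2_dominated[of x _ _ _ 1]) auto

lemma l2_partial_sum_le:
  assumes "x \<in> l2 A" "finite F"
  shows "(\<Sum>i\<in>F. (cmod (x i))\<^sup>2) \<le> (\<Sum>\<^sub>\<infinity>i\<in>A. (cmod (x i))\<^sup>2)"
proof -
  have "(\<Sum>i\<in>F. (cmod (x i))\<^sup>2) = (\<Sum>i\<in>F \<inter> A. (cmod (x i))\<^sup>2)"
    using assms by (intro sum.mono_neutral_right) (auto simp: l2_def)
  also have "\<dots> \<le> (\<Sum>\<^sub>\<infinity>i\<in>A. (cmod (x i))\<^sup>2)"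
    using assms by (intro finite_sum_le_infsum) (auto simp: l2_def)
  finally show ?thesis .
qed

lemma l2_subset_fibre_l2: "A \<subseteq> I \<Longrightarrow> l2 A \<subseteq> fibre_l2 I s W"
proof
  fix x assume A: "A \<subseteq> I" and x: "x \<in> l2 A"
  have "\<forall>i. i \<notin> I \<longrightarrow> x i = 0" using x A by (auto simp: l2_def)
  then show "x \<in> fibre_l2 I s W"
    unfolding fibre_l2_iff using l2_partial_sum_le[OF x] by blast
qed

lemma fibre_inner_summable:
  assumes "x \<in> fibre_l2 I s W" "y \<in> fibre_l2 I s W" "w \<in> W"
  shows "(\<lambda>i. cnj (x i) * y i) summable_on fibre I s w"
    and "(\<lambda>i. cmod (cnj (x i) * y i)) summable_on fibre I s w"
proof -
  show "(\<lambda>i. cmod (cnj (x i) * y i)) summable_on fibre I s w"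
    using assms by (intro square_summable_product) (auto simp: fibre_l2_def)
  then show "(\<lambda>i. cnj (x i) * y i) summable_on fibre I s w" by (rule abs_summable_summable)
qed

lemma fibre_inner_bound:
  assumes "x \<in> fibre_l2 I s W" "y \<in> fibre_l2 I s W"
  shows "\<exists>K. fibre_bounded I s W (\<lambda>i. cmod (cnj (x i) * y i)) K"
proof -
  obtain K L where KL:
    "fibre_bounded I s W (\<lambda>i. (cmod (x i))\<^sup>2) K"
    "fibre_bounded I s W (\<lambda>i. (cmod (y i))\<^sup>2) L"
    using assms by (auto simp: fibre_l2_iff)
  have "(\<Sum>i\<in>F. cmod (cnj (x i) * y i)) \<le> K + L" if "w \<in> W" "finite F" "F \<subseteq> fibre I s w" for w F
  proof -
    have "(\<Sum>i\<in>F. cmod (cnj (x i) * y i)) \<le> (\<Sum>i\<in>F. (cmod (x i))\<^sup>2 + (cmod (y i))\<^sup>2)"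
      by (intro sum_mono norm_mult_le_sum_squares)
    also have "\<dots> \<le> K + L" using KL that by (auto simp: sum.distrib intro!: add_mono)
    finally show ?thesis .
  qed
  then show ?thesis by blast
qed

lemma fibre_inner_self:
  "fibre_inner I s x x w = of_real (\<Sum>\<^sub>\<infinity>i\<in>fibre I s w. (cmod (x i))\<^sup>2)"
proof -
  let ?q = "\<lambda>i. (cmod (x i))\<^sup>2"
  have "cnj z * z = of_real ((cmod z)\<^sup>2)" for z
    by (simp add: complex_norm_square mult.commute del: of_real_power)
  then have eq: "fibre_inner I s x x w = (\<Sum>\<^sub>\<infinity>i\<in>fibre I s w. complex_of_real (?q i))"
    by (simp add: fibre_inner_def)
  show ?thesis
  proof (cases "?q summable_on fibre I s w")
    case True
    then show ?thesis unfolding eq by (intro infsumI has_sum_of_real) simp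
  next
    case False
    moreover have "?q summable_on fibre I s w"
      if "(\<lambda>i. complex_of_real (?q i)) summable_on fibre I s w"
      using summable_on_Re[OF that] by simp
    ultimately show ?thesis unfolding eq using infsum_not_exists by (metis of_real_0)
  qed
qed

lemma fibre_inner_linf:
  assumes x: "x \<in> fibre_l2 I s W" and y: "y \<in> fibre_l2 I s W" and s: "\<And>i. i \<in> I \<Longrightarrow> s i \<in> W"
  shows "fibre_inner I s x y \<in> linf_carrier W"
proof -
  obtain K where K: "fibre_bounded I s W (\<lambda>i. cmod (cnj (x i) * y i)) K"
    using fibre_inner_bound[OF x y] by blast
  show ?thesis
  proof (rule linf_memI[of _ _ K])
    fix w assume "w \<notin> W"
    then have "fibre I s w = {}" using s by (auto simp: fibre_def)
    then show "fibre_inner I s x y w = 0" by (simp add: fibre_inner_def)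
  next
    fix w assume w: "w \<in> W"
    have "cmod (fibre_inner I s x y w) \<le> (\<Sum>\<^sub>\<infinity>i\<in>fibre I s w. cmod (cnj (x i) * y i))"
      unfolding fibre_inner_def by (rule norm_infsum_bound[OF fibre_inner_summable(2)[OF x y w]])
    also have "\<dots> \<le> K"
      by (rule infsum_le_finite_sums[OF fibre_inner_summable(2)[OF x y w]]) (use K w in auto)
    finally show "cmod (fibre_inner I s x y w) \<le> K" .
  qed
qed

lemma fibre_l2_delta: "i \<in> I \<Longrightarrow> delta i \<in> fibre_l2 I s W"
proof -
  assume "i \<in> I"
  have "(\<Sum>j\<in>F. (cmod (delta i j))\<^sup>2) \<le> 1" if "finite F" for F
  proof -
    have "(\<Sum>j\<in>F. (cmod (delta i j))\<^sup>2) = (\<Sum>j\<in>F \<inter> {i}. 1)"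
      using that by (intro sum.mono_neutral_cong_right) (auto simp: delta_def)
    moreover have "card (F \<inter> {i}) \<le> card {i}" by (rule card_mono) auto
    ultimately show ?thesis by simp
  qed
  then show ?thesis using \<open>i \<in> I\<close> by (auto simp: fibre_l2_iff delta_def)
qed

locale fibred_module =
  fixes I :: "'i set" and s :: "'i \<Rightarrow> 'w" and W :: "'w set"
    and X :: "('w \<Rightarrow> complex, 'i \<Rightarrow> complex, 'n) hilbert_module_scheme"
  assumes base: "\<And>i. i \<in> I \<Longrightarrow> s i \<in> W"
    and carrier_fun: "carrier X = fibre_l2 I s W"
    and zero_X: "zero X = (\<lambda>_. 0)"
    and add_X: "add X = (\<lambda>x y i. x i + y i)"
    and smult_X: "smult X = (\<lambda>t x i. t * x i)"
    and ract_X: "ract X = (\<lambda>x b i. x i * b (s i))"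
    and rinner_X: "rinner X = fibre_inner I s"
begin

sublocale function_module X
proof -
  interpret function_space "fibre_l2 I s W" by (rule function_space_fibre_l2)
  show "function_module X"
    by unfold_locales (auto simp: carrier_fun zero_X add_X smult_X zero_mem add_mem smult_mem)
qed

lemma rinner_mem: "\<lbrakk>x \<in> carrier X; y \<in> carrier X\<rbrakk> \<Longrightarrow> rinner X x y \<in> linf_carrier W"
  unfolding rinner_X carrier_fun by (rule fibre_inner_linf) (auto simp: base)

lemma off_base: "w \<notin> W \<Longrightarrow> fibre I s w = {}"
  using base by (auto simp: fibre_def)

lemma off_carrier: "\<lbrakk>x \<in> carrier X; i \<notin> I\<rbrakk> \<Longrightarrow> x i = 0"
  by (simp add: carrier_fun fibre_l2_def)

lemma hnorm_le_iff:
  assumes x: "x \<in> carrier X" and r: "0 \<le> r"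
  shows "hnorm (linf W) X x \<le> r \<longleftrightarrow>
    (fibre_bounded I s W (\<lambda>i. (cmod (x i))\<^sup>2) (r\<^sup>2))"
proof -
  have summable: "(\<lambda>i. (cmod (x i))\<^sup>2) summable_on fibre I s w" if "w \<in> W" for w
    using x that by (simp add: carrier_fun fibre_l2_def)
  have "hnorm (linf W) X x \<le> r \<longleftrightarrow> linf_norm W (rinner X x x) \<le> r\<^sup>2"
    using r by (auto simp: hnorm_def real_sqrt_le_iff' intro: real_le_lsqrt sqrt_le_D)
  also have "\<dots> \<longleftrightarrow> (\<forall>w\<in>W. cmod (rinner X x x w) \<le> r\<^sup>2)"
    by (rule linf_norm_le_iff[OF rinner_mem[OF x x]]) simp
  also have "\<dots> \<longleftrightarrow> (\<forall>w\<in>W. (\<Sum>\<^sub>\<infinity>i\<in>fibre I s w. (cmod (x i))\<^sup>2) \<le> r\<^sup>2)"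
    by (simp add: rinner_X fibre_inner_self infsum_nonneg)
  also have "\<dots> \<longleftrightarrow> (fibre_bounded I s W (\<lambda>i. (cmod (x i))\<^sup>2) (r\<^sup>2))"
  proof (intro ball_cong refl iffI allI impI)
    fix w F assume w: "w \<in> W" "(\<Sum>\<^sub>\<infinity>i\<in>fibre I s w. (cmod (x i))\<^sup>2) \<le> r\<^sup>2" "finite F \<and> F \<subseteq> fibre I s w"
    then show "(\<Sum>i\<in>F. (cmod (x i))\<^sup>2) \<le> r\<^sup>2"
      by (intro order_trans[OF finite_sum_le_infsum[OF summable[OF w(1)]]]) auto
  qed (auto intro!: infsum_le_finite_sums simp: summable)
  finally show ?thesis .
qed

lemma hnorm_nonneg: "x \<in> carrier X \<Longrightarrow> 0 \<le> hnorm (linf W) X x"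
  by (simp add: hnorm_def linf_norm_nonneg rinner_mem)

lemma module_norm_complete: "norm_complete X (hnorm (linf W) X)"
proof (rule norm_complete_sup_L2[where \<F> = "{F. finite F \<and> (\<exists>w\<in>W. F \<subseteq> fibre I s w)}"])
  let ?\<F> = "{F. finite F \<and> (\<exists>w\<in>W. F \<subseteq> fibre I s w)}"
  have U: "\<Union>?\<F> = I"
  proof
    show "I \<subseteq> \<Union>?\<F>"
    proof
      fix i assume "i \<in> I"
      then have "{i} \<in> ?\<F>" using base by (auto simp: fibre_def)
      then show "i \<in> \<Union>?\<F>" by blast
    qed
  qed (auto simp: fibre_def)
  have L2: "L2_set (\<lambda>i. cmod (x i)) F \<le> r \<longleftrightarrow> (\<Sum>i\<in>F. (cmod (x i))\<^sup>2) \<le> r\<^sup>2" if "0 \<le> r" for x F r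
    using that by (auto simp: L2_set_def intro: real_le_lsqrt sqrt_le_D sum_nonneg)
  show "hnorm (linf W) X x \<le> r \<longleftrightarrow> (\<forall>F\<in>?\<F>. L2_set (\<lambda>i. cmod (x i)) F \<le> r)"
    if "x \<in> carrier X" "0 \<le> r" for x r
    using hnorm_le_iff[OF that] that(2) by (auto simp: L2)
  show "carrier X = {x. (\<forall>i. i \<notin> \<Union>?\<F> \<longrightarrow> x i = 0) \<and> (\<exists>K. \<forall>F\<in>?\<F>. L2_set (\<lambda>i. cmod (x i)) F \<le> K)}"
    unfolding U
  proof (rule Set.set_eqI)
    fix x
    have "(\<exists>K. \<forall>F\<in>?\<F>. L2_set (\<lambda>i. cmod (x i)) F \<le> K) \<longleftrightarrow>
      (\<exists>K. fibre_bounded I s W (\<lambda>i. (cmod (x i))\<^sup>2) K)" (is "?L \<longleftrightarrow> ?R")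
    proof
      assume ?L
      then obtain K where K: "\<forall>F\<in>?\<F>. L2_set (\<lambda>i. cmod (x i)) F \<le> K" by blast
      then have "\<forall>F\<in>?\<F>. L2_set (\<lambda>i. cmod (x i)) F \<le> \<bar>K\<bar>" by (meson abs_ge_self order_trans)
      then show ?R unfolding L2[OF abs_ge_zero] by blast
    next
      assume ?R
      then obtain K where K:
        "fibre_bounded I s W (\<lambda>i. (cmod (x i))\<^sup>2) K" by blast
      have "L2_set (\<lambda>i. cmod (x i)) F \<le> sqrt K" if "F \<in> ?\<F>" for F
        using K that unfolding L2_set_def by (intro real_sqrt_le_mono) blast
      then show ?L by blast
    qed
    then show "x \<in> carrier X \<longleftrightarrow> x \<in> {x. (\<forall>i. i \<notin> I \<longrightarrow> x i = 0) \<and> (\<exists>K. \<forall>F\<in>?\<F>. L2_set (\<lambda>i. cmod (x i)) F \<le> K)}"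
      by (simp add: carrier_fun fibre_l2_iff)
  qed
qed (auto simp: hnorm_nonneg)

lemma ract_mem: "\<lbrakk>x \<in> carrier X; b \<in> linf_carrier W\<rbrakk> \<Longrightarrow> (\<lambda>i. x i * b (s i)) \<in> carrier X"
  unfolding carrier_fun
  by (rule fibre_l2_dominated[of x _ _ _ "linf_norm W b"])
    (auto simp: linf_norm_nonneg norm_mult mult.commute[of "cmod (x _)"] intro!: mult_right_mono cmod_le_linf_norm)

lemma rinner_summable:
  "\<lbrakk>x \<in> carrier X; y \<in> carrier X\<rbrakk> \<Longrightarrow> (\<lambda>i. cnj (x i) * y i) summable_on fibre I s w"
  by (cases "w \<in> W") (auto simp: carrier_fun fibre_inner_summable off_base)

lemma right_cstar_module: "right_cstar_module (linf W) X"
proof -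
  have inner_ract: "fibre_inner I s x (\<lambda>i. y i * b (s i)) = (\<lambda>w. fibre_inner I s x y w * b w)" for x y b
  proof
    fix w
    have "fibre_inner I s x (\<lambda>i. y i * b (s i)) w = (\<Sum>\<^sub>\<infinity>i\<in>fibre I s w. cnj (x i) * y i * b w)"
      unfolding fibre_inner_def by (rule infsum_cong) (auto simp: fibre_def)
    then show "fibre_inner I s x (\<lambda>i. y i * b (s i)) w = fibre_inner I s x y w * b w"
      by (simp add: fibre_inner_def infsum_cmult_left')
  qed
  have definite: "x = (\<lambda>_. 0)" if x: "x \<in> carrier X" and 0: "fibre_inner I s x x = (\<lambda>_. 0)" for x
  proof
    fix i
    show "x i = 0"
    proof (cases "i \<in> I")
      case True
      then have i: "i \<in> fibre I s (s i)" by (simp add: fibre_def)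
      have "(\<Sum>\<^sub>\<infinity>j\<in>fibre I s (s i). (cmod (x j))\<^sup>2) = 0"
        using 0[THEN fun_cong, of "s i"] by (simp add: fibre_inner_self)
      then have "(cmod (x i))\<^sup>2 = 0"
        using x base[OF True] by (intro nonneg_infsum_le_0D[OF _ _ _ i]) (auto simp: carrier_fun fibre_l2_def)
      then show ?thesis by simp
    qed (simp add: off_carrier[OF x])
  qed
  have star: "(\<lambda>w. cnj (fibre_inner I s x y w)) = fibre_inner I s y x" for x y
    by (auto simp: fibre_inner_def fun_eq_iff mult.commute simp flip: infsum_cnj)
  have positive: "fibre_inner I s x x \<in> positive_elements (linf W)" if "x \<in> carrier X" for x
    using rinner_mem[OF that that]
    by (auto simp: positive_elements_linf rinner_X fibre_inner_self intro!: infsum_nonneg)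
  have smult: "fibre_inner I s x (\<lambda>i. t * y i) = (\<lambda>w. t * fibre_inner I s x y w)" for t x y
    by (simp add: fibre_inner_def fun_eq_iff mult.left_commute[of _ t] infsum_cmult_right')
  have add: "fibre_inner I s x (\<lambda>i. y i + z i) = (\<lambda>w. fibre_inner I s x y w + fibre_inner I s x z w)"
    if "x \<in> carrier X" "y \<in> carrier X" "z \<in> carrier X" for x y z
    using rinner_summable that
    by (auto simp: fibre_inner_def fun_eq_iff distrib_left infsum_add)
  have one: "(\<lambda>i. x i * (if s i \<in> W then 1 else 0)) = x" if "x \<in> carrier X" for x
    using off_carrier[OF that] base by (auto simp: fun_eq_iff)
  show ?thesis
    by (intro right_cstar_module.intro cstar_algebra_linf is_module right_cstar_module_axioms.intro)
      (use rinner_mem in \<open>simp_all add: module_norm_complete ract_X add_X smult_X zero_X rinner_X ract_mem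
        distrib_left distrib_right mult.assoc mult.left_commute inner_ract star positive definite smult add one\<close>)
qed


text \<open>A bounded module map is determined on each fibre by a bounded functional on a Hilbert space.
  Boundedness of the map bounds the norms of the representing vectors uniformly, so that they fit
  together to an element of the module.\<close>

lemma selfdual_X:
  assumes f: "bounded_module_map (linf W) X f"
  shows "\<exists>y\<in>carrier X. \<forall>x\<in>carrier X. f x = rinner X y x"
proof -
  have f_mem: "f x \<in> linf_carrier W" if "x \<in> carrier X" for x
    using f that by (auto simp: bounded_module_map_def)
  have f_add: "f (\<lambda>i. x i + y i) = (\<lambda>w. f x w + f y w)" if "x \<in> carrier X" "y \<in> carrier X" for x y
    using f that by (simp add: bounded_module_map_def add_X)
  have f_smult: "f (\<lambda>i. t * x i) = (\<lambda>w. t * f x w)" if "x \<in> carrier X" for t x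
    using f that by (simp add: bounded_module_map_def smult_X)
  have f_ract: "f (\<lambda>i. x i * b (s i)) = (\<lambda>w. f x w * b w)"
    if "x \<in> carrier X" "b \<in> linf_carrier W" for x b
    using f that by (simp add: bounded_module_map_def ract_X)
  obtain K where K: "\<forall>x\<in>carrier X. linf_norm W (f x) \<le> K * hnorm (linf W) X x"
    using f by (auto simp: bounded_module_map_def)
  have l2_mem: "x \<in> carrier X" and l2_norm: "hnorm (linf W) X x \<le> sqrt (\<Sum>\<^sub>\<infinity>i\<in>fibre I s w. (cmod (x i))\<^sup>2)"
    if x: "x \<in> l2 (fibre I s w)" for x w
  proof -
    show mem: "x \<in> carrier X"
      using x l2_subset_fibre_l2[of "fibre I s w" I s W] by (auto simp: carrier_fun fibre_def)
    show "hnorm (linf W) X x \<le> sqrt (\<Sum>\<^sub>\<infinity>i\<in>fibre I s w. (cmod (x i))\<^sup>2)"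
      using l2_partial_sum_le[OF x] by (subst hnorm_le_iff[OF mem]) (auto simp: infsum_nonneg)
  qed
  have bound: "(cmod (f x w))\<^sup>2 \<le> K\<^sup>2 * (\<Sum>\<^sub>\<infinity>i\<in>fibre I s w. (cmod (x i))\<^sup>2)"
    if x: "x \<in> l2 (fibre I s w)" for x w
  proof -
    have "cmod (f x w) \<le> K * hnorm (linf W) X x"
      using K l2_mem[OF x] order_trans[OF cmod_le_linf_norm[OF f_mem[OF l2_mem[OF x]]]] by blast
    also have "\<dots> \<le> \<bar>K\<bar> * sqrt (\<Sum>\<^sub>\<infinity>i\<in>fibre I s w. (cmod (x i))\<^sup>2)"
      by (intro mult_mono l2_norm[OF x] hnorm_nonneg l2_mem[OF x]) auto
    finally have "(cmod (f x w))\<^sup>2 \<le> (\<bar>K\<bar> * sqrt (\<Sum>\<^sub>\<infinity>i\<in>fibre I s w. (cmod (x i))\<^sup>2))\<^sup>2"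
      by (intro power_mono) auto
    then show ?thesis by (simp add: power_mult_distrib infsum_nonneg)
  qed
  define Y where "Y w = (\<lambda>i. if i \<in> fibre I s w then cnj (f (delta i) w) else 0)" for w
  have add': "f (\<lambda>i. x i + y i) w = f x w + f y w"
    if "x \<in> l2 (fibre I s w)" "y \<in> l2 (fibre I s w)" for x y w
    using f_add[OF l2_mem[OF that(1)] l2_mem[OF that(2)]] by simp
  have smult': "f (\<lambda>i. t * x i) w = t * f x w" if "x \<in> l2 (fibre I s w)" for t x w
    using f_smult[OF l2_mem[OF that]] by simp
  have riesz: "Y w \<in> l2 (fibre I s w)" "(\<Sum>\<^sub>\<infinity>i\<in>fibre I s w. (cmod (Y w i))\<^sup>2) \<le> K\<^sup>2"
    "x \<in> l2 (fibre I s w) \<Longrightarrow> ((\<lambda>i. cnj (Y w i) * x i) has_sum f x w) (fibre I s w)" for w x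
    unfolding Y_def
    by (rule riesz_vector_l2[where g = "\<lambda>x. f x w" and K = "K\<^sup>2"]
        riesz_vector_norm[where g = "\<lambda>x. f x w" and K = "K\<^sup>2"]
        riesz_represents[where g = "\<lambda>x. f x w" and K = "K\<^sup>2"];
      use add' smult' bound in simp)+
  define y where "y i = (if i \<in> I then Y (s i) i else 0)" for i
  have yY: "y i = Y w i" if "i \<in> fibre I s w" for i w
    using that by (simp add: y_def fibre_def)
  have y_mem: "y \<in> carrier X"
  proof -
    have "(\<Sum>i\<in>F. (cmod (y i))\<^sup>2) \<le> K\<^sup>2" if F: "w \<in> W" "finite F" "F \<subseteq> fibre I s w" for w F
    proof -
      have "(\<Sum>i\<in>F. (cmod (y i))\<^sup>2) = (\<Sum>i\<in>F. (cmod (Y w i))\<^sup>2)"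
        using F yY by (intro sum.cong) auto
      also have "\<dots> \<le> (\<Sum>\<^sub>\<infinity>i\<in>fibre I s w. (cmod (Y w i))\<^sup>2)"
        using F riesz(1)[of w] by (intro finite_sum_le_infsum) (auto simp: l2_def)
      also have "\<dots> \<le> K\<^sup>2" by (rule riesz(2))
      finally show ?thesis .
    qed
    then show ?thesis unfolding carrier_fun fibre_l2_iff by (auto simp: y_def)
  qed
  have "f x w = rinner X y x w" if x: "x \<in> carrier X" for x w
  proof (cases "w \<in> W")
    case False
    then show ?thesis using f_mem[OF x] by (simp add: linf_off rinner_X fibre_inner_def off_base)
  next
    case True
    let ?x = "\<lambda>i. x i * delta w (s i)"
    have x_l2: "?x \<in> l2 (fibre I s w)"
    proof -
      have "(\<lambda>i. (cmod (x i))\<^sup>2) summable_on fibre I s w"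
        using x True by (simp add: carrier_fun fibre_l2_def)
      then have "(\<lambda>i. (cmod (?x i))\<^sup>2) summable_on fibre I s w"
        by (rule summable_on_cong[THEN iffD1, rotated]) (auto simp: fibre_def delta_def)
      then show ?thesis using off_carrier[OF x] by (auto simp: l2_def fibre_def delta_def)
    qed
    have "f x w = f ?x w" using f_ract[OF x linf_delta[OF True]] by (simp add: delta_def)
    also have "\<dots> = (\<Sum>\<^sub>\<infinity>i\<in>fibre I s w. cnj (Y w i) * ?x i)"
      using infsumI[OF riesz(3)[OF x_l2]] by simp
    also have "\<dots> = rinner X y x w"
      unfolding rinner_X fibre_inner_def
      by (rule infsum_cong) (auto simp: yY fibre_def delta_def)
    finally show ?thesis .
  qed
  then show ?thesis using y_mem by (intro bexI[of _ y]) auto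
qed

lemma right_wstar_module: "right_wstar_module (linf W) X"
  by (intro right_wstar_module.intro right_cstar_module wstar_algebra_linf
      right_wstar_module_axioms.intro selfdual_X)

text \<open>Under the pairing with a family \<open>f\<close> in the predual, the sum over the base and the sums over the
  fibres merge into one absolutely convergent sum over \<open>I\<close>.\<close>

lemma functional_rinner:
  assumes f: "(\<lambda>w. cmod (f w)) summable_on W" and x: "x \<in> carrier X" and y: "y \<in> carrier X"
  shows "(\<lambda>i. cmod (f (s i) * (cnj (x i) * y i))) summable_on I"
    and "((\<lambda>i. f (s i) * (cnj (x i) * y i)) has_sum linf_functional W f (rinner X x y)) I"
proof -
  obtain K where K: "fibre_bounded I s W (\<lambda>i. cmod (cnj (x i) * y i)) K"
    using fibre_inner_bound x y unfolding carrier_fun by blast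
  show abs: "(\<lambda>i. cmod (f (s i) * (cnj (x i) * y i))) summable_on I"
    by (rule fibre_weighted_summable[where K = K, OF f base]) (use K in auto)
  let ?S = "\<Sum>\<^sub>\<infinity>i\<in>I. f (s i) * (cnj (x i) * y i)"
  have h: "((\<lambda>i. f (s i) * (cnj (x i) * y i)) has_sum ?S) I"
    by (rule has_sum_infsum[OF abs_summable_summable[OF abs]])
  have "(\<Sum>\<^sub>\<infinity>i\<in>fibre I s w. f (s i) * (cnj (x i) * y i)) = f w * rinner X x y w" for w
  proof -
    have "(\<Sum>\<^sub>\<infinity>i\<in>fibre I s w. f (s i) * (cnj (x i) * y i))
        = (\<Sum>\<^sub>\<infinity>i\<in>fibre I s w. f w * (cnj (x i) * y i))"
      by (rule infsum_cong) (auto simp: fibre_def)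
    then show ?thesis by (simp add: rinner_X fibre_inner_def infsum_cmult_right')
  qed
  with has_sum_fibres[where s = s, OF h base] have "((\<lambda>w. f w * rinner X x y w) has_sum ?S) W" by simp
  then have "linf_functional W f (rinner X x y) = ?S"
    using rinner_mem[OF x y] by (simp add: linf_functional_def infsumI)
  with h show "((\<lambda>i. f (s i) * (cnj (x i) * y i)) has_sum linf_functional W f (rinner X x y)) I"
    by simp
qed

lemma restrict_mem: "x \<in> carrier X \<Longrightarrow> (\<lambda>i. if P i then x i else 0) \<in> carrier X"
  unfolding carrier_fun by (rule fibre_l2_restrict)

lemma hnorm_restrict_le:
  assumes x: "x \<in> carrier X"
  shows "hnorm (linf W) X (\<lambda>i. if P i then x i else 0) \<le> hnorm (linf W) X x"
proof -
  have *: "fibre_bounded I s W (\<lambda>i. (cmod (x i))\<^sup>2) ((hnorm (linf W) X x)\<^sup>2)"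
    using hnorm_le_iff[OF x hnorm_nonneg[OF x]] by simp
  have "(\<Sum>i\<in>F. (cmod (if P i then x i else 0))\<^sup>2) \<le> (\<Sum>i\<in>F. (cmod (x i))\<^sup>2)" for F
    by (rule sum_mono) simp
  then show ?thesis
    using * by (subst hnorm_le_iff[OF restrict_mem[OF x] hnorm_nonneg[OF x]]) (auto intro: order_trans)
qed

text \<open>The functionals built from \<open>\<omega>\<close> and \<open>y\<close> are absolutely convergent sums over \<open>I\<close>, so they converge
  along finite truncations.  Since truncation does not increase the norm, this carries over to their
  norm limits, that is, to the whole predual of the module.\<close>

lemma wstar_closure_of_truncations:
  assumes x: "x \<in> carrier X" and A: "\<And>F. finite F \<Longrightarrow> (\<lambda>i. if i \<in> F then x i else 0) \<in> A"
  shows "x \<in> module_wstar_topology (linf W) X closure_of A"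
  unfolding module_wstar_topology_def
proof (rule weak_closure_limit)
  let ?t = "\<lambda>F i. if i \<in> F then x i else 0"
  let ?c = "\<lambda>F. if finite F then F else {}"
  have "(\<lambda>_. 0) \<in> module_predual (linf W) X"
    unfolding module_predual_def dual_space_def
    by (auto intro!: exI[of _ "[]"] exI[of _ 0] mult_nonneg_nonneg hnorm_nonneg)
  then show "module_predual (linf W) X \<noteq> {}" by blast
  show "finite_subsets_at_top I \<noteq> bot" by simp
  show "?t (?c F) \<in> A" for F using A[of "?c F"] by auto
  show "?t (?c F) \<in> carrier X" for F by (rule restrict_mem[OF x])
  show "x \<in> carrier X" by (rule x)
  fix \<phi> assume \<phi>: "\<phi> \<in> module_predual (linf W) X"
  define N where "N = hnorm (linf W) X x"
  have N: "0 \<le> N" by (simp add: N_def hnorm_nonneg[OF x])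
  show "((\<lambda>F. \<phi> (?t (?c F))) \<longlongrightarrow> \<phi> x) (finite_subsets_at_top I)"
  proof (rule tendstoI)
    fix e :: real assume "e > 0"
    define \<epsilon> where "\<epsilon> = e / (3 * (N + 1))"
    have \<epsilon>: "\<epsilon> > 0" "\<epsilon> * N \<le> e / 3"
      using \<open>e > 0\<close> N by (simp_all add: \<epsilon>_def field_simps mult_nonneg_nonneg)
    obtain ps where ps: "set ps \<subseteq> predual (linf W) \<times> carrier X"
      and close: "\<And>z. z \<in> carrier X \<Longrightarrow>
        cmod (\<phi> z - (\<Sum>(\<omega>, y) \<leftarrow> ps. \<omega> (rinner X y z))) \<le> \<epsilon> * hnorm (linf W) X z"
      using \<phi> \<epsilon>(1) unfolding module_predual_def by blast
    define \<psi> where "\<psi> z = (\<Sum>(\<omega>, y) \<leftarrow> ps. \<omega> (rinner X y z))" for z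
    have "((\<lambda>F. \<psi> (?t F)) \<longlongrightarrow> \<psi> x) (finite_subsets_at_top I)"
      unfolding \<psi>_def using ps
    proof (induction ps)
      case (Cons p ps)
      obtain \<omega> y where p: "p = (\<omega>, y)" by force
      with Cons.prems have "\<omega> \<in> predual (linf W)" and y: "y \<in> carrier X" by auto
      then obtain f where f: "(\<lambda>w. cmod (f w)) summable_on W" "\<omega> = linf_functional W f"
        by (auto simp: predual_linf)
      have "\<omega> (rinner X y (?t F)) = (\<Sum>i\<in>F. f (s i) * (cnj (y i) * x i))"
        if F: "finite F" "F \<subseteq> I" for F
      proof -
        have "((\<lambda>i. f (s i) * (cnj (y i) * ?t F i)) has_sum (\<Sum>i\<in>F. f (s i) * (cnj (y i) * x i))) I"
          by (rule has_sum_finite_neutralI[where B = F]) (use F in \<open>auto intro!: sum.cong\<close>)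
        with functional_rinner(2)[OF f(1) y restrict_mem[OF x, of "\<lambda>i. i \<in> F"]] show ?thesis
          unfolding f(2) by (rule has_sum_unique)
      qed
      then have "\<forall>\<^sub>F F in finite_subsets_at_top I.
          (\<Sum>i\<in>F. f (s i) * (cnj (y i) * x i)) = \<omega> (rinner X y (?t F))"
        by (intro eventually_finite_subsets_at_top_weakI) simp
      moreover have "((\<lambda>F. \<Sum>i\<in>F. f (s i) * (cnj (y i) * x i)) \<longlongrightarrow> \<omega> (rinner X y x)) (finite_subsets_at_top I)"
        using functional_rinner(2)[OF f(1) y x] unfolding f(2) has_sum_def .
      ultimately have "((\<lambda>F. \<omega> (rinner X y (?t F))) \<longlongrightarrow> \<omega> (rinner X y x)) (finite_subsets_at_top I)"
        by (rule Lim_transform_eventually[rotated])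
      from tendsto_add[OF this Cons.IH] Cons.prems show ?case by (simp add: p)
    qed simp
    then have "\<forall>\<^sub>F F in finite_subsets_at_top I. dist (\<psi> (?t F)) (\<psi> x) < e / 3"
      using \<open>e > 0\<close> by (intro tendstoD) auto
    moreover have "\<forall>\<^sub>F F in finite_subsets_at_top I. finite F"
      by (rule eventually_finite_subsets_at_top_weakI)
    ultimately show "\<forall>\<^sub>F F in finite_subsets_at_top I. dist (\<phi> (?t (?c F))) (\<phi> x) < e"
    proof eventually_elim
      case (elim F)
      have "cmod (\<phi> (?t F) - \<psi> (?t F)) \<le> \<epsilon> * hnorm (linf W) X (?t F)"
        using close[OF restrict_mem[OF x]] by (simp add: \<psi>_def)
      also have "\<dots> \<le> \<epsilon> * N"
        unfolding N_def using \<epsilon>(1) hnorm_restrict_le[OF x] by (intro mult_left_mono) auto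
      finally have 1: "cmod (\<phi> (?t F) - \<psi> (?t F)) \<le> e / 3" using \<epsilon>(2) by simp
      have 2: "cmod (\<phi> x - \<psi> x) \<le> e / 3"
        using close[OF x] \<epsilon>(2) by (simp add: \<psi>_def N_def)
      have "\<phi> (?t F) - \<phi> x = (\<phi> (?t F) - \<psi> (?t F)) - (\<phi> x - \<psi> x) + (\<psi> (?t F) - \<psi> x)" by simp
      then have "cmod (\<phi> (?t F) - \<phi> x)
          \<le> cmod (\<phi> (?t F) - \<psi> (?t F)) + cmod (\<phi> x - \<psi> x) + cmod (\<psi> (?t F) - \<psi> x)"
        using norm_triangle_ineq[of "\<phi> (?t F) - \<psi> (?t F) - (\<phi> x - \<psi> x)" "\<psi> (?t F) - \<psi> x"]
          norm_triangle_ineq4[of "\<phi> (?t F) - \<psi> (?t F)" "\<phi> x - \<psi> x"] by simp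
      then show ?case using 1 2 elim by (simp add: dist_norm)
    qed
  qed
qed

end

locale fibred_correspondence = fibred_module I s W X
  for I :: "'i set" and s :: "'i \<Rightarrow> 'w" and W :: "'w set"
    and X :: "('w \<Rightarrow> complex, 'i \<Rightarrow> complex, 'v \<Rightarrow> complex, 'n) correspondence_scheme" +
  fixes r :: "'i \<Rightarrow> 'v" and V :: "'v set"
  assumes left_base: "\<And>i. i \<in> I \<Longrightarrow> r i \<in> V"
    and lact_X: "lact X = (\<lambda>a x i. a (r i) * x i)"
begin

lemma lact_mem: "\<lbrakk>a \<in> linf_carrier V; x \<in> carrier X\<rbrakk> \<Longrightarrow> (\<lambda>i. a (r i) * x i) \<in> carrier X"
  unfolding carrier_fun
  by (rule fibre_l2_dominated[of x _ _ _ "linf_norm V a"])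
    (auto simp: linf_norm_nonneg norm_mult intro!: mult_right_mono cmod_le_linf_norm)

lemma lact_adjoint: "rinner X (lact X a x) y = rinner X x (lact X (star (linf V) a) y)"
  by (simp add: rinner_X lact_X fibre_inner_def mult.left_commute mult.assoc)

lemma adjointable_lact: "a \<in> linf_carrier V \<Longrightarrow> adjointable X (lact X a)"
  unfolding adjointable_def using lact_adjoint[of a] lact_mem linf_cnj[of a V]
  by (auto simp: lact_X intro!: bexI[of _ "lact X (star (linf V) a)"])

lemma wstar_correspondence: "wstar_correspondence (linf V) (linf W) X"
proof (intro wstar_correspondence.intro wstar_algebra_linf right_wstar_module
    wstar_correspondence_axioms.intro)
  show "adjointable X (lact X a)" if "a \<in> carrier (linf V)" for a
    using that adjointable_lact by simp
  show "lact X \<one>\<^bsub>linf V\<^esub> x = x" if "x \<in> carrier X" for x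
    using off_carrier[OF that] left_base by (auto simp: lact_X fun_eq_iff)
  show "rinner X (lact X a x) y = rinner X x (lact X (star (linf V) a) y)" for a x y
    by (rule lact_adjoint)
  fix \<omega> x y assume \<omega>: "\<omega> \<in> predual (linf W)" and x: "x \<in> carrier X" and y: "y \<in> carrier X"
  obtain f where f: "(\<lambda>w. cmod (f w)) summable_on W" "\<omega> = linf_functional W f"
    using \<omega> by (auto simp: predual_linf)
  let ?h = "\<lambda>i. f (s i) * (cnj (x i) * y i)"
  note abs = functional_rinner(1)[OF f(1) x y]
  define g where "g v = (\<Sum>\<^sub>\<infinity>i\<in>fibre I r v. ?h i)" for v
  \<comment> \<open>Pulled back to \<open>\<ell>\<^sup>\<infinity>(V)\<close>, the functional is the summable family of its sums over the fibres
      of \<open>r\<close>.\<close>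
  have g: "(\<lambda>v. cmod (g v)) summable_on V"
  proof (rule Infinite_Sum.abs_summable_on_comparison_test')
    show "(\<lambda>v. \<Sum>\<^sub>\<infinity>i\<in>fibre I r v. cmod (?h i)) summable_on V"
      by (rule has_sum_imp_summable[OF has_sum_fibres[where s = r, OF has_sum_infsum[OF abs] left_base]])
    show "cmod (g v) \<le> (\<Sum>\<^sub>\<infinity>i\<in>fibre I r v. cmod (?h i))" for v
      unfolding g_def
      by (intro norm_infsum_bound summable_on_subset_banach[OF abs]) (auto simp: fibre_def)
  qed
  have "\<omega> (rinner X x (lact X a y)) = linf_functional V g a" if a: "a \<in> linf_carrier V" for a
  proof -
    have "((\<lambda>i. f (s i) * (cnj (x i) * lact X a y i)) has_sum \<omega> (rinner X x (lact X a y))) I"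
      unfolding f(2) by (rule functional_rinner(2)[OF f(1) x]) (simp add: lact_X lact_mem a y)
    then have "((\<lambda>v. \<Sum>\<^sub>\<infinity>i\<in>fibre I r v. f (s i) * (cnj (x i) * lact X a y i))
        has_sum \<omega> (rinner X x (lact X a y))) V"
      by (rule has_sum_fibres[where s = r, OF _ left_base])
    moreover have "(\<Sum>\<^sub>\<infinity>i\<in>fibre I r v. f (s i) * (cnj (x i) * lact X a y i)) = g v * a v" for v
    proof -
      have "(\<Sum>\<^sub>\<infinity>i\<in>fibre I r v. f (s i) * (cnj (x i) * lact X a y i))
          = (\<Sum>\<^sub>\<infinity>i\<in>fibre I r v. ?h i * a v)"
        by (rule infsum_cong) (auto simp: fibre_def lact_X)
      then show ?thesis by (simp add: g_def infsum_cmult_left')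
    qed
    ultimately have "((\<lambda>v. g v * a v) has_sum \<omega> (rinner X x (lact X a y))) V" by simp
    then show ?thesis using a by (simp add: linf_functional_def infsumI)
  qed
  then show "continuous_map (wstar_topology (linf V)) euclidean (\<lambda>a. \<omega> (rinner X x (lact X a y)))"
    unfolding wstar_topology_def
    by (intro continuous_map_weak_topology[of "linf_functional V g"]) (use g in \<open>auto simp: predual_linf\<close>)
qed (simp_all add: lact_X add_X smult_X distrib_right mult.assoc)

end


section \<open>Tensor products as fibre products\<close>

text \<open>The balanced tensor product of two such correspondences consists of functions on the fibre
  product of the index sets over the middle algebra.  The index set \<open>K\<close> is only required to be in
  bijection with that fibre product, so that it may be taken inside a prescribed type.\<close>

locale fibred_tensor =
  X: fibred_correspondence I sX V X rX U +
  Y: fibred_correspondence J sY W Y rY V +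
  T: fibred_correspondence K sT W T rT U
  for I :: "'i set" and sX :: "'i \<Rightarrow> 'v" and V :: "'v set"
    and X :: "('v \<Rightarrow> complex, 'i \<Rightarrow> complex, 'u \<Rightarrow> complex, 'n) correspondence_scheme"
    and rX :: "'i \<Rightarrow> 'u" and U :: "'u set"
    and J :: "'j set" and sY :: "'j \<Rightarrow> 'w" and W :: "'w set"
    and Y :: "('w \<Rightarrow> complex, 'j \<Rightarrow> complex, 'v \<Rightarrow> complex, 'p) correspondence_scheme"
    and rY :: "'j \<Rightarrow> 'v"
    and K :: "'k set" and sT :: "'k \<Rightarrow> 'w"
    and T :: "('w \<Rightarrow> complex, 'k \<Rightarrow> complex, 'u \<Rightarrow> complex, 'q) correspondence_scheme"
    and rT :: "'k \<Rightarrow> 'u" +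
  fixes p :: "'k \<Rightarrow> 'i" and q :: "'k \<Rightarrow> 'j"
  assumes pullback: "bij_betw (\<lambda>k. (q k, p k)) K (SIGMA j:J. fibre I sX (rY j))"
    and source: "\<And>k. k \<in> K \<Longrightarrow> sT k = sY (q k)"
    and range: "\<And>k. k \<in> K \<Longrightarrow> rT k = rX (p k)"
begin

definition tens :: "('i \<Rightarrow> complex) \<Rightarrow> ('j \<Rightarrow> complex) \<Rightarrow> 'k \<Rightarrow> complex"
  where "tens x y = (\<lambda>k. if k \<in> K then x (p k) * y (q k) else 0)"

lemma pullback_mem:
  assumes "k \<in> K"
  shows "q k \<in> J" "p k \<in> I" "sX (p k) = rY (q k)"
  using bij_betw_apply[OF pullback assms] by (auto simp: fibre_def)

lemma pullback_inj: "\<lbrakk>k \<in> K; l \<in> K; p k = p l; q k = q l\<rbrakk> \<Longrightarrow> k = l"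
  using bij_betw_imp_inj_on[OF pullback] by (auto simp: inj_on_def)

lemma pullback_fibre:
  "bij_betw (\<lambda>k. (q k, p k)) (fibre K sT w) (SIGMA j:fibre J sY w. fibre I sX (rY j))"
proof (rule bij_betw_subset[OF pullback])
  show "fibre K sT w \<subseteq> K" by (auto simp: fibre_def)
  show "(\<lambda>k. (q k, p k)) ` fibre K sT w = (SIGMA j:fibre J sY w. fibre I sX (rY j))" (is "?L = ?R")
  proof
    show "?L \<subseteq> ?R" using pullback_mem source by (auto simp: fibre_def)
    show "?R \<subseteq> ?L"
    proof
      fix z assume z: "z \<in> ?R"
      then have "z \<in> (\<lambda>k. (q k, p k)) ` K"
        using bij_betw_imp_surj_on[OF pullback] by (auto simp: fibre_def)
      then obtain k where k: "k \<in> K" "z = (q k, p k)" by blast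
      then have "k \<in> fibre K sT w" using z source by (auto simp: fibre_def)
      then show "z \<in> ?L" using k by blast
    qed
  qed
qed

text \<open>Fubini for absolutely convergent sums over the fibre product.\<close>

lemma tens_has_sum:
  assumes x: "x1 \<in> carrier X" "x2 \<in> carrier X" and y: "y1 \<in> carrier Y" "y2 \<in> carrier Y"
    and w: "w \<in> W"
  shows "((\<lambda>k. cnj (tens x1 y1 k) * tens x2 y2 k) has_sum
    rinner Y y1 (lact Y (rinner X x1 x2) y2) w) (fibre K sT w)"
proof -
  define h where "h = (\<lambda>(j, i). (cnj (x1 i) * x2 i) * (cnj (y1 j) * y2 j))"
  have base: "rY j \<in> V" if "j \<in> fibre J sY w" for j
    using that Y.left_base by (auto simp: fibre_def)
  have xs: "(\<lambda>i. cmod (cnj (x1 i) * x2 i)) summable_on fibre I sX v" if "v \<in> V" for v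
    using x that unfolding X.carrier_fun by (rule fibre_inner_summable)
  obtain M where M: "fibre_bounded I sX V (\<lambda>i. cmod (cnj (x1 i) * x2 i)) M"
    using fibre_inner_bound x unfolding X.carrier_fun by blast
  have xM: "(\<Sum>\<^sub>\<infinity>i\<in>fibre I sX v. cmod (cnj (x1 i) * x2 i)) \<le> M" if "v \<in> V" for v
    by (rule infsum_le_finite_sums[OF xs[OF that]]) (use M that in auto)
  have inner: "(\<Sum>\<^sub>\<infinity>i\<in>fibre I sX (rY j). cmod (h (j, i)))
      = (\<Sum>\<^sub>\<infinity>i\<in>fibre I sX (rY j). cmod (cnj (x1 i) * x2 i)) * cmod (cnj (y1 j) * y2 j)" for j
    by (simp add: h_def norm_mult infsum_cmult_left'[symmetric])
  have abs: "(\<lambda>z. norm (h z)) summable_on (SIGMA j:fibre J sY w. fibre I sX (rY j))"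
    unfolding Infinite_Sum.abs_summable_on_Sigma_iff
  proof (intro conjI ballI)
    show "(\<lambda>i. norm (h (j, i))) summable_on fibre I sX (rY j)" if "j \<in> fibre J sY w" for j
      using summable_on_cmult_left[OF xs[OF base[OF that]], of "cmod (cnj (y1 j) * y2 j)"]
      by (simp add: h_def norm_mult)
    show "(\<lambda>j. norm (\<Sum>\<^sub>\<infinity>i\<in>fibre I sX (rY j). cmod (h (j, i)))) summable_on fibre J sY w"
    proof (rule Infinite_Sum.abs_summable_on_comparison_test')
      show "(\<lambda>j. M * cmod (cnj (y1 j) * y2 j)) summable_on fibre J sY w"
        using y w by (intro summable_on_cmult_right fibre_inner_summable(2)[where W = W])
          (auto simp: Y.carrier_fun)
      show "norm (\<Sum>\<^sub>\<infinity>i\<in>fibre I sX (rY j). cmod (h (j, i))) \<le> M * cmod (cnj (y1 j) * y2 j)"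
        if "j \<in> fibre J sY w" for j
        unfolding inner using xM[OF base[OF that]]
        by (simp add: abs_mult infsum_nonneg mult_right_mono)
    qed
  qed
  let ?\<Sigma> = "SIGMA j:fibre J sY w. fibre I sX (rY j)"
  have h: "(h has_sum infsum h ?\<Sigma>) ?\<Sigma>"
    by (rule has_sum_infsum[OF abs_summable_summable[OF abs]])
  have "((\<lambda>j. rinner X x1 x2 (rY j) * (cnj (y1 j) * y2 j)) has_sum infsum h ?\<Sigma>) (fibre J sY w)"
  proof (rule has_sum_Sigma'[OF h])
    fix j assume "j \<in> fibre J sY w"
    then have "((\<lambda>i. cnj (x1 i) * x2 i) has_sum rinner X x1 x2 (rY j)) (fibre I sX (rY j))"
      using X.rinner_summable[OF x] by (simp add: X.rinner_X fibre_inner_def)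
    then show "((\<lambda>i. h (j, i)) has_sum rinner X x1 x2 (rY j) * (cnj (y1 j) * y2 j)) (fibre I sX (rY j))"
      unfolding h_def by (auto intro: has_sum_cmult_left)
  qed
  then have "infsum h ?\<Sigma> = rinner Y y1 (lact Y (rinner X x1 x2) y2) w"
    by (simp add: Y.rinner_X Y.lact_X fibre_inner_def infsumI mult.left_commute)
  with h have "((\<lambda>k. h (q k, p k)) has_sum rinner Y y1 (lact Y (rinner X x1 x2) y2) w) (fibre K sT w)"
    using has_sum_reindex_bij_betw[OF pullback_fibre[of w], of h] by simp
  then show ?thesis
    by (rule has_sum_cong[THEN iffD1, rotated]) (auto simp: h_def tens_def fibre_def mult_ac)
qed

lemma tens_mem:
  assumes x: "x \<in> carrier X" and y: "y \<in> carrier Y"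
  shows "tens x y \<in> carrier T"
proof -
  let ?a = "rinner Y y (lact Y (rinner X x x) y)"
  have a: "?a \<in> linf_carrier W"
    using y Y.lact_mem[OF X.rinner_mem[OF x x] y] by (intro Y.rinner_mem) (auto simp: Y.lact_X)
  have h: "((\<lambda>k. (cmod (tens x y k))\<^sup>2) has_sum Re (?a w)) (fibre K sT w)" if "w \<in> W" for w
  proof -
    have "Re (cnj z * z) = (cmod z)\<^sup>2" for z
      unfolding cmod_power2 by (simp add: power2_eq_square)
    then show ?thesis using has_sum_Re[OF tens_has_sum[OF x x y y that]] by simp
  qed
  have "(\<Sum>\<^sub>\<infinity>k\<in>fibre K sT w. (cmod (tens x y k))\<^sup>2) \<le> linf_norm W ?a" if "w \<in> W" for w
    unfolding infsumI[OF h[OF that]]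
    by (rule order_trans[OF complex_Re_le_cmod cmod_le_linf_norm[OF a]])
  then show ?thesis
    using has_sum_imp_summable[OF h]
    by (auto simp: T.carrier_fun fibre_l2_def tens_def intro!: bdd_aboveI2)
qed

lemma tens_delta: "k \<in> K \<Longrightarrow> tens (delta (p k)) (delta (q k)) = delta k"
  using pullback_inj by (auto simp: tens_def delta_def fun_eq_iff)

lemma wstar_tensor: "wstar_tensor (linf U) (linf V) (linf W) X Y T tens"
  unfolding wstar_tensor_def
proof (intro conjI ballI)
  show "wstar_correspondence (linf U) (linf W) T" by (rule T.wstar_correspondence)
  show "tens x y \<in> carrier T" if "x \<in> carrier X" "y \<in> carrier Y" for x y
    using that by (rule tens_mem)
  show "rinner T (tens x1 y1) (tens x2 y2) = rinner Y y1 (lact Y (rinner X x1 x2) y2)"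
    if "x1 \<in> carrier X" "y1 \<in> carrier Y" "x2 \<in> carrier X" "y2 \<in> carrier Y" for x1 y1 x2 y2
  proof
    fix w
    show "rinner T (tens x1 y1) (tens x2 y2) w = rinner Y y1 (lact Y (rinner X x1 x2) y2) w"
    proof (cases "w \<in> W")
      case True
      then show ?thesis
        using infsumI[OF tens_has_sum] that by (simp add: T.rinner_X fibre_inner_def)
    next
      case False
      then show ?thesis by (simp add: T.rinner_X Y.rinner_X fibre_inner_def T.off_base Y.off_base)
    qed
  qed
  show "lact T c (tens x y) = tens (lact X c x) y"
    if "c \<in> carrier (linf U)" "x \<in> carrier X" "y \<in> carrier Y" for c x y
    using range by (auto simp: T.lact_X X.lact_X tens_def fun_eq_iff)
  let ?S = "{tens x y | x y. x \<in> carrier X \<and> y \<in> carrier Y}"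
  show "module_wstar_topology (linf W) T closure_of lin_span T ?S = carrier T"
  proof
    have "topspace (module_wstar_topology (linf W) T) \<subseteq> carrier T"
      unfolding module_wstar_topology_def by (rule topspace_weak_topology_subset)
    then show "module_wstar_topology (linf W) T closure_of lin_span T ?S \<subseteq> carrier T"
      using closure_of_subset_topspace by fastforce
    show "carrier T \<subseteq> module_wstar_topology (linf W) T closure_of lin_span T ?S"
    proof
      fix z assume z: "z \<in> carrier T"
      show "z \<in> module_wstar_topology (linf W) T closure_of lin_span T ?S"
      proof (rule T.wstar_closure_of_truncations[OF z])
        fix F :: "'k set" assume F: "finite F"
        have "(\<lambda>k. if k \<in> F then z k else 0) \<in> H"
          if H: "submodule H complex_ring T" "?S \<subseteq> H" for H
        proof -
          interpret H: submodule H complex_ring T by (rule H(1))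
          have "function_space H"
          proof
            show "(\<lambda>_. 0) \<in> H" using H.one_closed by (simp add: T.zero_fun)
            show "(\<lambda>i. x i + y i) \<in> H" if "x \<in> H" "y \<in> H" for x y
              using H.m_closed[OF that] by (simp add: T.add_fun)
            show "(\<lambda>i. t * x i) \<in> H" if "x \<in> H" for t x
              using H.smult_closed[of t x] that by (simp add: T.smult_fun)
          qed
          moreover have "delta k \<in> H" if "k \<in> F \<inter> K" for k
          proof -
            have "delta (p k) \<in> carrier X" "delta (q k) \<in> carrier Y"
              using that pullback_mem by (auto simp: X.carrier_fun Y.carrier_fun intro: fibre_l2_delta)
            then show ?thesis using H(2) tens_delta[of k] that by fastforce
          qed
          ultimately have "(\<lambda>k. if k \<in> F \<inter> K then z k else 0) \<in> H"
            using function_space.linear_finite_support[of H "F \<inter> K" "\<lambda>_. 0" z] F by simp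
          moreover have "(\<lambda>k. if k \<in> F \<inter> K then z k else 0) = (\<lambda>k. if k \<in> F then z k else 0)"
            using T.off_carrier[OF z] by (auto simp: fun_eq_iff)
          ultimately show ?thesis by simp
        qed
        then show "(\<lambda>k. if k \<in> F then z k else 0) \<in> lin_span T ?S"
          unfolding lin_span_def by blast
      qed
    qed
  qed
qed

end


section \<open>Equivalence bimodules from bijections\<close>

lemma fibre_inj_on:
  assumes "inj_on s I" "i \<in> I"
  shows "fibre I s (s i) = {i}"
  using assms by (auto simp: fibre_def inj_on_def)

lemma fibre_inner_inj_on:
  "\<lbrakk>inj_on s I; i \<in> I\<rbrakk> \<Longrightarrow> fibre_inner I s x y (s i) = cnj (x i) * y i"
  by (simp add: fibre_inner_def fibre_inj_on)

lemma fibre_l2_bij: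
  assumes "bij_betw s I W"
  shows "fibre_l2 I s W = linf_carrier I"
proof -
  have inj: "inj_on s I" and W: "W = s ` I" using assms by (auto simp: bij_betw_def)
  have "(\<lambda>i. (cmod (x i))\<^sup>2) summable_on fibre I s w" if "w \<in> W" for x :: "'a \<Rightarrow> complex" and w
    using that W by (auto simp: fibre_inj_on[OF inj])
  moreover have "(\<lambda>w. \<Sum>\<^sub>\<infinity>i\<in>fibre I s w. (cmod (x i))\<^sup>2) ` W = (\<lambda>i. (cmod (x i))\<^sup>2) ` I"
    for x :: "'a \<Rightarrow> complex"
    unfolding W image_image by (rule image_cong) (auto simp: fibre_inj_on[OF inj])
  moreover have "bdd_above ((\<lambda>i. (cmod (x i))\<^sup>2) ` I) \<longleftrightarrow> bounded (x ` I)" for x :: "'a \<Rightarrow> complex"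
  proof
    assume "bdd_above ((\<lambda>i. (cmod (x i))\<^sup>2) ` I)"
    then obtain K where "\<forall>i\<in>I. (cmod (x i))\<^sup>2 \<le> K" by (auto simp: bdd_above_def)
    then have "\<forall>i\<in>I. cmod (x i) \<le> sqrt K" by (auto intro: real_le_rsqrt)
    then show "bounded (x ` I)" by (auto simp: bounded_iff)
  next
    assume "bounded (x ` I)"
    then obtain K where "\<forall>i\<in>I. cmod (x i) \<le> K" by (auto simp: bounded_iff)
    then have "\<forall>i\<in>I. (cmod (x i))\<^sup>2 \<le> K\<^sup>2" by (auto intro: power_mono)
    then show "bdd_above ((\<lambda>i. (cmod (x i))\<^sup>2) ` I)" by (auto intro: bdd_aboveI2)
  qed
  ultimately show ?thesis by (auto simp: fibre_l2_def linf_carrier_def)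
qed

text \<open>When the fibres are points, the inner products already exhaust \<open>\<ell>\<^sup>\<infinity>(W)\<close>: pair the constant \<open>1\<close>
  with the pullback of a given function.\<close>

lemma (in fibred_module) wstar_full_bij:
  assumes "bij_betw s I W"
  shows "wstar_full (linf W) X"
proof -
  have inj: "inj_on s I" and W: "W = s ` I" using assms by (auto simp: bij_betw_def)
  let ?S = "{rinner X x y | x y. x \<in> carrier X \<and> y \<in> carrier X}"
  have "b \<in> ?S" if b: "b \<in> linf_carrier W" for b
  proof -
    let ?x = "\<lambda>i. if i \<in> I then 1 else 0" and ?y = "\<lambda>i. if i \<in> I then b (s i) else 0"
    have "?x \<in> carrier X" "?y \<in> carrier X"
      unfolding carrier_fun fibre_l2_bij[OF assms]
      by (rule linf_memI[of _ _ 1], auto) (rule linf_memI[of _ _ "linf_norm W b"], auto intro: cmod_le_linf_norm[OF b])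
    moreover have "b w = rinner X ?x ?y w" for w
    proof (cases "w \<in> W")
      case True
      then show ?thesis using W by (auto simp: rinner_X fibre_inner_inj_on[OF inj])
    next
      case False
      then show ?thesis by (simp add: rinner_X fibre_inner_def off_base linf_off[OF b])
    qed
    then have "b = rinner X ?x ?y" by (rule ext)
    ultimately show ?thesis by blast
  qed
  then have S: "?S = linf_carrier W" using rinner_mem by blast
  have top: "topspace (wstar_topology (linf W)) = linf_carrier W"
  proof -
    have "predual (linf W) \<noteq> {}" using wstar_algebra.predual_zero[OF wstar_algebra_linf] by blast
    then show ?thesis by (simp add: wstar_topology_def topspace_weak_topology)
  qed
  have "?S \<subseteq> lin_span (linf W) ?S" by (auto simp: lin_span_def)
  from closure_of_mono[OF this, of "wstar_topology (linf W)"]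
    closure_of_topspace[of "wstar_topology (linf W)"]
    closure_of_subset_topspace[of "wstar_topology (linf W)" "lin_span (linf W) ?S"]
  show ?thesis unfolding wstar_full_def using S top by auto
qed

text \<open>The left module structure is therefore again a right module over \<open>\<ell>\<^sup>\<infinity>(V)\<close>, and the results on
  right modules serve both sides.\<close>

lemma opposite_linf: "opposite (linf V) = linf V"
  by (simp add: opposite_def linf_def mult.commute)

lemma wstar_equivalence_bimodule_bij:
  fixes X :: "('w \<Rightarrow> complex, 'i \<Rightarrow> complex, 'v \<Rightarrow> complex, 'n) bimod_scheme"
  assumes "fibred_correspondence N s W X r V"
    and s: "bij_betw s N W" and r: "bij_betw r N V"
    and linner: "linner X = (\<lambda>x y. fibre_inner N r y x)"
  shows "wstar_equivalence_bimodule (linf V) (linf W) X"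
proof -
  interpret fibred_correspondence N s W X r V by fact
  have inj: "inj_on s N" "inj_on r N" using s r by (auto simp: bij_betw_def)
  interpret L: fibred_module N r V "left_module X"
    by unfold_locales (auto simp: left_base left_module_def carrier_fun fibre_l2_bij[OF s] fibre_l2_bij[OF r]
      zero_X add_X smult_X lact_X linner mult.commute)
  show ?thesis
    unfolding wstar_equivalence_bimodule_def opposite_linf
  proof (intro conjI ballI)
    show "adjointable (left_module X) (\<lambda>x. ract X x b)" if b: "b \<in> carrier (linf W)" for b
      unfolding adjointable_def
    proof (intro conjI bexI ballI)
      let ?T = "\<lambda>b x. ract X x b"
      show "rinner (left_module X) (?T b x) y = rinner (left_module X) x (?T (\<lambda>w. cnj (b w)) y)" for x y
        by (simp add: left_module_def linner ract_X fibre_inner_def mult_ac)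
      have "carrier (left_module X) = carrier X" by (simp add: left_module_def)
      then show "?T b \<in> carrier (left_module X) \<rightarrow> carrier (left_module X)"
        "?T (\<lambda>w. cnj (b w)) \<in> carrier (left_module X) \<rightarrow> carrier (left_module X)"
        using ract_mem[of _ b] ract_mem[OF _ linf_cnj[of b]] b by (auto simp: ract_X)
    qed
    show "lact X (linner X x y) z = ract X x (rinner X y z)"
      if "x \<in> carrier X" "y \<in> carrier X" "z \<in> carrier X" for x y z
    proof
      fix i
      show "lact X (linner X x y) z i = ract X x (rinner X y z) i"
        by (cases "i \<in> N") (simp_all add: lact_X ract_X linner rinner_X fibre_inner_inj_on inj
          off_carrier[OF that(1)] off_carrier[OF that(3)] mult_ac)
    qed
  qed (use right_wstar_module L.right_wstar_module wstar_full_bij[OF s] L.wstar_full_bij[OF r] adjointable_lact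
    in \<open>simp_all add: lact_X ract_X mult_ac\<close>)
qed


section \<open>Isomorphic graphs have Morita equivalent correspondences\<close>

definition fibred_bimod ::
    "'i set \<Rightarrow> ('i \<Rightarrow> 'w) \<Rightarrow> 'w set \<Rightarrow> ('i \<Rightarrow> 'v) \<Rightarrow> ('w \<Rightarrow> complex, 'i \<Rightarrow> complex, 'v \<Rightarrow> complex) bimod"
  where "fibred_bimod I s W r = \<lparr>carrier = fibre_l2 I s W, mult = undefined, one = undefined,
    zero = (\<lambda>_. 0), add = (\<lambda>x y i. x i + y i), smult = (\<lambda>t x i. t * x i),
    ract = (\<lambda>x b i. x i * b (s i)), rinner = fibre_inner I s,
    lact = (\<lambda>a x i. a (r i) * x i), linner = (\<lambda>x y. fibre_inner I r y x)\<rparr>"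

lemma fibred_correspondence_fibred_bimod:
  assumes "\<And>i. i \<in> I \<Longrightarrow> s i \<in> W" "\<And>i. i \<in> I \<Longrightarrow> r i \<in> V"
  shows "fibred_correspondence I s W (fibred_bimod I s W r) r V"
    and "fibred_correspondence I s W (correspondence.truncate (fibred_bimod I s W r)) r V"
  by (unfold_locales; simp add: fibred_bimod_def correspondence.truncate_def assms)+

lemma fibred_correspondence_graph:
  assumes "wf_digraph G"
  shows "fibred_correspondence (arcs G) (tail G) (verts G) (graph_correspondence G) (head G) (verts G)"
proof -
  interpret wf_digraph G by fact
  have "out_arcs G v = fibre (arcs G) (tail G) v" for v
    by (auto simp: out_arcs_def fibre_def)
  then show ?thesis
    by unfold_locales (simp_all add: graph_correspondence_def fibre_l2_def fibre_inner_def fun_eq_iff)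
qed

text \<open>Both tensor products are realised by the square-summable functions on the edges, and the
  isomorphism between them is the identity.  The index sets are coded by natural numbers.\<close>

lemma graph_isomorphic_imp_morita_equivalent:
  fixes G :: "('v, 'e) pre_digraph" and F :: "('w, 'f) pre_digraph"
  assumes wf: "wf_digraph G" "wf_digraph F"
    and countable: "countable (verts F)" "countable (arcs F)"
    and iso: "graph_isomorphic G F"
  shows "morita_equivalent TYPE(nat \<Rightarrow> complex) (linf (verts G)) (linf (verts F))
    (graph_correspondence G) (graph_correspondence F)"
proof -
  interpret G: wf_digraph G by fact
  interpret F: wf_digraph F by fact
  let ?V = "verts G" and ?W = "verts F"
  obtain \<alpha> \<beta> where \<alpha>: "bij_betw \<alpha> (arcs G) (arcs F)" and \<beta>: "bij_betw \<beta> ?V ?W"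
    and ends: "\<And>e. e \<in> arcs G \<Longrightarrow> tail F (\<alpha> e) = \<beta> (tail G e)"
      "\<And>e. e \<in> arcs G \<Longrightarrow> head F (\<alpha> e) = \<beta> (head G e)"
    using iso by (auto simp: graph_isomorphic_def)
  define \<beta>' \<alpha>' where "\<beta>' = inv_into ?V \<beta>" and "\<alpha>' = inv_into (arcs G) \<alpha>"
  have \<beta>': "bij_betw \<beta>' ?W ?V" and \<alpha>': "bij_betw \<alpha>' (arcs F) (arcs G)"
    unfolding \<beta>'_def \<alpha>'_def using bij_betw_inv_into \<alpha> \<beta> by auto
  have \<alpha>'_mem: "\<alpha>' f \<in> arcs G" and \<alpha>\<alpha>': "\<alpha> (\<alpha>' f) = f" if "f \<in> arcs F" for f
    using that bij_betw_apply[OF \<alpha>'] bij_betw_inv_into_right[OF \<alpha>] by (auto simp: \<alpha>'_def)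
  have \<beta>'\<beta>: "\<beta>' (\<beta> v) = v" if "v \<in> ?V" for v
    using that bij_betw_inv_into_left[OF \<beta>] by (simp add: \<beta>'_def)
  have ends': "tail G (\<alpha>' f) = \<beta>' (tail F f)" "head G (\<alpha>' f) = \<beta>' (head F f)" if "f \<in> arcs F" for f
    using ends[OF \<alpha>'_mem[OF that]] \<alpha>'_mem[OF that] by (simp_all add: \<alpha>\<alpha>'[OF that] \<beta>'\<beta>)
  define n a where "n = to_nat_on ?W" and "a = to_nat_on (arcs F)"
  define s d where "s = from_nat_into ?W" and "d = from_nat_into (arcs F)"
  have sn: "s (n w) = w" if "w \<in> ?W" for w
    using that countable by (simp add: s_def n_def)
  have da: "d (a f) = f" if "f \<in> arcs F" for f
    using that countable by (simp add: d_def a_def)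
  define N K where "N = n ` ?W" and "K = a ` arcs F"
  define r where "r = (\<lambda>i. \<beta>' (s i))"
  have s: "bij_betw s N ?W" and d: "bij_betw d K (arcs F)"
    unfolding N_def K_def by (rule bij_betwI[of _ _ _ n] bij_betwI[of _ _ _ a]; auto simp: sn da)+
  have r: "bij_betw r N ?V"
    unfolding r_def using bij_betw_trans[OF s \<beta>'] by (simp add: o_def)
  have dK: "d k \<in> arcs F" "a (d k) = k" if "k \<in> K" for k
    using that by (auto simp: K_def da)
  define sT rT where "sT = (\<lambda>k. tail F (d k))" and "rT = (\<lambda>k. \<beta>' (head F (d k)))"
  let ?X = "fibred_bimod N s ?W r"
  let ?T = "correspondence.truncate (fibred_bimod K sT ?W rT)"
  have X: "fibred_correspondence N s ?W ?X r ?V"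
    using bij_betw_apply[OF s] bij_betw_apply[OF r] by (rule fibred_correspondence_fibred_bimod)
  have T: "fibred_correspondence K sT ?W ?T rT ?V"
    using dK bij_betw_apply[OF \<beta>']
    by (intro fibred_correspondence_fibred_bimod) (auto simp: sT_def rT_def)
  note E = fibred_correspondence_graph[OF wf(1)] and D = fibred_correspondence_graph[OF wf(2)]
  \<comment> \<open>The factor on the vertices is determined by the edge: its range in \<open>X \<otimes> D\<close>, its source in
      \<open>E \<otimes> X\<close>.\<close>
  interpret XD: fibred_tensor N s ?W ?X r ?V "arcs F" "tail F" ?W "graph_correspondence F" "head F"
    K sT ?T rT "\<lambda>k. n (head F (d k))" d
  proof (intro fibred_tensor.intro fibred_tensor_axioms.intro X D T)
    show "bij_betw (\<lambda>k. (d k, n (head F (d k)))) K (SIGMA j:arcs F. fibre N s (head F j))"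
      by (rule bij_betwI[of _ _ _ "\<lambda>(j, i). a j"])
        (auto simp: dK K_def N_def fibre_def da sn)
  qed (auto simp: sT_def rT_def r_def sn dK)
  interpret EX: fibred_tensor "arcs G" "tail G" ?V "graph_correspondence G" "head G" ?V N s ?W ?X r
    K sT ?T rT "\<lambda>k. \<alpha>' (d k)" "\<lambda>k. n (tail F (d k))"
  proof (intro fibred_tensor.intro fibred_tensor_axioms.intro X E T)
    have "\<beta>' w = \<beta>' w' \<Longrightarrow> w = w'" if "w \<in> ?W" "w' \<in> ?W" for w w'
      using that bij_betw_imp_inj_on[OF \<beta>'] by (auto simp: inj_on_def)
    then have tail: "tail F (\<alpha> e) = w" if "e \<in> arcs G" "w \<in> ?W" "tail G e = \<beta>' w" for e w
      using that ends(1) bij_betw_inv_into_right[OF \<beta>] by (simp add: \<beta>'_def)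
    have \<alpha>_mem: "\<alpha> e \<in> arcs F" and \<alpha>'\<alpha>: "\<alpha>' (\<alpha> e) = e" if "e \<in> arcs G" for e
      using that bij_betw_apply[OF \<alpha>] bij_betw_inv_into_left[OF \<alpha>] by (auto simp: \<alpha>'_def)
    show "bij_betw (\<lambda>k. (n (tail F (d k)), \<alpha>' (d k))) K (SIGMA j:N. fibre (arcs G) (tail G) (r j))"
      by (rule bij_betwI[of _ _ _ "\<lambda>(j, e). a (\<alpha> e)"])
        (auto simp: dK K_def N_def fibre_def da sn r_def ends' \<alpha>'_mem \<alpha>\<alpha>' \<alpha>_mem \<alpha>'\<alpha> tail)
  qed (auto simp: sT_def rT_def sn dK ends')
  have "wstar_equivalence_bimodule (linf ?V) (linf ?W) ?X"
    by (rule wstar_equivalence_bimodule_bij[OF X s r]) (simp add: fibred_bimod_def)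
  moreover have "correspondence_iso (linf ?V) (linf ?W) ?T ?T id"
    by (simp add: correspondence_iso_def)
  ultimately show ?thesis
    unfolding morita_equivalent_def
    using XD.Y.wstar_correspondence EX.X.wstar_correspondence XD.wstar_tensor EX.wstar_tensor by blast
qed


section \<open>Modules over \<open>\<ell>\<^sup>\<infinity>(W)\<close> at a point\<close>

text \<open>Evaluating the inner product at one point of \<open>W\<close> gives a positive semidefinite form with
  complex values.\<close>

locale linf_module = right_cstar_module "linf W" X
  for W :: "'w set" and X :: "('w \<Rightarrow> complex, 'x, 'n) hilbert_module_scheme"
begin

lemma smult_mem: "x \<in> carrier X \<Longrightarrow> t \<odot>\<^bsub>X\<^esub> x \<in> carrier X"
  by (simp add: X.smult_closed)

lemma zero_smult: "x \<in> carrier X \<Longrightarrow> 0 \<odot>\<^bsub>X\<^esub> x = \<zero>\<^bsub>X\<^esub>"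
  using X.smult_l_null[of x] by simp

lemma smult_smult: "x \<in> carrier X \<Longrightarrow> t \<odot>\<^bsub>X\<^esub> (u \<odot>\<^bsub>X\<^esub> x) = (t * u) \<odot>\<^bsub>X\<^esub> x"
  using X.smult_assoc1[of t u x] by simp

lemma one_smult: "x \<in> carrier X \<Longrightarrow> 1 \<odot>\<^bsub>X\<^esub> x = x"
  using X.smult_one[of x] by simp

lemma inner_mem: "\<lbrakk>x \<in> carrier X; y \<in> carrier X\<rbrakk> \<Longrightarrow> rinner X x y \<in> linf_carrier W"
  using rinner_closed by simp

lemma inner_cnj: "\<lbrakk>x \<in> carrier X; y \<in> carrier X\<rbrakk> \<Longrightarrow> rinner X y x w = cnj (rinner X x y w)"
  using fun_cong[OF rinner_star[of x y], of w] by simp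

lemma inner_add:
  assumes "x \<in> carrier X" "y \<in> carrier X" "z \<in> carrier X"
  shows "rinner X x (y \<oplus>\<^bsub>X\<^esub> z) w = rinner X x y w + rinner X x z w"
    and "rinner X (y \<oplus>\<^bsub>X\<^esub> z) x w = rinner X y x w + rinner X z x w"
proof -
  show *: "rinner X x (y \<oplus>\<^bsub>X\<^esub> z) w = rinner X x y w + rinner X x z w"
    using rinner_add assms by simp
  have "rinner X (y \<oplus>\<^bsub>X\<^esub> z) x w = cnj (rinner X x (y \<oplus>\<^bsub>X\<^esub> z) w)"
    using assms by (intro inner_cnj) auto
  then show "rinner X (y \<oplus>\<^bsub>X\<^esub> z) x w = rinner X y x w + rinner X z x w"
    using assms by (simp add: * inner_cnj[of x y] inner_cnj[of x z])
qed

lemma inner_smult: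
  assumes "x \<in> carrier X" "y \<in> carrier X"
  shows "rinner X x (t \<odot>\<^bsub>X\<^esub> y) w = t * rinner X x y w"
    and "rinner X (t \<odot>\<^bsub>X\<^esub> y) x w = cnj t * rinner X y x w"
proof -
  show *: "rinner X x (t \<odot>\<^bsub>X\<^esub> y) w = t * rinner X x y w"
    using rinner_smult assms by simp
  have "rinner X (t \<odot>\<^bsub>X\<^esub> y) x w = cnj (rinner X x (t \<odot>\<^bsub>X\<^esub> y) w)"
    using assms by (intro inner_cnj smult_mem)
  then show "rinner X (t \<odot>\<^bsub>X\<^esub> y) x w = cnj t * rinner X y x w"
    using assms by (simp add: * inner_cnj[of x y])
qed

lemma inner_ract:
  assumes "x \<in> carrier X" "y \<in> carrier X" "b \<in> linf_carrier W"
  shows "rinner X x (ract X y b) w = rinner X x y w * b w"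
    and "rinner X (ract X y b) x w = cnj (b w) * rinner X y x w"
proof -
  show *: "rinner X x (ract X y b) w = rinner X x y w * b w"
    using rinner_ract assms by simp
  have "rinner X (ract X y b) x w = cnj (rinner X x (ract X y b) w)"
    using assms ract_closed by (intro inner_cnj) auto
  then show "rinner X (ract X y b) x w = cnj (b w) * rinner X y x w"
    using assms by (simp add: * inner_cnj[of x y])
qed

lemma inner_self:
  assumes "x \<in> carrier X"
  shows "0 \<le> Re (rinner X x x w)" "rinner X x x w = of_real (Re (rinner X x x w))"
proof -
  have "rinner X x x w \<in> \<real>\<^sub>\<ge>\<^sub>0"
    using rinner_positive[OF assms] by (simp add: positive_elements_linf)
  then show "0 \<le> Re (rinner X x x w)" "rinner X x x w = of_real (Re (rinner X x x w))"
    by (auto simp: nonneg_Reals_def)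
qed

lemma cauchy_schwarz:
  assumes x: "x \<in> carrier X" and y: "y \<in> carrier X"
  shows "(cmod (rinner X x y w))\<^sup>2 \<le> Re (rinner X x x w) * Re (rinner X y y w)"
proof -
  define a b c where "a = Re (rinner X x x w)" and "b = Re (rinner X y y w)" and "c = rinner X x y w"
  have a: "rinner X x x w = of_real a" "0 \<le> a" and b: "rinner X y y w = of_real b" "0 \<le> b"
    using inner_self[OF x] inner_self[OF y] by (auto simp: a_def b_def)
  have c: "rinner X x y w = c" "rinner X y x w = cnj c"
    using inner_cnj[OF x y] by (auto simp: c_def)
  have quad: "0 \<le> Re (cnj s * s * a + cnj s * t * c + cnj t * s * cnj c + cnj t * t * b)" for s t
  proof -
    let ?z = "s \<odot>\<^bsub>X\<^esub> x \<oplus>\<^bsub>X\<^esub> t \<odot>\<^bsub>X\<^esub> y"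
    have "?z \<in> carrier X" using x y smult_mem by auto
    then have "0 \<le> Re (rinner X ?z ?z w)" by (rule inner_self)
    also have "rinner X ?z ?z w = cnj s * s * a + cnj s * t * c + cnj t * s * cnj c + cnj t * t * b"
      using x y by (simp add: inner_add inner_smult smult_mem a(1) b(1) c algebra_simps)
    finally show ?thesis .
  qed
  have cc: "c * cnj c = of_real ((cmod c)\<^sup>2)" by (simp add: complex_norm_square del: of_real_power)
  \<comment> \<open>The usual vector \<open>b x - c\<^sup>* y\<close> settles the case \<open>b > 0\<close>; exchanging the roles of \<open>x\<close> and \<open>y\<close>
      settles \<open>a > 0\<close>, and if both vectors are null, then \<open>x - c\<^sup>* y\<close> has squared length
      \<open>- 2 |c|\<^sup>2\<close>.\<close>
  have "b * (a * b - (cmod c)\<^sup>2) \<ge> 0"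
  proof -
    have "cnj (of_real b) * of_real b * of_real a + cnj (of_real b) * (- cnj c) * c
      + cnj (- cnj c) * of_real b * cnj c + cnj (- cnj c) * (- cnj c) * of_real b
      = complex_of_real (b * (a * b - (cmod c)\<^sup>2))"
      using cc by (simp add: algebra_simps del: of_real_power)
    then show ?thesis using quad[of "of_real b" "- cnj c"] by (simp del: of_real_mult of_real_diff of_real_power)
  qed
  moreover have "a * (a * b - (cmod c)\<^sup>2) \<ge> 0"
  proof -
    have "cnj (- c) * (- c) * of_real a + cnj (- c) * of_real a * c
      + cnj (of_real a) * (- c) * cnj c + cnj (of_real a) * of_real a * of_real b
      = complex_of_real (a * (a * b - (cmod c)\<^sup>2))"
      using cc by (simp add: algebra_simps del: of_real_power)
    then show ?thesis using quad[of "- c" "of_real a"] by (simp del: of_real_mult of_real_diff of_real_power)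
  qed
  moreover have "(cmod c)\<^sup>2 \<le> 0" if "a = 0" "b = 0"
  proof -
    have "cnj 1 * 1 * of_real a + cnj 1 * (- cnj c) * c + cnj (- cnj c) * 1 * cnj c
        + cnj (- cnj c) * (- cnj c) * of_real b = complex_of_real (- 2 * (cmod c)\<^sup>2)"
      using cc that by (simp add: algebra_simps del: of_real_power)
    then show ?thesis using quad[of 1 "- cnj c"] by (simp del: of_real_mult of_real_power)
  qed
  ultimately have "(cmod c)\<^sup>2 \<le> a * b"
    using a(2) b(2) by (cases "a = 0"; cases "b = 0") (auto simp: zero_le_mult_iff mult_le_0_iff)
  then show ?thesis by (simp add: a_def b_def c_def)
qed

text \<open>The hypotheses say that \<open>z - z'\<close> has length zero at \<open>w\<close>.  This replaces linearity and
  balancedness of elementary tensors, which are only known through their inner products.\<close>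

lemma inner_eq_if_null_difference:
  assumes z: "z \<in> carrier X" and z': "z' \<in> carrier X" and x: "x \<in> carrier X"
    and eq: "rinner X z z w = c" "rinner X z z' w = c" "rinner X z' z' w = c"
  shows "rinner X x z w = rinner X x z' w"
proof -
  let ?d = "z \<oplus>\<^bsub>X\<^esub> (-1) \<odot>\<^bsub>X\<^esub> z'"
  have d: "?d \<in> carrier X" using z z' smult_mem by auto
  have "cnj c = c" using inner_cnj[OF z z, of w] eq by simp
  then have "rinner X z' z w = c" using inner_cnj[OF z z', of w] eq by simp
  then have "rinner X ?d ?d w = 0"
    using z z' eq by (simp add: inner_add inner_smult smult_mem)
  then have "rinner X x ?d w = 0" using cauchy_schwarz[OF x d, of w] by simp
  then show ?thesis using x z z' by (simp add: inner_add inner_smult smult_mem)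
qed

lemma eq_zero_iff: "x \<in> carrier X \<Longrightarrow> x = \<zero>\<^bsub>X\<^esub> \<longleftrightarrow> (\<forall>w\<in>W. rinner X x x w = 0)"
proof
  assume x: "x \<in> carrier X" and "x = \<zero>\<^bsub>X\<^esub>"
  then have "x = 0 \<odot>\<^bsub>X\<^esub> x" using zero_smult[OF x] by simp
  then have "rinner X x x w = rinner X x (0 \<odot>\<^bsub>X\<^esub> x) w" for w by simp
  then show "\<forall>w\<in>W. rinner X x x w = 0" by (simp add: inner_smult[OF x x])
next
  assume x: "x \<in> carrier X" and "\<forall>w\<in>W. rinner X x x w = 0"
  then have "rinner X x x = (\<lambda>_. 0)"
    using linf_off[OF inner_mem[OF x x]] by (auto simp: fun_eq_iff)
  then show "x = \<zero>\<^bsub>X\<^esub>" using rinner_definite[OF x] by simp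
qed

lemma ract_delta_mem: "\<lbrakk>x \<in> carrier X; w \<in> W\<rbrakk> \<Longrightarrow> ract X x (delta w) \<in> carrier X"
  by (simp add: ract_closed linf_delta)

lemma ract_delta_ract:
  assumes x: "x \<in> carrier X" and b: "b \<in> linf_carrier W" and w: "w \<in> W"
  shows "ract X (ract X x (delta w)) b = b w \<odot>\<^bsub>X\<^esub> ract X x (delta w)"
proof -
  have "ract X (ract X x (delta w)) b = ract X x (\<lambda>u. delta w u * b u)"
    using ract_mult[OF x, of "delta w" b] b w by (simp add: linf_delta)
  also have "(\<lambda>u. delta w u * b u) = (\<lambda>u. b w * delta w u)"
    by (auto simp: delta_def)
  also have "ract X x (\<lambda>u. b w * delta w u) = b w \<odot>\<^bsub>X\<^esub> ract X x (delta w)"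
    using ract_smult_right[OF x, of "delta w" "b w"] w by (simp add: linf_delta)
  finally show ?thesis .
qed

lemma ract_delta_idem:
  assumes "x \<in> carrier X" "w \<in> W"
  shows "ract X (ract X x (delta w)) (delta w) = ract X x (delta w)"
  using ract_delta_ract[OF assms(1) linf_delta[OF assms(2)] assms(2)] ract_delta_mem[OF assms]
  by (simp add: one_smult delta_def)

lemma exists_ract_delta_nonzero:
  assumes "x \<in> carrier X" "x \<noteq> \<zero>\<^bsub>X\<^esub>"
  shows "\<exists>w\<in>W. ract X x (delta w) \<noteq> \<zero>\<^bsub>X\<^esub>"
proof -
  obtain w where w: "w \<in> W" "rinner X x x w \<noteq> 0" using assms eq_zero_iff by blast
  then have "rinner X (ract X x (delta w)) (ract X x (delta w)) w \<noteq> 0"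
    using assms ract_delta_mem[of x w] by (simp add: inner_ract linf_delta delta_same)
  then show ?thesis using w assms eq_zero_iff[OF ract_delta_mem] by blast
qed

text \<open>Evaluation at \<open>w\<close> is \<open>w\<^sup>*\<close>-continuous.  If it vanished on all inner products, it would vanish on
  their \<open>w\<^sup>*\<close>-closed span, which contains \<open>delta w\<close>.\<close>

lemma full_imp_ract_delta_nonzero:
  assumes full: "wstar_full (linf W) X" and w: "w \<in> W"
  shows "\<exists>x\<in>carrier X. ract X x (delta w) \<noteq> \<zero>\<^bsub>X\<^esub>"
proof (rule ccontr)
  assume "\<not> ?thesis"
  then have zero: "ract X y (delta w) = \<zero>\<^bsub>X\<^esub>" if "y \<in> carrier X" for y using that by blast
  let ?S = "{rinner X x y | x y. x \<in> carrier X \<and> y \<in> carrier X}"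
  let ?\<phi> = "\<lambda>a. if a \<in> linf_carrier W then a w else 0"
  have inner: "rinner X x y w = 0" if xy: "x \<in> carrier X" "y \<in> carrier X" for x y
  proof -
    have "rinner X x y w = rinner X x (ract X y (delta w)) w"
      using xy w by (simp add: inner_ract linf_delta delta_same)
    also have "\<dots> = rinner X x (0 \<odot>\<^bsub>X\<^esub> y) w" using xy by (simp add: zero zero_smult)
    finally show ?thesis using xy by (simp add: inner_smult)
  qed
  interpret C: function_module "linf W" by (rule function_module_linf)
  have "?\<phi> a = 0" if "a \<in> lin_span (linf W) ?S" for a
    by (rule lin_span_vanishing[OF C.is_module _ _ _ _ that])
      (auto simp: inner inner_mem linf_add linf_smult)
  moreover have "delta w \<in> weak_topology (linf_carrier W) (predual (linf W)) closure_of lin_span (linf W) ?S"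
    using full linf_delta[OF w] by (simp add: wstar_full_def wstar_topology_def)
  ultimately have "?\<phi> (delta w) = 0"
    using weak_closure_vanishing[OF _ evaluation_in_predual[OF w]] by blast
  then show False using linf_delta[OF w] by (simp add: delta_def)
qed

lemma inner_vanishes_on_closure:
  assumes w: "w \<in> W" and x: "x \<in> carrier X" and S: "S \<subseteq> carrier X"
    and zero: "\<And>y. y \<in> S \<Longrightarrow> rinner X x y w = 0"
    and y: "y \<in> module_wstar_topology (linf W) X closure_of lin_span X S" "y \<in> carrier X"
  shows "rinner X x y w = 0"
proof -
  let ?\<phi> = "\<lambda>y. if y \<in> carrier X then rinner X x y w else 0"
  have norm: "(hnorm (linf W) X z)\<^sup>2 = linf_norm W (rinner X z z)" if "z \<in> carrier X" for z
    using linf_norm_nonneg[OF inner_mem[OF that that]] by (simp add: hnorm_def)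
  have bound: "cmod (rinner X x z w) \<le> hnorm (linf W) X x * hnorm (linf W) X z"
    if z: "z \<in> carrier X" for z
  proof (rule power2_le_imp_le)
    have "(cmod (rinner X x z w))\<^sup>2 \<le> Re (rinner X x x w) * Re (rinner X z z w)"
      by (rule cauchy_schwarz[OF x z])
    also have "\<dots> \<le> linf_norm W (rinner X x x) * linf_norm W (rinner X z z)"
      using x z by (intro mult_mono order_trans[OF complex_Re_le_cmod cmod_le_linf_norm]
          inner_mem linf_norm_nonneg inner_self)
    also have "\<dots> = (hnorm (linf W) X x * hnorm (linf W) X z)\<^sup>2"
      by (simp add: power_mult_distrib norm x z)
    finally show "(cmod (rinner X x z w))\<^sup>2 \<le> (hnorm (linf W) X x * hnorm (linf W) X z)\<^sup>2" .
    show "0 \<le> hnorm (linf W) X x * hnorm (linf W) X z"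
      using x z by (simp add: hnorm_def linf_norm_nonneg inner_mem)
  qed
  have hn: "0 \<le> hnorm (linf W) X z" if "z \<in> carrier X" for z
    using that by (simp add: hnorm_def linf_norm_nonneg inner_mem)
  have "?\<phi> \<in> dual_space X (hnorm (linf W) X)"
    using x smult_mem bound by (auto simp: dual_space_def inner_add inner_smult)
  moreover have "\<exists>ps. set ps \<subseteq> predual (linf W) \<times> carrier X \<and>
      (\<forall>z\<in>carrier X. cmod (?\<phi> z - (\<Sum>(\<omega>, y) \<leftarrow> ps. \<omega> (rinner X y z))) \<le> \<epsilon> * hnorm (linf W) X z)"
    if "\<epsilon> > 0" for \<epsilon>
    by (rule exI[of _ "[(\<lambda>a. if a \<in> linf_carrier W then a w else 0, x)]"])
      (use evaluation_in_predual[OF w] that x hn in \<open>auto simp: inner_mem\<close>)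
  ultimately have predual: "?\<phi> \<in> module_predual (linf W) X" by (simp add: module_predual_def)
  have vanish: "?\<phi> z = 0" if "z \<in> lin_span X S" for z
    by (rule lin_span_vanishing[OF X.module_axioms S _ _ _ that])
      (use x S zero smult_mem in \<open>auto simp: inner_add inner_smult\<close>)
  have "?\<phi> y = 0"
    by (rule weak_closure_vanishing[OF y(1)[unfolded module_wstar_topology_def] predual vanish])
  then show ?thesis using y(2) by simp
qed

text \<open>If \<open>j\<close> embeds \<open>l2 I\<close> isometrically at the point \<open>w\<close> and the pairing of \<open>P\<close> with a total set
  factors through the image of \<open>j\<close>, then that image is all of \<open>P\<close> up to vectors that are null at
  \<open>w\<close>: by Riesz the functional \<open>\<xi> \<mapsto> \<langle>\<eta>, j \<xi>\<rangle>\<close> is represented by some \<open>d\<close>, and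
  \<open>\<eta> - j d\<close> is orthogonal to the total set.  Hence the vectors \<open>j (delta i)\<close> satisfy Parseval's
  identity on \<open>P\<close>.\<close>

lemma parseval_at_point:
  assumes w: "w \<in> W"
    and L: "L \<subseteq> carrier X"
    and dense: "module_wstar_topology (linf W) X closure_of lin_span X L = carrier X"
    and P: "P \<subseteq> carrier X" "\<And>x y t. \<lbrakk>x \<in> P; y \<in> P\<rbrakk> \<Longrightarrow> x \<oplus>\<^bsub>X\<^esub> t \<odot>\<^bsub>X\<^esub> y \<in> P"
    and j: "\<And>\<xi>. \<xi> \<in> l2 I \<Longrightarrow> j \<xi> \<in> P"
    and iso: "\<And>\<xi> \<zeta>. \<lbrakk>\<xi> \<in> l2 I; \<zeta> \<in> l2 I\<rbrakk> \<Longrightarrow> rinner X (j \<xi>) (j \<zeta>) w = (\<Sum>\<^sub>\<infinity>i\<in>I. cnj (\<xi> i) * \<zeta> i)"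
    and total: "\<And>l. l \<in> L \<Longrightarrow> \<exists>\<xi>\<in>l2 I. \<forall>\<eta>\<in>P. rinner X \<eta> l w = rinner X \<eta> (j \<xi>) w"
    and \<eta>: "\<eta> \<in> P"
  shows "((\<lambda>i. (cmod (rinner X (j (delta i)) \<eta> w))\<^sup>2) has_sum Re (rinner X \<eta> \<eta> w)) I"
proof -
  interpret l2: function_space "l2 I" by (rule function_space_l2)
  have mem: "\<eta> \<in> carrier X" "\<xi> \<in> l2 I \<Longrightarrow> j \<xi> \<in> carrier X" for \<xi> using \<eta> j P(1) by auto
  define ip where "ip \<xi> \<zeta> = (\<Sum>\<^sub>\<infinity>i\<in>I. cnj (\<xi> i) * (\<zeta> i :: complex))" for \<xi> \<zeta>
  have sm: "(\<lambda>i. cnj (\<xi> i) * \<zeta> i) summable_on I" if "\<xi> \<in> l2 I" "\<zeta> \<in> l2 I" for \<xi> \<zeta>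
    by (rule abs_summable_summable[OF square_summable_product]) (use that in \<open>auto simp: l2_def\<close>)
  have ip_add: "ip \<xi> (\<lambda>i. \<zeta> i + \<zeta>' i) = ip \<xi> \<zeta> + ip \<xi> \<zeta>'" "ip (\<lambda>i. \<zeta> i + \<zeta>' i) \<xi> = ip \<zeta> \<xi> + ip \<zeta>' \<xi>"
    if "\<xi> \<in> l2 I" "\<zeta> \<in> l2 I" "\<zeta>' \<in> l2 I" for \<xi> \<zeta> \<zeta>'
    using that sm by (simp_all add: ip_def distrib_left distrib_right infsum_add)
  have ip_smult: "ip \<xi> (\<lambda>i. t * \<zeta> i) = t * ip \<xi> \<zeta>" "ip (\<lambda>i. t * \<zeta> i) \<xi> = cnj t * ip \<zeta> \<xi>" for \<xi> \<zeta> t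
    by (simp_all add: ip_def mult.left_commute[of _ t] mult.assoc infsum_cmult_right')
  note iso = iso[folded ip_def]
  define g where "g \<xi> = rinner X \<eta> (j \<xi>) w" for \<xi>
  have g_add: "g (\<lambda>i. \<xi> i + \<zeta> i) = g \<xi> + g \<zeta>" if "\<xi> \<in> l2 I" "\<zeta> \<in> l2 I" for \<xi> \<zeta>
  proof -
    have "g (\<lambda>i. \<xi> i + \<zeta> i) = rinner X \<eta> (j \<xi> \<oplus>\<^bsub>X\<^esub> j \<zeta>) w"
      unfolding g_def using that
      by (intro inner_eq_if_null_difference[where c = "ip \<xi> \<xi> + ip \<xi> \<zeta> + (ip \<zeta> \<xi> + ip \<zeta> \<zeta>)"])
        (simp_all add: mem l2.add_mem iso inner_add ip_add)
    then show ?thesis using that by (simp add: g_def inner_add mem)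
  qed
  have g_smult: "g (\<lambda>i. t * \<xi> i) = t * g \<xi>" if "\<xi> \<in> l2 I" for t \<xi>
  proof -
    have "g (\<lambda>i. t * \<xi> i) = rinner X \<eta> (t \<odot>\<^bsub>X\<^esub> j \<xi>) w"
      unfolding g_def using that
      by (intro inner_eq_if_null_difference[where c = "cnj t * (t * ip \<xi> \<xi>)"])
        (simp_all add: mem smult_mem l2.smult_mem iso inner_smult ip_smult)
    then show ?thesis using that by (simp add: g_def inner_smult mem)
  qed
  have ip_self: "ip \<xi> \<xi> = of_real (\<Sum>\<^sub>\<infinity>i\<in>I. (cmod (\<xi> i))\<^sup>2)" if "\<xi> \<in> l2 I" for \<xi>
    using fibre_inner_self[of I "\<lambda>_. ()" \<xi> "()"] by (simp add: fibre_inner_def fibre_def ip_def)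
  have g_bound: "(cmod (g \<xi>))\<^sup>2 \<le> Re (rinner X \<eta> \<eta> w) * (\<Sum>\<^sub>\<infinity>i\<in>I. (cmod (\<xi> i))\<^sup>2)" if "\<xi> \<in> l2 I" for \<xi>
    using cauchy_schwarz[OF mem(1) mem(2)[OF that], of w] that
    by (simp add: g_def iso ip_self)
  define d where "d i = (if i \<in> I then cnj (g (delta i)) else 0)" for i
  have d: "d \<in> l2 I" unfolding d_def
    by (rule riesz_vector_l2[where K = "Re (rinner X \<eta> \<eta> w)"])
      (use g_add g_smult g_bound inner_self(1)[OF mem(1)] in auto)
  have rep: "((\<lambda>i. cnj (d i) * \<xi> i) has_sum g \<xi>) I" if "\<xi> \<in> l2 I" for \<xi>
    unfolding d_def
    by (rule riesz_represents[where K = "Re (rinner X \<eta> \<eta> w)"])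
      (use g_add g_smult g_bound inner_self(1)[OF mem(1)] that in auto)
  have g: "g \<xi> = ip d \<xi>" if "\<xi> \<in> l2 I" for \<xi>
    using rep[OF that] by (simp add: ip_def infsumI)
  let ?\<zeta> = "\<eta> \<oplus>\<^bsub>X\<^esub> (-1) \<odot>\<^bsub>X\<^esub> j d"
  have \<zeta>: "?\<zeta> \<in> P" by (rule P(2)[OF \<eta> j[OF d]])
  have split: "rinner X ?\<zeta> y w = rinner X \<eta> y w - rinner X (j d) y w" if "y \<in> carrier X" for y
    using that d by (simp add: inner_add inner_smult mem smult_mem)
  have "rinner X ?\<zeta> l w = 0" if l: "l \<in> L" for l
  proof -
    obtain \<xi> where \<xi>: "\<xi> \<in> l2 I" "rinner X ?\<zeta> l w = rinner X ?\<zeta> (j \<xi>) w"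
      using total[OF l] \<zeta> by blast
    then show ?thesis using split[OF mem(2)[OF \<xi>(1)]] g[OF \<xi>(1)] iso[OF d \<xi>(1)] by (simp add: g_def)
  qed
  then have "rinner X ?\<zeta> \<eta> w = 0"
    by (rule inner_vanishes_on_closure[OF w subsetD[OF P(1) \<zeta>] L])
      (use mem(1) in \<open>simp_all add: dense\<close>)
  then have "rinner X \<eta> \<eta> w = rinner X (j d) \<eta> w" using split[OF mem(1)] by simp
  also have "\<dots> = cnj (g d)" using inner_cnj[OF mem(1) mem(2)[OF d]] by (simp add: g_def)
  also have "\<dots> = of_real (\<Sum>\<^sub>\<infinity>i\<in>I. (cmod (d i))\<^sup>2)" by (simp add: g[OF d] ip_self[OF d])
  finally have "Re (rinner X \<eta> \<eta> w) = (\<Sum>\<^sub>\<infinity>i\<in>I. (cmod (d i))\<^sup>2)" by simp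
  then have "((\<lambda>i. (cmod (d i))\<^sup>2) has_sum Re (rinner X \<eta> \<eta> w)) I"
    using d by (simp add: l2_def)
  moreover have "cmod (d i) = cmod (rinner X (j (delta i)) \<eta> w)" if "i \<in> I" for i
    using that inner_cnj[OF mem(1) mem(2)[OF l2_delta[OF that]], of w] by (simp add: d_def g_def)
  ultimately show ?thesis by (simp cong: has_sum_cong)
qed

end


section \<open>Equivalence bimodules over \<open>\<ell>\<^sup>\<infinity>\<close>\<close>

locale linf_equivalence_bimodule =
  fixes V :: "'v set" and W :: "'w set"
    and X :: "('w \<Rightarrow> complex, 'x, 'v \<Rightarrow> complex, 'n) bimod_scheme"
  assumes equivalence: "wstar_equivalence_bimodule (linf V) (linf W) X"
begin

sublocale R: linf_module W X
  using equivalence right_wstar_module.axioms(1) unfolding wstar_equivalence_bimodule_def linf_module_def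
  by blast

sublocale L: linf_module V "left_module X"
  using equivalence right_wstar_module.axioms(1)
  unfolding wstar_equivalence_bimodule_def linf_module_def opposite_linf
  by blast

lemma left_simps [simp]:
  "carrier (left_module X) = carrier X" "zero (left_module X) = zero X" "add (left_module X) = add X"
  "smult (left_module X) = smult X" "ract (left_module X) x a = lact X a x"
  "rinner (left_module X) x y = linner X y x"
  by (simp_all add: left_module_def)

lemma lact_mem: "\<lbrakk>a \<in> linf_carrier V; x \<in> carrier X\<rbrakk> \<Longrightarrow> lact X a x \<in> carrier X"
  using L.ract_closed by simp

lemma lact_ract: "\<lbrakk>a \<in> linf_carrier V; x \<in> carrier X; b \<in> linf_carrier W\<rbrakk>
    \<Longrightarrow> ract X (lact X a x) b = lact X a (ract X x b)"
  using equivalence by (simp add: wstar_equivalence_bimodule_def)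

lemma linner_lact_rinner: "\<lbrakk>x \<in> carrier X; y \<in> carrier X; z \<in> carrier X\<rbrakk>
    \<Longrightarrow> lact X (linner X x y) z = ract X x (rinner X y z)"
  using equivalence by (simp add: wstar_equivalence_bimodule_def)

text \<open>A nonzero vector in the corner of the bimodule cut out by \<open>v\<close> and \<open>w\<close>.\<close>

definition link :: "'v \<Rightarrow> 'w \<Rightarrow> 'x \<Rightarrow> bool"
  where "link v w x \<longleftrightarrow> v \<in> V \<and> w \<in> W \<and> x \<in> carrier X \<and> x \<noteq> \<zero>\<^bsub>X\<^esub> \<and>
    lact X (delta v) x = x \<and> ract X x (delta w) = x"

text \<open>A nonzero corner of the bimodule is one-dimensional and exhausts its row and its column: in
  \<open>linner x x \<cdot> z = x \<cdot> rinner x z\<close> the left side is a nonzero multiple of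
  \<open>lact (delta v) z\<close> and the right side is a multiple of \<open>x\<close>.\<close>

lemma link_corner:
  assumes l: "link v w x" and z: "z \<in> carrier X"
  shows link_row: "\<exists>t. lact X (delta v) z = t \<odot>\<^bsub>X\<^esub> x"
    and link_column: "\<exists>t. ract X z (delta w) = t \<odot>\<^bsub>X\<^esub> x"
proof -
  have v: "v \<in> V" and w: "w \<in> W" and x: "x \<in> carrier X" "x \<noteq> \<zero>\<^bsub>X\<^esub>"
    and vx: "lact X (delta v) x = x" and xw: "ract X x (delta w) = x"
    using l by (auto simp: link_def)
  have scalar_right: "ract X x b = b w \<odot>\<^bsub>X\<^esub> x" if "b \<in> linf_carrier W" for b
    using R.ract_delta_ract[OF x(1) that w] by (simp add: xw)
  have scalar_left: "lact X a x = a v \<odot>\<^bsub>X\<^esub> x" if "a \<in> linf_carrier V" for a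
    using L.ract_delta_ract[OF _ that v, of x] x by (simp add: vx)
  define c where "c = linner X x x v"
  have "linner X x x u = c * delta v u" for u
    using L.inner_ract(1)[of x x "delta v" u] x v
    by (cases "u = v") (simp_all add: vx linf_delta c_def delta_same delta_other)
  then have c: "linner X x x = (\<lambda>u. c * delta v u)" by (rule ext)
  have "c \<noteq> 0"
    using L.eq_zero_iff[of x] x c by auto
  have "c \<odot>\<^bsub>X\<^esub> lact X (delta v) z = rinner X x z w \<odot>\<^bsub>X\<^esub> x"
    using linner_lact_rinner[OF x(1) x(1) z] scalar_right[OF R.inner_mem[OF x(1) z]]
      L.ract_smult_right[of z "delta v" c] z v by (simp add: c linf_delta)
  then have "inverse c \<odot>\<^bsub>X\<^esub> (c \<odot>\<^bsub>X\<^esub> lact X (delta v) z) = inverse c \<odot>\<^bsub>X\<^esub> (rinner X x z w \<odot>\<^bsub>X\<^esub> x)"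
    by simp
  then have "lact X (delta v) z = (inverse c * rinner X x z w) \<odot>\<^bsub>X\<^esub> x"
    using \<open>c \<noteq> 0\<close> x z v by (simp add: R.smult_smult lact_mem linf_delta R.one_smult)
  then show "\<exists>t. lact X (delta v) z = t \<odot>\<^bsub>X\<^esub> x" by blast
  define d where "d = rinner X x x w"
  have "rinner X x x u = d * delta w u" for u
    using R.inner_ract(1)[of x x "delta w" u] x w
    by (cases "u = w") (simp_all add: xw linf_delta d_def delta_same delta_other)
  then have d: "rinner X x x = (\<lambda>u. d * delta w u)" by (rule ext)
  have "d \<noteq> 0"
    using R.eq_zero_iff[of x] x d by auto
  have "d \<odot>\<^bsub>X\<^esub> ract X z (delta w) = linner X z x v \<odot>\<^bsub>X\<^esub> x"
    using linner_lact_rinner[OF z x(1) x(1)] scalar_left[of "linner X z x"] L.inner_mem[of x z]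
      R.ract_smult_right[of z "delta w" d] x z w by (simp add: d linf_delta)
  then have "inverse d \<odot>\<^bsub>X\<^esub> (d \<odot>\<^bsub>X\<^esub> ract X z (delta w)) = inverse d \<odot>\<^bsub>X\<^esub> (linner X z x v \<odot>\<^bsub>X\<^esub> x)"
    by simp
  then have "ract X z (delta w) = (inverse d * linner X z x v) \<odot>\<^bsub>X\<^esub> x"
    using \<open>d \<noteq> 0\<close> x z w by (simp add: R.smult_smult R.ract_delta_mem R.one_smult)
  then show "\<exists>t. ract X z (delta w) = t \<odot>\<^bsub>X\<^esub> x" by blast
qed

lemma link_unique:
  assumes "link v w x" "link v' w' x'"
  shows "v = v' \<longleftrightarrow> w = w'"
proof -
  have x: "v \<in> V" "w \<in> W" "x \<in> carrier X" "x \<noteq> \<zero>\<^bsub>X\<^esub>" "lact X (delta v) x = x" "ract X x (delta w) = x"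
    and x': "v' \<in> V" "w' \<in> W" "x' \<in> carrier X" "x' \<noteq> \<zero>\<^bsub>X\<^esub>" "lact X (delta v') x' = x'" "ract X x' (delta w') = x'"
    using assms by (auto simp: link_def)
  show ?thesis
  proof (rule iffI; rule ccontr)
    assume "v = v'" "w \<noteq> w'"
    obtain t where t: "x' = t \<odot>\<^bsub>X\<^esub> x" using link_row[OF assms(1) x'(3)] x'(5) \<open>v = v'\<close> by auto
    have "x' = ract X x' (delta w')" using x' by simp
    also have "\<dots> = t \<odot>\<^bsub>X\<^esub> ract X x (delta w')"
      using R.ract_smult_left[OF x(3), of "delta w'" t] x'(2) by (simp add: t linf_delta)
    also have "ract X x (delta w') = 0 \<odot>\<^bsub>X\<^esub> x"
      using R.ract_delta_ract[OF x(3) linf_delta[OF x'(2)] x(2)] \<open>w \<noteq> w'\<close> by (simp add: x(6) delta_other)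
    finally show False using x x' by (simp add: R.smult_smult R.zero_smult)
  next
    assume "w = w'" "v \<noteq> v'"
    obtain t where t: "x' = t \<odot>\<^bsub>X\<^esub> x" using link_column[OF assms(1) x'(3)] x'(6) \<open>w = w'\<close> by auto
    have "x' = lact X (delta v') x'" using x' by simp
    also have "\<dots> = t \<odot>\<^bsub>X\<^esub> lact X (delta v') x"
      using L.ract_smult_left[of x "delta v'" t] x(3) x'(1) by (simp add: t linf_delta)
    also have "lact X (delta v') x = 0 \<odot>\<^bsub>X\<^esub> x"
      using L.ract_delta_ract[OF _ linf_delta[OF x'(1)] x(1), of x] x(3) \<open>v \<noteq> v'\<close> by (simp add: x(5) delta_other)
    finally show False using x x' by (simp add: R.smult_smult R.zero_smult)
  qed
qed

lemma link_from_corner: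
  assumes "v \<in> V" "w \<in> W" "x \<in> carrier X" "lact X (delta v) (ract X x (delta w)) \<noteq> \<zero>\<^bsub>X\<^esub>"
  shows "link v w (lact X (delta v) (ract X x (delta w)))"
proof -
  have xw: "ract X x (delta w) \<in> carrier X" using assms R.ract_delta_mem by simp
  then show ?thesis
    using assms L.ract_delta_idem[of "ract X x (delta w)" v] R.ract_delta_idem[of x w]
    by (simp add: link_def lact_mem lact_ract linf_delta)
qed

lemma link_exists_right: "v \<in> V \<Longrightarrow> \<exists>w x. link v w x"
proof -
  assume v: "v \<in> V"
  have "wstar_full (linf V) (left_module X)"
    using equivalence by (simp add: wstar_equivalence_bimodule_def opposite_linf)
  then obtain x where x: "x \<in> carrier X" "lact X (delta v) x \<noteq> \<zero>\<^bsub>X\<^esub>"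
    using L.full_imp_ract_delta_nonzero[OF _ v] by auto
  then obtain w where "w \<in> W" "ract X (lact X (delta v) x) (delta w) \<noteq> \<zero>\<^bsub>X\<^esub>"
    using R.exists_ract_delta_nonzero[of "lact X (delta v) x"] v by (auto simp: lact_mem linf_delta)
  then show ?thesis
    using link_from_corner[of v w x] v x by (auto simp: lact_ract linf_delta)
qed

lemma link_exists_left: "w \<in> W \<Longrightarrow> \<exists>v x. link v w x"
proof -
  assume w: "w \<in> W"
  have "wstar_full (linf W) X"
    using equivalence by (simp add: wstar_equivalence_bimodule_def)
  then obtain x where x: "x \<in> carrier X" "ract X x (delta w) \<noteq> \<zero>\<^bsub>X\<^esub>"
    using R.full_imp_ract_delta_nonzero[OF _ w] by auto
  then obtain v where "v \<in> V" "lact X (delta v) (ract X x (delta w)) \<noteq> \<zero>\<^bsub>X\<^esub>"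
    using L.exists_ract_delta_nonzero[of "ract X x (delta w)"] w by (auto simp: R.ract_delta_mem)
  then show ?thesis using link_from_corner[of v w x] w x by auto
qed

lemma link_normalise:
  assumes "link v w x"
  shows "\<exists>y. link v w y \<and> rinner X y y = delta w"
proof -
  have x: "v \<in> V" "w \<in> W" "x \<in> carrier X" "x \<noteq> \<zero>\<^bsub>X\<^esub>" "lact X (delta v) x = x" "ract X x (delta w) = x"
    using assms by (auto simp: link_def)
  define c where "c = Re (rinner X x x w)"
  have c: "rinner X x x w = of_real c" "0 \<le> c" using R.inner_self[OF x(3)] by (auto simp: c_def)
  have "rinner X x x u = of_real c * delta w u" for u
    using R.inner_ract(1)[of x x "delta w" u] x c(1)
    by (cases "u = w") (simp_all add: linf_delta delta_same delta_other)
  then have eq: "rinner X x x = (\<lambda>u. of_real c * delta w u)" by (rule ext)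
  have "c \<noteq> 0" using R.eq_zero_iff[of x] x eq by auto
  then have "c > 0" using c by simp
  let ?t = "complex_of_real (inverse (sqrt c))"
  let ?y = "?t \<odot>\<^bsub>X\<^esub> x"
  have "rinner X ?y ?y u = delta w u" for u
  proof -
    have "rinner X ?y ?y u = of_real (inverse (sqrt c) * (inverse (sqrt c) * c)) * delta w u"
      using x by (simp add: R.inner_smult R.smult_mem eq)
    also have "inverse (sqrt c) * (inverse (sqrt c) * c) = 1"
      using \<open>c > 0\<close> by (simp add: field_simps)
    finally show ?thesis by simp
  qed
  then have inner: "rinner X ?y ?y = delta w" by (rule ext)
  moreover have "link v w ?y"
  proof -
    have "lact X (delta v) ?y = ?y"
      using L.ract_smult_left[of x "delta v" ?t] x by (simp add: linf_delta)
    moreover have "ract X ?y (delta w) = ?y"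
      using R.ract_smult_left[of x "delta w" ?t] x by (simp add: linf_delta)
    moreover have "?y \<noteq> \<zero>\<^bsub>X\<^esub>"
      using R.eq_zero_iff[of ?y] x inner by (auto simp: R.smult_mem delta_def)
    ultimately show ?thesis using x by (simp add: link_def R.smult_mem)
  qed
  ultimately show ?thesis by blast
qed

lemma exists_linking_bijection:
  "\<exists>\<beta> \<xi>. bij_betw \<beta> V W \<and> (\<forall>v\<in>V. link v (\<beta> v) (\<xi> v) \<and> rinner X (\<xi> v) (\<xi> v) = delta (\<beta> v))"
proof -
  have "\<forall>v\<in>V. \<exists>w x. link v w x \<and> rinner X x x = delta w"
    using link_exists_right link_normalise by blast
  then obtain \<beta> \<xi> where \<beta>: "\<forall>v\<in>V. link v (\<beta> v) (\<xi> v) \<and> rinner X (\<xi> v) (\<xi> v) = delta (\<beta> v)"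
    by metis
  have "bij_betw \<beta> V W"
  proof (rule bij_betw_imageI)
    show "inj_on \<beta> V"
    proof (rule inj_onI)
      fix u v assume "u \<in> V" "v \<in> V" "\<beta> u = \<beta> v"
      then show "u = v" using link_unique[of u "\<beta> u" "\<xi> u" v "\<beta> v" "\<xi> v"] \<beta> by blast
    qed
    show "\<beta> ` V = W"
    proof
      show "\<beta> ` V \<subseteq> W" using \<beta> by (auto simp: link_def)
      show "W \<subseteq> \<beta> ` V"
      proof
        fix w assume "w \<in> W"
        then obtain v x where v: "link v w x" using link_exists_left by blast
        then have "v \<in> V" by (simp add: link_def)
        then show "w \<in> \<beta> ` V" using v \<beta> link_unique by blast
      qed
    qed
  qed
  then show ?thesis using \<beta> by blast
qed

end


section \<open>Counting edges\<close>

text \<open>The squared moduli of the transition coefficients between two orthonormal bases form such a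
  matrix.  Summing all entries by rows and by columns shows that it is square.\<close>

lemma doubly_stochastic_card_le:
  fixes c :: "'i \<Rightarrow> 'j \<Rightarrow> real"
  assumes nonneg: "\<And>i j. 0 \<le> c i j"
    and col: "\<And>j. j \<in> J \<Longrightarrow> ((\<lambda>i. c i j) has_sum 1) I"
    and row: "\<And>i. i \<in> I \<Longrightarrow> (c i has_sum 1) J"
    and I: "finite I"
  shows "finite J \<and> card J \<le> card I"
proof (rule ccontr)
  assume "\<not> ?thesis"
  then obtain J' where J': "J' \<subseteq> J" "finite J'" "card J' = Suc (card I)"
    by (metis card.infinite infinite_arbitrarily_large not_less_eq_eq obtain_subset_with_card_n)
  have "real (card J') = (\<Sum>j\<in>J'. \<Sum>i\<in>I. c i j)"
    using has_sum_unique[OF col has_sum_finite[OF I]] J' by (simp add: subset_iff)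
  also have "\<dots> = (\<Sum>i\<in>I. \<Sum>j\<in>J'. c i j)" by (rule sum.swap)
  also have "\<dots> \<le> (\<Sum>i\<in>I. 1)"
  proof (rule sum_mono)
    fix i assume i: "i \<in> I"
    show "(\<Sum>j\<in>J'. c i j) \<le> 1"
      by (rule finite_sum_le_has_sum[OF row[OF i]]) (use J' nonneg in auto)
  qed
  finally show False using J' by simp
qed

lemma doubly_stochastic_bij:
  fixes c :: "'i \<Rightarrow> 'j \<Rightarrow> real"
  assumes nonneg: "\<And>i j. 0 \<le> c i j"
    and col: "\<And>j. j \<in> J \<Longrightarrow> ((\<lambda>i. c i j) has_sum 1) I"
    and row: "\<And>i. i \<in> I \<Longrightarrow> (c i has_sum 1) J"
    and countable: "countable I" "countable J"
  shows "\<exists>f. bij_betw f I J"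
proof -
  have IJ: "finite I \<Longrightarrow> finite J \<and> card J \<le> card I"
    using doubly_stochastic_card_le[of c J I] assms by blast
  have JI: "finite J \<Longrightarrow> finite I \<and> card I \<le> card J"
    using doubly_stochastic_card_le[of "\<lambda>j i. c i j" I J] assms by blast
  show ?thesis
  proof (cases "finite I")
    case True
    then show ?thesis using IJ JI by (intro finite_same_card_bij) auto
  next
    case False
    then have "infinite J" using JI by blast
    have "bij_betw (to_nat_on I) I UNIV" "bij_betw (from_nat_into J) UNIV J"
      using False \<open>infinite J\<close> countable to_nat_on_infinite bij_betw_from_nat_into by auto
    then show ?thesis using bij_betw_trans by blast
  qed
qed

text \<open>Applied with \<open>p\<close> and \<open>q\<close> the endpoint maps of the two graphs, the first one followed by the
  bijection of the vertices.\<close>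

lemma bij_betw_from_fibres:
  assumes fibres: "\<And>k. k \<in> p ` A \<union> q ` B \<Longrightarrow> \<exists>f. bij_betw f {a \<in> A. p a = k} {b \<in> B. q b = k}"
  shows "\<exists>f. bij_betw f A B \<and> (\<forall>a\<in>A. q (f a) = p a)"
proof -
  obtain f where f: "bij_betw (f k) {a \<in> A. p a = k} {b \<in> B. q b = k}" if "k \<in> p ` A \<union> q ` B" for k
    using fibres by metis
  define g where "g a = f (p a) a" for a
  have g: "g a \<in> B" "q (g a) = p a" if "a \<in> A" for a
    using bij_betw_apply[OF f, of "p a" a] that by (auto simp: g_def)
  have "bij_betw g A B"
  proof (rule bij_betw_imageI)
    show "inj_on g A"
    proof (rule inj_onI)
      fix a b assume ab: "a \<in> A" "b \<in> A" "g a = g b"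
      then have "p a = p b" using g by metis
      then show "a = b"
        using bij_betw_imp_inj_on[OF f, of "p a"] ab by (auto simp: g_def inj_on_def)
    qed
    show "g ` A = B"
    proof
      show "B \<subseteq> g ` A"
      proof
        fix b assume b: "b \<in> B"
        then have "b \<in> f (q b) ` {a \<in> A. p a = q b}"
          using bij_betw_imp_surj_on[OF f, of "q b"] by auto
        then obtain a where "a \<in> A" "p a = q b" "b = f (q b) a" by blast
        then show "b \<in> g ` A" by (intro image_eqI[of _ _ a]) (simp_all add: g_def)
      qed
    qed (use g in auto)
  qed
  then show ?thesis using g by blast
qed


section \<open>Morita equivalent graph correspondences have isomorphic graphs\<close>

lemma infsum_delta_square:
  assumes "k \<in> A"
  shows "(\<Sum>\<^sub>\<infinity>i\<in>A. cnj (delta k i) * delta k i) = 1"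
proof -
  have "(\<Sum>\<^sub>\<infinity>i\<in>A. cnj (delta k i) * delta k i) = (\<Sum>\<^sub>\<infinity>i\<in>{k}. 1)"
    using assms by (intro infsum_cong_neutral) (auto simp: delta_def)
  then show ?thesis by simp
qed

lemma restrict_fibre_l2:
  assumes x: "x \<in> fibre_l2 I s W" and A: "A \<subseteq> fibre I s w" "w \<in> W"
  shows "(\<lambda>i. if i \<in> A then t * x i else 0) \<in> l2 A"
proof -
  have "(\<lambda>i. (cmod (x i))\<^sup>2) summable_on A"
    using x A summable_on_subset_banach by (fastforce simp: fibre_l2_def)
  then have "(\<lambda>i. (cmod t)\<^sup>2 * (cmod (x i))\<^sup>2) summable_on A" by (rule summable_on_cmult_right)
  then have "(\<lambda>i. (cmod (if i \<in> A then t * x i else 0))\<^sup>2) summable_on A"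
    by (rule summable_on_cong[THEN iffD1, rotated]) (simp add: norm_mult power_mult_distrib)
  then show ?thesis by (simp add: l2_def)
qed

context linf_equivalence_bimodule
begin

text \<open>Over \<open>w\<close> the left action of \<open>a\<close> is multiplication by the number \<open>a u\<close>.\<close>

lemma corner_inner:
  assumes link: "link u w x" "rinner X x x = delta w"
    and y: "y \<in> carrier X" "ract X y (delta w) = t \<odot>\<^bsub>X\<^esub> x"
    and y': "y' \<in> carrier X" "ract X y' (delta w) = t' \<odot>\<^bsub>X\<^esub> x"
    and a: "a \<in> linf_carrier V"
  shows "rinner X y (lact X a y') w = cnj t * t' * a u"
proof -
  have u: "u \<in> V" and w: "w \<in> W" and x: "x \<in> carrier X" and ux: "lact X (delta u) x = x"
    using link by (auto simp: link_def)
  have ax: "lact X a x = a u \<odot>\<^bsub>X\<^esub> x"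
    using L.ract_delta_ract[OF _ a u, of x] x by (simp add: ux)
  have "ract X (lact X a y') (delta w) = lact X a (t' \<odot>\<^bsub>X\<^esub> x)"
    using lact_ract[OF a y'(1) linf_delta[OF w]] y'(2) by simp
  also have "\<dots> = (t' * a u) \<odot>\<^bsub>X\<^esub> x"
    using L.ract_smult_left[of x a t'] x a by (simp add: ax R.smult_smult)
  finally have ay': "ract X (lact X a y') (delta w) = (t' * a u) \<odot>\<^bsub>X\<^esub> x" .
  have ay'_mem: "lact X a y' \<in> carrier X" using a y' by (simp add: lact_mem)
  have "rinner X y (lact X a y') w
      = rinner X (ract X y (delta w)) (ract X (lact X a y') (delta w)) w"
    using y(1) ay'_mem w R.ract_delta_mem
    by (simp add: R.inner_ract linf_delta delta_same)
  also have "\<dots> = cnj t * t' * a u"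
    using x link(2) by (simp add: y(2) ay' R.inner_smult R.smult_mem delta_same)
  finally show ?thesis .
qed

lemma left_tensor_inner:
  assumes link: "link u w x" "rinner X x x = delta w"
    and E: "fibred_correspondence I s V E r V"
    and T: "wstar_tensor (linf V) (linf V) (linf W) E X T \<sigma>"
    and \<xi>: "\<xi> \<in> carrier E" and \<zeta>: "\<zeta> \<in> carrier E"
    and y: "y \<in> carrier X" "ract X y (delta w) = t \<odot>\<^bsub>X\<^esub> x"
    and y': "y' \<in> carrier X" "ract X y' (delta w) = t' \<odot>\<^bsub>X\<^esub> x"
  shows "rinner T (\<sigma> \<xi> y) (\<sigma> \<zeta> y') w = (\<Sum>\<^sub>\<infinity>i\<in>fibre I s u. cnj (t * \<xi> i) * (t' * \<zeta> i))"
proof -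
  interpret E: fibred_correspondence I s V E r V by fact
  have "rinner T (\<sigma> \<xi> y) (\<sigma> \<zeta> y') w = rinner X y (lact X (rinner E \<xi> \<zeta>) y') w"
    using T \<xi> \<zeta> y(1) y'(1) by (simp add: wstar_tensor_def)
  also have "\<dots> = cnj t * t' * rinner E \<xi> \<zeta> u"
    by (rule corner_inner[OF link y y' E.rinner_mem[OF \<xi> \<zeta>]])
  also have "\<dots> = (\<Sum>\<^sub>\<infinity>i\<in>fibre I s u. cnj t * t' * (cnj (\<xi> i) * \<zeta> i))"
    by (simp add: E.rinner_X fibre_inner_def infsum_cmult_right')
  finally show ?thesis by (simp add: mult_ac)
qed

lemma right_tensor_inner:
  assumes link: "link v w x" "rinner X x x = delta w"
    and D: "fibred_correspondence I s W D r W"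
    and S: "wstar_tensor (linf V) (linf W) (linf W) X D S \<tau>"
    and \<xi>: "\<xi> \<in> carrier D" and \<zeta>: "\<zeta> \<in> carrier D"
  shows "rinner S (\<tau> (t \<odot>\<^bsub>X\<^esub> x) \<xi>) (\<tau> (t' \<odot>\<^bsub>X\<^esub> x) \<zeta>) w'
    = (\<Sum>\<^sub>\<infinity>i\<in>fibre I s w'. delta w (r i) * (cnj (t * \<xi> i) * (t' * \<zeta> i)))"
proof -
  interpret D: fibred_correspondence I s W D r W by fact
  have x: "x \<in> carrier X" using link by (simp add: link_def)
  have "rinner S (\<tau> (t \<odot>\<^bsub>X\<^esub> x) \<xi>) (\<tau> (t' \<odot>\<^bsub>X\<^esub> x) \<zeta>) w'
      = rinner D \<xi> (lact D (rinner X (t \<odot>\<^bsub>X\<^esub> x) (t' \<odot>\<^bsub>X\<^esub> x)) \<zeta>) w'"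
    using S \<xi> \<zeta> R.smult_mem[OF x] by (simp add: wstar_tensor_def)
  also have "\<dots> = (\<Sum>\<^sub>\<infinity>i\<in>fibre I s w'. delta w (r i) * (cnj (t * \<xi> i) * (t' * \<zeta> i)))"
    using x by (simp add: D.rinner_X D.lact_X fibre_inner_def R.inner_smult R.smult_mem link mult_ac)
  finally show ?thesis .
qed

end

text \<open>The form in which \<open>parseval_at_point\<close> applies to a corner of a tensor product: an elementary
  tensor, projected to the corner over \<open>v\<close>, need only differ from a vector \<open>j \<xi>\<close> by a null vector.\<close>

lemma corner_parseval:
  assumes T: "wstar_correspondence (linf V) (linf W) T" and v: "v \<in> V" and w: "w \<in> W"
    and L: "L \<subseteq> carrier T"
    and dense: "module_wstar_topology (linf W) T closure_of lin_span T L = carrier T"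
    and j: "\<And>\<xi>. \<xi> \<in> l2 A \<Longrightarrow> j \<xi> \<in> carrier T \<and> lact T (delta v) (j \<xi>) = j \<xi>"
    and iso: "\<And>\<xi> \<zeta>. \<lbrakk>\<xi> \<in> l2 A; \<zeta> \<in> l2 A\<rbrakk> \<Longrightarrow> rinner T (j \<xi>) (j \<zeta>) w = (\<Sum>\<^sub>\<infinity>i\<in>A. cnj (\<xi> i) * \<zeta> i)"
    and total: "\<And>l. l \<in> L \<Longrightarrow> \<exists>\<xi>\<in>l2 A. \<forall>z\<in>{lact T (delta v) l, j \<xi>}.
      rinner T (lact T (delta v) l) z w = (\<Sum>\<^sub>\<infinity>i\<in>A. cnj (\<xi> i) * \<xi> i)"
    and \<eta>: "\<eta> \<in> carrier T" "lact T (delta v) \<eta> = \<eta>"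
  shows "((\<lambda>i. (cmod (rinner T (j (delta i)) \<eta> w))\<^sup>2) has_sum Re (rinner T \<eta> \<eta> w)) A"
proof -
  interpret T: wstar_correspondence "linf V" "linf W" T by (rule T)
  interpret T: linf_module W T by unfold_locales
  let ?v = "lact T (delta v)"
  \<comment> \<open>Stated through the pairing, the corner is visibly closed under linear combinations.\<close>
  let ?P = "{\<eta> \<in> carrier T. \<forall>l\<in>carrier T. rinner T \<eta> l w = rinner T \<eta> (?v l) w}"
  have v_mem: "?v l \<in> carrier T" if "l \<in> carrier T" for l
    using T.lact_adjointable[of "delta v"] v that by (auto simp: linf_delta adjointable_def)
  have "star (linf V) (delta v) = delta v" by (auto simp: delta_def)
  then have P: "\<eta> \<in> ?P" if "\<eta> \<in> carrier T" "?v \<eta> = \<eta>" for \<eta>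
    using T.lact_star[of "delta v" \<eta>] that v by (auto simp: linf_delta)
  show ?thesis
  proof (rule T.parseval_at_point[where P = ?P, OF w L dense])
    show "?P \<subseteq> carrier T" by auto
    show "y \<oplus>\<^bsub>T\<^esub> t \<odot>\<^bsub>T\<^esub> z \<in> ?P" if "y \<in> ?P" "z \<in> ?P" for y z t
      using that by (auto simp: T.inner_add T.inner_smult T.smult_mem v_mem)
    show "j \<xi> \<in> ?P" if "\<xi> \<in> l2 A" for \<xi> using P j[OF that] by blast
    show "\<eta> \<in> ?P" by (rule P[OF \<eta>])
    show "\<exists>\<xi>\<in>l2 A. \<forall>\<eta>\<in>?P. rinner T \<eta> l w = rinner T \<eta> (j \<xi>) w" if l: "l \<in> L" for l
    proof -
      obtain \<xi> where \<xi>: "\<xi> \<in> l2 A"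
        "rinner T (?v l) (?v l) w = (\<Sum>\<^sub>\<infinity>i\<in>A. cnj (\<xi> i) * \<xi> i)"
        "rinner T (?v l) (j \<xi>) w = (\<Sum>\<^sub>\<infinity>i\<in>A. cnj (\<xi> i) * \<xi> i)"
        using total[OF l] by auto
      have "rinner T \<eta>' l w = rinner T \<eta>' (j \<xi>) w" if "\<eta>' \<in> ?P" for \<eta>'
      proof -
        have l': "l \<in> carrier T" and \<eta>': "\<eta>' \<in> carrier T" using that l L by auto
        have "rinner T \<eta>' (?v l) w = rinner T \<eta>' (j \<xi>) w"
          using j[OF \<xi>(1)]
          by (intro T.inner_eq_if_null_difference[OF v_mem[OF l'] _ \<eta>' \<xi>(2,3) iso[OF \<xi>(1) \<xi>(1)]]) simp
        then show ?thesis using that l' by simp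
      qed
      then show ?thesis using \<xi>(1) by blast
    qed
  qed (rule iso)
qed

context linf_equivalence_bimodule
begin

text \<open>The corner of the tensor product \<open>E \<otimes> X\<close> over \<open>v\<close>, paired at the point \<open>w\<close> linked to \<open>u\<close>,
  is \<open>\<ell>\<^sup>2\<close> of the edges with source \<open>u\<close> and range \<open>v\<close>, because the fibre of \<open>X\<close> over \<open>w\<close> is
  spanned by the unit vector \<open>x\<close>.\<close>

lemma left_tensor_corner:
  assumes link: "link u w x" "rinner X x x = delta w" and v: "v \<in> V"
    and E: "fibred_correspondence I s V E r V"
    and T: "wstar_tensor (linf V) (linf V) (linf W) E X T \<sigma>"
  defines "A \<equiv> {i \<in> I. s i = u \<and> r i = v}"
  shows "\<xi> \<in> l2 A \<Longrightarrow> \<sigma> \<xi> x \<in> carrier T \<and> lact T (delta v) (\<sigma> \<xi> x) = \<sigma> \<xi> x"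
    and "\<lbrakk>\<xi> \<in> l2 A; \<zeta> \<in> l2 A\<rbrakk>
      \<Longrightarrow> rinner T (\<sigma> \<xi> x) (\<sigma> \<zeta> x) w = (\<Sum>\<^sub>\<infinity>i\<in>A. cnj (\<xi> i) * \<zeta> i)"
    and "\<lbrakk>\<eta> \<in> carrier T; lact T (delta v) \<eta> = \<eta>\<rbrakk>
      \<Longrightarrow> ((\<lambda>i. (cmod (rinner T (\<sigma> (delta i) x) \<eta> w))\<^sup>2) has_sum Re (rinner T \<eta> \<eta> w)) A"
proof -
  interpret E: fibred_correspondence I s V E r V by fact
  have u: "u \<in> V" and w: "w \<in> W" and x: "x \<in> carrier X" "ract X x (delta w) = 1 \<odot>\<^bsub>X\<^esub> x"
    using link R.one_smult by (auto simp: link_def)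
  have A: "A \<subseteq> fibre I s u" by (auto simp: A_def fibre_def)
  have l2: "\<xi> \<in> carrier E" if "\<xi> \<in> l2 A" for \<xi>
    using that l2_subset_fibre_l2[of A I s V] by (auto simp: E.carrier_fun A_def)
  have \<sigma>_mem: "\<sigma> y z \<in> carrier T" if "y \<in> carrier E" "z \<in> carrier X" for y z
    using T that by (simp add: wstar_tensor_def)
  have \<sigma>_lact: "lact T (delta v) (\<sigma> y z) = \<sigma> (lact E (delta v) y) z"
    if "y \<in> carrier E" "z \<in> carrier X" for y z
    using T that v by (simp add: wstar_tensor_def linf_delta)
  have supported: "lact E (delta v) \<xi> = \<xi>" if "\<xi> \<in> l2 A" for \<xi>
    using that by (auto simp: E.lact_X l2_def A_def delta_def fun_eq_iff)
  show vector: "\<sigma> \<xi> x \<in> carrier T \<and> lact T (delta v) (\<sigma> \<xi> x) = \<sigma> \<xi> x" if "\<xi> \<in> l2 A" for \<xi>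
    using \<sigma>_mem[OF l2[OF that] x(1)] \<sigma>_lact[OF l2[OF that] x(1)] supported[OF that] by simp
  show iso: "rinner T (\<sigma> \<xi> x) (\<sigma> \<zeta> x) w = (\<Sum>\<^sub>\<infinity>i\<in>A. cnj (\<xi> i) * \<zeta> i)"
    if "\<xi> \<in> l2 A" "\<zeta> \<in> l2 A" for \<xi> \<zeta>
    unfolding left_tensor_inner[OF link E T l2[OF that(1)] l2[OF that(2)] x x]
    by (rule infsum_cong_neutral) (use that A in \<open>auto simp: l2_def\<close>)
  show "((\<lambda>i. (cmod (rinner T (\<sigma> (delta i) x) \<eta> w))\<^sup>2) has_sum Re (rinner T \<eta> \<eta> w)) A"
    if \<eta>: "\<eta> \<in> carrier T" "lact T (delta v) \<eta> = \<eta>"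
  proof (rule corner_parseval[where V = V and L = "{\<sigma> y z | y z. y \<in> carrier E \<and> z \<in> carrier X}"
        and j = "\<lambda>\<xi>. \<sigma> \<xi> x", OF _ v w _ _ vector iso _ \<eta>])
    fix l assume "l \<in> {\<sigma> y z | y z. y \<in> carrier E \<and> z \<in> carrier X}"
    then obtain y z where l: "l = \<sigma> y z" and y: "y \<in> carrier E" and z: "z \<in> carrier X" by blast
    obtain t where t: "ract X z (delta w) = t \<odot>\<^bsub>X\<^esub> x" using link_column[OF link(1) z] by blast
    let ?y = "lact E (delta v) y" and ?\<xi> = "\<lambda>i. if i \<in> A then t * y i else 0"
    have y': "?y \<in> carrier E" using E.lact_mem[OF linf_delta[OF v] y] by (simp add: E.lact_X)
    have \<xi>: "?\<xi> \<in> l2 A" using restrict_fibre_l2[OF _ A u] y by (simp add: E.carrier_fun)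
    let ?c = "\<Sum>\<^sub>\<infinity>i\<in>A. cnj (?\<xi> i) * ?\<xi> i"
    have "rinner T (\<sigma> ?y z) (\<sigma> ?y z) w = ?c"
      unfolding left_tensor_inner[OF link E T y' y' z t z t]
      by (rule infsum_cong_neutral) (use A in \<open>auto simp: E.lact_X A_def fibre_def delta_def\<close>)
    moreover have "rinner T (\<sigma> ?y z) (\<sigma> ?\<xi> x) w = ?c"
      unfolding left_tensor_inner[OF link E T y' l2[OF \<xi>] z t x]
      by (rule infsum_cong_neutral) (use A in \<open>auto simp: E.lact_X A_def fibre_def delta_def\<close>)
    ultimately show "\<exists>\<xi>\<in>l2 A. \<forall>l'\<in>{lact T (delta v) l, \<sigma> \<xi> x}.
        rinner T (lact T (delta v) l) l' w = (\<Sum>\<^sub>\<infinity>i\<in>A. cnj (\<xi> i) * \<xi> i)"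
      unfolding l \<sigma>_lact[OF y z] using \<xi> by (intro bexI[of _ ?\<xi>]) auto
  qed (use T \<sigma>_mem in \<open>auto simp: wstar_tensor_def\<close>)
qed

text \<open>The mirror image: the corner of \<open>X \<otimes> D\<close> over \<open>v\<close>, paired at \<open>w'\<close>, is \<open>\<ell>\<^sup>2\<close> of the edges with
  source \<open>w'\<close> and range \<open>w\<close>, because the row of \<open>v\<close> in \<open>X\<close> is spanned by the unit vector \<open>x\<close>, which
  sits over \<open>w\<close>.\<close>

lemma right_tensor_corner:
  assumes link: "link v w x" "rinner X x x = delta w" and w': "w' \<in> W"
    and D: "fibred_correspondence I s W D r W"
    and S: "wstar_tensor (linf V) (linf W) (linf W) X D S \<tau>"
  defines "A \<equiv> {i \<in> I. s i = w' \<and> r i = w}"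
  shows "\<xi> \<in> l2 A \<Longrightarrow> \<tau> x \<xi> \<in> carrier S \<and> lact S (delta v) (\<tau> x \<xi>) = \<tau> x \<xi>"
    and "\<lbrakk>\<xi> \<in> l2 A; \<zeta> \<in> l2 A\<rbrakk>
      \<Longrightarrow> rinner S (\<tau> x \<xi>) (\<tau> x \<zeta>) w' = (\<Sum>\<^sub>\<infinity>i\<in>A. cnj (\<xi> i) * \<zeta> i)"
    and "\<lbrakk>\<eta> \<in> carrier S; lact S (delta v) \<eta> = \<eta>\<rbrakk>
      \<Longrightarrow> ((\<lambda>i. (cmod (rinner S (\<tau> x (delta i)) \<eta> w'))\<^sup>2) has_sum Re (rinner S \<eta> \<eta> w')) A"
proof -
  interpret D: fibred_correspondence I s W D r W by fact
  have v: "v \<in> V" and x: "x \<in> carrier X" and vx: "lact X (delta v) x = x"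
    using link by (auto simp: link_def)
  have A: "A \<subseteq> fibre I s w'" by (auto simp: A_def fibre_def)
  have l2: "\<xi> \<in> carrier D" if "\<xi> \<in> l2 A" for \<xi>
    using that l2_subset_fibre_l2[of A I s W] by (auto simp: D.carrier_fun A_def)
  have \<tau>_mem: "\<tau> z y \<in> carrier S" if "z \<in> carrier X" "y \<in> carrier D" for y z
    using S that by (simp add: wstar_tensor_def)
  have \<tau>_lact: "lact S (delta v) (\<tau> z y) = \<tau> (lact X (delta v) z) y"
    if "z \<in> carrier X" "y \<in> carrier D" for y z
    using S that v by (simp add: wstar_tensor_def linf_delta)
  show vector: "\<tau> x \<xi> \<in> carrier S \<and> lact S (delta v) (\<tau> x \<xi>) = \<tau> x \<xi>" if "\<xi> \<in> l2 A" for \<xi>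
    using \<tau>_mem[OF x l2[OF that]] \<tau>_lact[OF x l2[OF that]] vx by simp
  note inner = right_tensor_inner[OF link D S, of _ _ _ 1, unfolded R.one_smult[OF x]]
  show iso: "rinner S (\<tau> x \<xi>) (\<tau> x \<zeta>) w' = (\<Sum>\<^sub>\<infinity>i\<in>A. cnj (\<xi> i) * \<zeta> i)"
    if "\<xi> \<in> l2 A" "\<zeta> \<in> l2 A" for \<xi> \<zeta>
    unfolding inner[OF l2[OF that(1)] l2[OF that(2)], of 1, unfolded R.one_smult[OF x]]
    by (rule infsum_cong_neutral) (use that A in \<open>auto simp: l2_def A_def delta_def\<close>)
  show "((\<lambda>i. (cmod (rinner S (\<tau> x (delta i)) \<eta> w'))\<^sup>2) has_sum Re (rinner S \<eta> \<eta> w')) A"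
    if \<eta>: "\<eta> \<in> carrier S" "lact S (delta v) \<eta> = \<eta>"
  proof (rule corner_parseval[where V = V and L = "{\<tau> z y | z y. z \<in> carrier X \<and> y \<in> carrier D}"
        and j = "\<lambda>\<xi>. \<tau> x \<xi>", OF _ v w' _ _ vector iso _ \<eta>])
    fix l assume "l \<in> {\<tau> z y | z y. z \<in> carrier X \<and> y \<in> carrier D}"
    then obtain y z where l: "l = \<tau> z y" and y: "y \<in> carrier D" and z: "z \<in> carrier X" by blast
    obtain t where t: "lact X (delta v) z = t \<odot>\<^bsub>X\<^esub> x" using link_row[OF link(1) z] by blast
    let ?\<xi> = "\<lambda>i. if i \<in> A then t * y i else 0"
    have \<xi>: "?\<xi> \<in> l2 A" using restrict_fibre_l2[OF _ A w'] y by (simp add: D.carrier_fun)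
    let ?c = "\<Sum>\<^sub>\<infinity>i\<in>A. cnj (?\<xi> i) * ?\<xi> i"
    have "rinner S (\<tau> (t \<odot>\<^bsub>X\<^esub> x) y) (\<tau> (t \<odot>\<^bsub>X\<^esub> x) y) w' = ?c"
      unfolding right_tensor_inner[OF link D S y y]
      by (rule infsum_cong_neutral) (use A in \<open>auto simp: A_def fibre_def delta_def\<close>)
    moreover have "rinner S (\<tau> (t \<odot>\<^bsub>X\<^esub> x) y) (\<tau> x ?\<xi>) w' = ?c"
      unfolding inner[OF y l2[OF \<xi>]]
      by (rule infsum_cong_neutral) (use A in \<open>auto simp: A_def fibre_def delta_def\<close>)
    ultimately show "\<exists>\<xi>\<in>l2 A. \<forall>l'\<in>{lact S (delta v) l, \<tau> x \<xi>}.
        rinner S (lact S (delta v) l) l' w' = (\<Sum>\<^sub>\<infinity>i\<in>A. cnj (\<xi> i) * \<xi> i)"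
      unfolding l \<tau>_lact[OF z y] t using \<xi> by (intro bexI[of _ ?\<xi>]) auto
  qed (use S \<tau>_mem in \<open>auto simp: wstar_tensor_def\<close>)
qed

end

lemma morita_equivalent_imp_graph_isomorphic:
  fixes G :: "('v, 'e) pre_digraph" and F :: "('w, 'f) pre_digraph"
  assumes wf: "wf_digraph G" "wf_digraph F"
    and countable: "countable (arcs G)" "countable (arcs F)"
    and morita: "morita_equivalent TYPE('x) (linf (verts G)) (linf (verts F))
      (graph_correspondence G) (graph_correspondence F)"
  shows "graph_isomorphic G F"
proof -
  interpret G: wf_digraph G by fact
  interpret F: wf_digraph F by fact
  let ?V = "verts G" and ?W = "verts F"
  obtain X :: "('w \<Rightarrow> complex, 'x, 'v \<Rightarrow> complex) bimod"
    and S :: "('w \<Rightarrow> complex, 'x, 'v \<Rightarrow> complex) correspondence" and \<tau>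
    and T :: "('w \<Rightarrow> complex, 'x, 'v \<Rightarrow> complex) correspondence" and \<sigma> \<Phi>
    where X: "wstar_equivalence_bimodule (linf ?V) (linf ?W) X"
      and S: "wstar_tensor (linf ?V) (linf ?W) (linf ?W) X (graph_correspondence F) S \<tau>"
      and T: "wstar_tensor (linf ?V) (linf ?V) (linf ?W) (graph_correspondence G) X T \<sigma>"
      and \<Phi>: "correspondence_iso (linf ?V) (linf ?W) S T \<Phi>"
    using morita unfolding morita_equivalent_def by blast
  interpret linf_equivalence_bimodule ?V ?W X by unfold_locales (rule X)
  obtain \<beta> \<xi> where \<beta>: "bij_betw \<beta> ?V ?W"
    and link: "\<And>v. v \<in> ?V \<Longrightarrow> link v (\<beta> v) (\<xi> v)"
    and unit: "\<And>v. v \<in> ?V \<Longrightarrow> rinner X (\<xi> v) (\<xi> v) = delta (\<beta> v)"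
    using exists_linking_bijection by blast
  have \<beta>_mem: "\<beta> v \<in> ?W" if "v \<in> ?V" for v using bij_betw_apply[OF \<beta> that] .
  note E = fibred_correspondence_graph[OF wf(1)] and D = fibred_correspondence_graph[OF wf(2)]
  have \<Phi>_bij: "bij_betw \<Phi> (carrier S) (carrier T)"
    and \<Phi>_lact: "\<And>a x. \<lbrakk>a \<in> linf_carrier ?V; x \<in> carrier S\<rbrakk> \<Longrightarrow> \<Phi> (lact S a x) = lact T a (\<Phi> x)"
    and \<Phi>_inner: "\<And>x y. \<lbrakk>x \<in> carrier S; y \<in> carrier S\<rbrakk> \<Longrightarrow> rinner T (\<Phi> x) (\<Phi> y) = rinner S x y"
    using \<Phi> by (auto simp: correspondence_iso_def)
  interpret Tm: linf_module ?W T
    using T by (auto simp: wstar_tensor_def wstar_correspondence_def right_wstar_module_def linf_module_def)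
  have edges: "\<exists>f. bij_betw f {e \<in> arcs G. tail G e = u \<and> head G e = v}
      {f \<in> arcs F. tail F f = \<beta> u \<and> head F f = \<beta> v}" (is "\<exists>f. bij_betw f ?I ?J")
    if u: "u \<in> ?V" and v: "v \<in> ?V" for u v
  proof -
    let ?t = "\<lambda>e. \<sigma> (delta e) (\<xi> u)" and ?s = "\<lambda>f. \<tau> (\<xi> v) (delta f)"
    note corner_t = left_tensor_corner[OF link[OF u] unit[OF u] v E T]
      and corner_s = right_tensor_corner[OF link[OF v] unit[OF v] \<beta>_mem[OF u] D S]
    have s: "?s f \<in> carrier S" "lact S (delta v) (?s f) = ?s f" "rinner S (?s f) (?s f) (\<beta> u) = 1"
      if "f \<in> ?J" for f
      using corner_s(1)[OF l2_delta[OF that]] corner_s(2)[OF l2_delta[OF that] l2_delta[OF that]]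
      by (simp_all add: infsum_delta_square[OF that])
    have t: "?t e \<in> carrier T" "lact T (delta v) (?t e) = ?t e" "rinner T (?t e) (?t e) (\<beta> u) = 1"
      if "e \<in> ?I" for e
      using corner_t(1)[OF l2_delta[OF that]] corner_t(2)[OF l2_delta[OF that] l2_delta[OF that]]
      by (simp_all add: infsum_delta_square[OF that])
    let ?c = "\<lambda>e f. (cmod (rinner T (?t e) (\<Phi> (?s f)) (\<beta> u)))\<^sup>2"
    show ?thesis
    proof (rule doubly_stochastic_bij)
      show "countable ?I" "countable ?J" using countable by auto
      show "0 \<le> ?c e f" for e f by simp
      show "((\<lambda>e. ?c e f) has_sum 1) ?I" if f: "f \<in> ?J" for f
      proof -
        have "\<Phi> (?s f) \<in> carrier T" using bij_betw_apply[OF \<Phi>_bij s(1)[OF f]] .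
        moreover have "lact T (delta v) (\<Phi> (?s f)) = \<Phi> (?s f)"
          using \<Phi>_lact[OF linf_delta[OF v] s(1)[OF f]] s(2)[OF f] by simp
        ultimately have "((\<lambda>e. ?c e f) has_sum Re (rinner T (\<Phi> (?s f)) (\<Phi> (?s f)) (\<beta> u))) ?I"
          by (rule corner_t(3))
        then show ?thesis using \<Phi>_inner[OF s(1) s(1)] s(3) f by simp
      qed
      show "(?c e has_sum 1) ?J" if e: "e \<in> ?I" for e
      proof -
        obtain y where y: "y \<in> carrier S" "\<Phi> y = ?t e"
          using bij_betw_imp_surj_on[OF \<Phi>_bij] t(1)[OF e] by (metis imageE)
        interpret C: wstar_correspondence "linf ?V" "linf ?W" S using S by (simp add: wstar_tensor_def)
        have vy: "lact S (delta v) y \<in> carrier S"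
          using C.lact_adjointable[of "delta v"] v y by (auto simp: linf_delta adjointable_def)
        have "\<Phi> (lact S (delta v) y) = \<Phi> y"
          using \<Phi>_lact[OF linf_delta[OF v] y(1)] y(2) t(2)[OF e] by simp
        then have "lact S (delta v) y = y"
          using bij_betw_imp_inj_on[OF \<Phi>_bij] vy y(1) by (auto dest: inj_onD)
        then have "((\<lambda>f. (cmod (rinner S (?s f) y (\<beta> u)))\<^sup>2) has_sum Re (rinner S y y (\<beta> u))) ?J"
          by (rule corner_s(3)[OF y(1)])
        moreover have "rinner S y y (\<beta> u) = 1"
          using \<Phi>_inner[OF y(1) y(1)] t(3)[OF e] y(2) by simp
        moreover have eq: "cmod (rinner S (?s f) y (\<beta> u)) = cmod (rinner T (?t e) (\<Phi> (?s f)) (\<beta> u))"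
          if f: "f \<in> ?J" for f
          using \<Phi>_inner[OF s(1)[OF f] y(1)] y(2)
            Tm.inner_cnj[OF t(1)[OF e] bij_betw_apply[OF \<Phi>_bij s(1)[OF f]], of "\<beta> u"] by simp
        ultimately have "((\<lambda>f. (cmod (rinner S (?s f) y (\<beta> u)))\<^sup>2) has_sum 1) ?J" by simp
        then show ?thesis
          by (rule has_sum_cong[THEN iffD1, rotated]) (simp only: eq)
      qed
    qed
  qed
  obtain \<alpha> where \<alpha>: "bij_betw \<alpha> (arcs G) (arcs F)"
    and ends: "\<forall>e\<in>arcs G. (tail F (\<alpha> e), head F (\<alpha> e)) = (\<beta> (tail G e), \<beta> (head G e))"
  proof -
    let ?p = "\<lambda>e. (\<beta> (tail G e), \<beta> (head G e))" and ?q = "\<lambda>f. (tail F f, head F f)"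
    have "\<exists>f. bij_betw f {e \<in> arcs G. ?p e = k} {f \<in> arcs F. ?q f = k}"
      if "k \<in> ?p ` arcs G \<union> ?q ` arcs F" for k
    proof -
      have "k \<in> ?W \<times> ?W" using that \<beta>_mem by auto
      then have "k \<in> \<beta> ` ?V \<times> \<beta> ` ?V" using bij_betw_imp_surj_on[OF \<beta>] by simp
      then obtain u v where uv: "u \<in> ?V" "v \<in> ?V" "k = (\<beta> u, \<beta> v)" by auto
      have "\<beta> x = \<beta> y \<longleftrightarrow> x = y" if "x \<in> ?V" "y \<in> ?V" for x y
        using bij_betw_imp_inj_on[OF \<beta>] that by (auto simp: inj_on_def)
      then have "{e \<in> arcs G. ?p e = k} = {e \<in> arcs G. tail G e = u \<and> head G e = v}"
        using uv by auto
      then show ?thesis using edges[OF uv(1,2)] uv(3) by simp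
    qed
    from bij_betw_from_fibres[OF this] show ?thesis using that by blast
  qed
  show ?thesis unfolding graph_isomorphic_def using \<alpha> \<beta> ends by blast
qed

theorem corollary4p13:
  fixes G :: "('v, 'e) pre_digraph" and F :: "('w, 'f) pre_digraph"
  assumes "wf_digraph G" "countable (verts G)" "countable (arcs G)"
    and "wf_digraph F" "countable (verts F)" "countable (arcs F)"
  shows "(morita_equivalent TYPE(nat \<Rightarrow> complex) (linf (verts G)) (linf (verts F))
            (graph_correspondence G) (graph_correspondence F) \<longleftrightarrow> graph_isomorphic G F)
       \<and> (morita_equivalent TYPE('x) (linf (verts G)) (linf (verts F))
            (graph_correspondence G) (graph_correspondence F) \<longrightarrow> graph_isomorphic G F)"
proof (intro conjI iffI impI)
  show "graph_isomorphic G F"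
    if "morita_equivalent TYPE(nat \<Rightarrow> complex) (linf (verts G)) (linf (verts F))
      (graph_correspondence G) (graph_correspondence F)"
    by (rule morita_equivalent_imp_graph_isomorphic[OF assms(1,4,3,6) that])
  show "graph_isomorphic G F"
    if "morita_equivalent TYPE('x) (linf (verts G)) (linf (verts F))
      (graph_correspondence G) (graph_correspondence F)"
    by (rule morita_equivalent_imp_graph_isomorphic[OF assms(1,4,3,6) that])
qed (rule graph_isomorphic_imp_morita_equivalent[OF assms(1,4,5,6)])

end
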